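(* Let $P$ be a manifold and $n\in\mathbb{N}$. Then the following assertions hold: (a) If $(C^{\infty}(P),C_n,\alpha)$ is a trivial noncommutative principal $C_n$-bundle, and $\sigma:P\times C_n\rightarrow P$ denotes the induced (smooth, free and proper) action of $C_n$ on $P$, where $\sigma(p,\zeta^k)$ is the unique point of $P$ with $\delta_{\sigma(p,\zeta^k)}=\delta_p\circ\alpha(\zeta^k)$, then the corresponding principal bundle $(P,P/C_n,C_n,\mathrm{pr},\sigma)$, where $\mathrm{pr}:P\rightarrow P/C_n$ is the orbit map, is trivial. (b) Conversely, if $(P,M,C_n,q,\sigma)$ is a trivial principal $C_n$-bundle (total space $P$, base manifold $M$, projection $q$, right action $\sigma:P\times C_n\to P$), then the corresponding dynamical system $(C^{\infty}(P),C_n,\alpha)$ defined by \[\alpha:C_n\times C^{\infty}(P)\rightarrow C^{\infty}(P),\quad \alpha(\zeta^k,f)(p):=f(\sigma(p,\zeta^k)),\] is a trivial noncommutative principal $C_n$-bundle.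
   Context: Manifolds are finite-dimensional, paracompact, second countable and smooth; algebras are associative and complex; $C^\infty(P)$ is the algebra of smooth complex-valued functions with its usual locally convex topology (the smooth compact-open topology). For $p\in P$, $\delta_p$ denotes the point evaluation $f\mapsto f(p)$ on $C^{\infty}(P)$; the map $p\mapsto\delta_p$ is a bijection of $P$ onto the set of nonzero algebra homomorphisms $C^{\infty}(P)\to\mathbb{C}$. $C_n:=\{z\in\mathbb{C}^{\times}: z^n=1\}=\{\zeta^k: k=0,1,\ldots,n-1\}$ with $\zeta:=\exp(2\pi i/n)$. A dynamical system $(A,C_n,\alpha)$ consists of a unital locally convex algebra $A$ and a group homomorphism $\alpha:C_n\to\mathrm{Aut}(A)$ which induces a continuous action of $C_n$ on $A$. For $k=0,1,\ldots,n-1$ its isotypic components are $A_k:=\{a\in A:\alpha(\zeta).a=\zeta^k\cdot a\}$. A dynamical system $(A,C_n,\alpha)$ is called a trivial noncommutative principal $C_n$-bundle if each isotypic component $A_k$ contains an invertible element $a_k$ satisfying $a_k^n=1_A$. A principal $C_n$-bundle over $M$ is trivial if it is equivalent, as a principal bundle over $M$, to $M\times C_n$. *)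

theory Defs
  imports
    "HOL-Analysis.Analysis"
    "HOL-Algebra.Bij"
    "HOL-Algebra.Module"
begin

section \<open>Smooth functions on open subsets of a Euclidean vector space\<close>

primrec higher_differentiable_on ::
    "'e::real_normed_vector set \<Rightarrow> ('e \<Rightarrow> 'f::real_normed_vector) \<Rightarrow> nat \<Rightarrow> bool" where
  "higher_differentiable_on S f 0 \<longleftrightarrow> continuous_on S f"
| "higher_differentiable_on S f (Suc k) \<longleftrightarrow>
     (\<forall>x\<in>S. f differentiable (at x)) \<and>
     (\<forall>v. higher_differentiable_on S (\<lambda>x. frechet_derivative f (at x) v) k)"

text \<open>Only meaningful for open \<open>S\<close>.\<close>

definition smooth_on ::
    "'e::real_normed_vector set \<Rightarrow> ('e \<Rightarrow> 'f::real_normed_vector) \<Rightarrow> bool" where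
  "smooth_on S f \<longleftrightarrow> (\<forall>k. higher_differentiable_on S f k)"

text \<open>\<open>iter_deriv [v\<^sub>1, \<dots>, v\<^sub>k] f\<close> is the iterated directional derivative
  \<open>\<partial>\<^sub>v\<^sub>k \<dots> \<partial>\<^sub>v\<^sub>1 f\<close>.\<close>

primrec iter_deriv ::
    "'e::real_normed_vector list \<Rightarrow> ('e \<Rightarrow> 'f::real_normed_vector) \<Rightarrow> 'e \<Rightarrow> 'f" where
  "iter_deriv [] f = f"
| "iter_deriv (v # vs) f = iter_deriv vs (\<lambda>x. frechet_derivative f (at x) v)"


section \<open>Smooth manifolds\<close>

text \<open>A chart is a pair \<open>(U, \<phi>)\<close> of its domain and its coordinate map; the values of
  \<open>\<phi>\<close> outside \<open>U\<close> are irrelevant.  The atlas need not be maximal.\<close>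

record ('a, 'e) mfd =
  mtop :: "'a topology"
  atlas :: "('a set \<times> ('a \<Rightarrow> 'e)) set"

abbreviation pts :: "('a, 'e, 'z) mfd_scheme \<Rightarrow> 'a set" where
  "pts P \<equiv> topspace (mtop P)"

fun chart :: "'a topology \<Rightarrow> 'a set \<times> ('a \<Rightarrow> 'e::real_normed_vector) \<Rightarrow> bool" where
  "chart X (U, \<phi>) \<longleftrightarrow>
     openin X U \<and> open (\<phi> ` U) \<and>
     homeomorphic_map (subtopology X U) (top_of_set (\<phi> ` U)) \<phi>"

fun compatible ::
    "'a set \<times> ('a \<Rightarrow> 'e::real_normed_vector) \<Rightarrow> 'a set \<times> ('a \<Rightarrow> 'e) \<Rightarrow> bool" where
  "compatible (U, \<phi>) (V, \<psi>) \<longleftrightarrow>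
     smooth_on (\<phi> ` (U \<inter> V)) (\<psi> \<circ> inv_into U \<phi>) \<and>
     smooth_on (\<psi> ` (U \<inter> V)) (\<phi> \<circ> inv_into V \<psi>)"

definition paracompact_space :: "'a topology \<Rightarrow> bool" where
  "paracompact_space X \<longleftrightarrow>
     (\<forall>\<U>. (\<forall>U\<in>\<U>. openin X U) \<and> \<Union>\<U> = topspace X \<longrightarrow>
       (\<exists>\<V>. (\<forall>V\<in>\<V>. openin X V \<and> (\<exists>U\<in>\<U>. V \<subseteq> U)) \<and> \<Union>\<V> = topspace X \<and>
            locally_finite_in X \<V>))"

text \<open>The model space is a finite-dimensional real inner product space rather than a type of
  class \<open>euclidean_space\<close>, because the latter always has positive dimension and would
  exclude \<open>0\<close>-dimensional manifolds.\<close>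

definition manifold :: "('a, 'e::real_inner) mfd \<Rightarrow> bool" where
  "manifold P \<longleftrightarrow>
     (\<exists>B::'e set. finite B \<and> span B = UNIV) \<and>
     Hausdorff_space (mtop P) \<and> second_countable (mtop P) \<and> paracompact_space (mtop P) \<and>
     (\<forall>c\<in>atlas P. chart (mtop P) c) \<and>
     (\<Union>c\<in>atlas P. fst c) = pts P \<and>
     (\<forall>c\<in>atlas P. \<forall>d\<in>atlas P. compatible c d)"

definition maximal_atlas ::
    "('a, 'e::real_inner) mfd \<Rightarrow> ('a set \<times> ('a \<Rightarrow> 'e)) set" where
  "maximal_atlas P = {c. chart (mtop P) c \<and> (\<forall>d\<in>atlas P. compatible c d)}"

definition smooth_map ::
    "('a, 'e::real_inner) mfd \<Rightarrow> ('b, 'f::real_inner) mfd \<Rightarrow> ('a \<Rightarrow> 'b) \<Rightarrow> bool" where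
  "smooth_map P Q h \<longleftrightarrow>
     continuous_map (mtop P) (mtop Q) h \<and>
     (\<forall>(U, \<phi>)\<in>atlas P. \<forall>(V, \<psi>)\<in>atlas Q.
        smooth_on (\<phi> ` (U \<inter> h -` V)) (\<psi> \<circ> h \<circ> inv_into U \<phi>))"

definition diffeomorphism ::
    "('a, 'e::real_inner) mfd \<Rightarrow> ('b, 'f::real_inner) mfd \<Rightarrow> ('a \<Rightarrow> 'b) \<Rightarrow> bool" where
  "diffeomorphism P Q h \<longleftrightarrow>
     smooth_map P Q h \<and>
     (\<exists>k. smooth_map Q P k \<and> (\<forall>p\<in>pts P. k (h p) = p) \<and> (\<forall>x\<in>pts Q. h (k x) = x))"

definition open_submanifold :: "('a, 'e) mfd \<Rightarrow> 'a set \<Rightarrow> ('a, 'e) mfd" where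
  "open_submanifold P W =
     \<lparr>mtop = subtopology (mtop P) W, atlas = (\<lambda>(U, \<phi>). (U \<inter> W, \<phi>)) ` atlas P\<rparr>"

text \<open>The product with a discrete set, regarded as a \<open>0\<close>-dimensional manifold.\<close>

definition prod_discrete :: "('a, 'e) mfd \<Rightarrow> 'g set \<Rightarrow> ('a \<times> 'g, 'e) mfd" where
  "prod_discrete P G =
     \<lparr>mtop = prod_topology (mtop P) (discrete_topology G),
      atlas = {(U \<times> {g}, \<phi> \<circ> fst) | U \<phi> g. (U, \<phi>) \<in> atlas P \<and> g \<in> G}\<rparr>"


section \<open>Principal bundles with the cyclic group as structure group\<close>

definition zeta :: "nat \<Rightarrow> complex" where
  "zeta n = exp (2 * of_real pi * \<i> / of_nat n)"

definition Cn :: "nat \<Rightarrow> complex monoid" where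
  "Cn n = \<lparr>carrier = {z. z \<noteq> 0 \<and> z ^ n = 1}, mult = (*), one = 1\<rparr>"

definition smooth_action ::
    "nat \<Rightarrow> ('a, 'e::real_inner) mfd \<Rightarrow> ('a \<Rightarrow> complex \<Rightarrow> 'a) \<Rightarrow> bool" where
  "smooth_action n P \<sigma> \<longleftrightarrow>
     smooth_map (prod_discrete P (carrier (Cn n))) P (\<lambda>(p, z). \<sigma> p z) \<and>
     (\<forall>p\<in>pts P. \<sigma> p 1 = p) \<and>
     (\<forall>p\<in>pts P. \<forall>z\<in>carrier (Cn n). \<forall>w\<in>carrier (Cn n). \<sigma> (\<sigma> p z) w = \<sigma> p (z * w))"

definition free_action ::
    "nat \<Rightarrow> ('a, 'e) mfd \<Rightarrow> ('a \<Rightarrow> complex \<Rightarrow> 'a) \<Rightarrow> bool" where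
  "free_action n P \<sigma> \<longleftrightarrow> (\<forall>p\<in>pts P. \<forall>z\<in>carrier (Cn n). \<sigma> p z = p \<longrightarrow> z = 1)"

definition proper_action ::
    "nat \<Rightarrow> ('a, 'e) mfd \<Rightarrow> ('a \<Rightarrow> complex \<Rightarrow> 'a) \<Rightarrow> bool" where
  "proper_action n P \<sigma> \<longleftrightarrow>
     proper_map (prod_topology (mtop P) (discrete_topology (carrier (Cn n))))
       (prod_topology (mtop P) (mtop P)) (\<lambda>(p, z). (p, \<sigma> p z))"

text \<open>Equivalence of two spaces with projections \<open>q\<close>, \<open>q'\<close> to the same base and with right
  actions of \<open>C\<^sub>n\<close>: an equivariant diffeomorphism over the identity of the base.\<close>

definition bundle_equivalent ::
    "nat \<Rightarrow> ('a, 'e::real_inner) mfd \<Rightarrow> ('a \<Rightarrow> 'm) \<Rightarrow> ('a \<Rightarrow> complex \<Rightarrow> 'a) \<Rightarrow>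
     ('b, 'f::real_inner) mfd \<Rightarrow> ('b \<Rightarrow> 'm) \<Rightarrow> ('b \<Rightarrow> complex \<Rightarrow> 'b) \<Rightarrow> bool" where
  "bundle_equivalent n P q \<sigma> P' q' \<sigma>' \<longleftrightarrow>
     (\<exists>\<Phi>. diffeomorphism P P' \<Phi> \<and>
        (\<forall>p\<in>pts P. q' (\<Phi> p) = q p) \<and>
        (\<forall>p\<in>pts P. \<forall>z\<in>carrier (Cn n). \<Phi> (\<sigma> p z) = \<sigma>' (\<Phi> p) z))"

definition product_action :: "'m \<times> complex \<Rightarrow> complex \<Rightarrow> 'm \<times> complex" where
  "product_action = (\<lambda>(x, w) z. (x, w * z))"

definition principal_bundle ::
    "nat \<Rightarrow> ('a, 'e::real_inner) mfd \<Rightarrow> ('m, 'f::real_inner) mfd \<Rightarrow> ('a \<Rightarrow> 'm) \<Rightarrow>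
     ('a \<Rightarrow> complex \<Rightarrow> 'a) \<Rightarrow> bool" where
  "principal_bundle n P M q \<sigma> \<longleftrightarrow>
     manifold P \<and> manifold M \<and> smooth_map P M q \<and> smooth_action n P \<sigma> \<and>
     (\<forall>p\<in>pts P. \<forall>z\<in>carrier (Cn n). q (\<sigma> p z) = q p) \<and>
     (\<forall>x\<in>pts M. \<exists>U. openin (mtop M) U \<and> x \<in> U \<and>
        bundle_equivalent n
          (open_submanifold P {p \<in> pts P. q p \<in> U}) q \<sigma>
          (prod_discrete (open_submanifold M U) (carrier (Cn n))) fst product_action)"

definition trivial_principal_bundle ::
    "nat \<Rightarrow> ('a, 'e::real_inner) mfd \<Rightarrow> ('m, 'f::real_inner) mfd \<Rightarrow> ('a \<Rightarrow> 'm) \<Rightarrow>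
     ('a \<Rightarrow> complex \<Rightarrow> 'a) \<Rightarrow> bool" where
  "trivial_principal_bundle n P M q \<sigma> \<longleftrightarrow>
     principal_bundle n P M q \<sigma> \<and>
     bundle_equivalent n P q \<sigma> (prod_discrete M (carrier (Cn n))) fst product_action"

definition orbit_map :: "nat \<Rightarrow> ('a \<Rightarrow> complex \<Rightarrow> 'a) \<Rightarrow> 'a \<Rightarrow> 'a set" where
  "orbit_map n \<sigma> p = \<sigma> p ` carrier (Cn n)"

text \<open>The orbit space \<open>P/C\<^sub>n\<close> with the quotient topology; its charts are the charts of \<open>P\<close> on
  whose domains the orbit map is injective, transported along the orbit map.  For a free action
  of the finite group \<open>C\<^sub>n\<close> these domains cover \<open>P\<close>, and this is the smooth structure for which
  the orbit map is a local diffeomorphism.\<close>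

definition orbit_manifold ::
    "nat \<Rightarrow> ('a, 'e::real_inner) mfd \<Rightarrow> ('a \<Rightarrow> complex \<Rightarrow> 'a) \<Rightarrow> ('a set, 'e) mfd" where
  "orbit_manifold n P \<sigma> =
     \<lparr>mtop = topology (\<lambda>V. V \<subseteq> orbit_map n \<sigma> ` pts P \<and>
                openin (mtop P) {p \<in> pts P. orbit_map n \<sigma> p \<in> V}),
      atlas = {(orbit_map n \<sigma> ` U, \<phi> \<circ> inv_into U (orbit_map n \<sigma>)) | U \<phi>.
                (U, \<phi>) \<in> maximal_atlas P \<and> inj_on (orbit_map n \<sigma>) U}\<rparr>"


section \<open>Locally convex algebras and dynamical systems\<close>

record 'b lc_alg = "(complex, 'b) module" +
  topo :: "'b topology"

definition complex_ring :: "complex ring" where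
  "complex_ring = \<lparr>carrier = UNIV, mult = (*), one = 1, zero = 0, add = (+)\<rparr>"

definition unital_lc_algebra :: "'b lc_alg \<Rightarrow> bool" where
  "unital_lc_algebra A \<longleftrightarrow>
     ring A \<and> Module.module complex_ring A \<and>
     (\<forall>c. \<forall>a\<in>carrier A. \<forall>b\<in>carrier A.
        (c \<odot>\<^bsub>A\<^esub> a) \<otimes>\<^bsub>A\<^esub> b = c \<odot>\<^bsub>A\<^esub> (a \<otimes>\<^bsub>A\<^esub> b) \<and>
        a \<otimes>\<^bsub>A\<^esub> (c \<odot>\<^bsub>A\<^esub> b) = c \<odot>\<^bsub>A\<^esub> (a \<otimes>\<^bsub>A\<^esub> b)) \<and>
     topspace (topo A) = carrier A \<and>
     continuous_map (prod_topology (topo A) (topo A)) (topo A) (\<lambda>(a, b). a \<oplus>\<^bsub>A\<^esub> b) \<and>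
     continuous_map (prod_topology euclidean (topo A)) (topo A) (\<lambda>(c, a). c \<odot>\<^bsub>A\<^esub> a) \<and>
     continuous_map (prod_topology (topo A) (topo A)) (topo A) (\<lambda>(a, b). a \<otimes>\<^bsub>A\<^esub> b) \<and>
     (\<forall>W. openin (topo A) W \<and> \<zero>\<^bsub>A\<^esub> \<in> W \<longrightarrow>
        (\<exists>V. openin (topo A) V \<and> \<zero>\<^bsub>A\<^esub> \<in> V \<and> V \<subseteq> W \<and>
           (\<forall>a\<in>V. \<forall>b\<in>V. \<forall>t\<in>{0..1}.
              (complex_of_real t \<odot>\<^bsub>A\<^esub> a) \<oplus>\<^bsub>A\<^esub> (complex_of_real (1 - t) \<odot>\<^bsub>A\<^esub> b) \<in> V)))"

definition alg_Aut :: "'b lc_alg \<Rightarrow> ('b \<Rightarrow> 'b) monoid" where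
  "alg_Aut A = BijGroup (carrier A)
     \<lparr>carrier := {h \<in> Bij (carrier A). h \<in> ring_hom A A \<and>
                    (\<forall>c. \<forall>a\<in>carrier A. h (c \<odot>\<^bsub>A\<^esub> a) = c \<odot>\<^bsub>A\<^esub> h a)}\<rparr>"

definition dynamical_system ::
    "nat \<Rightarrow> 'b lc_alg \<Rightarrow> (complex \<Rightarrow> 'b \<Rightarrow> 'b) \<Rightarrow> bool" where
  "dynamical_system n A \<alpha> \<longleftrightarrow>
     unital_lc_algebra A \<and> \<alpha> \<in> hom (Cn n) (alg_Aut A) \<and>
     continuous_map (prod_topology (discrete_topology (carrier (Cn n))) (topo A)) (topo A)
       (\<lambda>(z, a). \<alpha> z a)"

definition isotypic ::
    "nat \<Rightarrow> 'b lc_alg \<Rightarrow> (complex \<Rightarrow> 'b \<Rightarrow> 'b) \<Rightarrow> nat \<Rightarrow> 'b set" where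
  "isotypic n A \<alpha> k = {a \<in> carrier A. \<alpha> (zeta n) a = (zeta n ^ k) \<odot>\<^bsub>A\<^esub> a}"

definition trivial_nc_principal_bundle ::
    "nat \<Rightarrow> 'b lc_alg \<Rightarrow> (complex \<Rightarrow> 'b \<Rightarrow> 'b) \<Rightarrow> bool" where
  "trivial_nc_principal_bundle n A \<alpha> \<longleftrightarrow>
     dynamical_system n A \<alpha> \<and>
     (\<forall>k<n. \<exists>a\<in>isotypic n A \<alpha> k. a \<in> Units A \<and> a [^]\<^bsub>A\<^esub> n = \<one>\<^bsub>A\<^esub>)"


section \<open>The algebra of smooth functions\<close>

text \<open>Smooth functions are made extensional so that they are determined by their values
  on the manifold.\<close>

definition smooth_functions :: "('a, 'e::real_inner) mfd \<Rightarrow> ('a \<Rightarrow> complex) set" where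
  "smooth_functions P =
     {f \<in> extensional (pts P). \<forall>(U, \<phi>)\<in>atlas P. smooth_on (\<phi> ` U) (f \<circ> inv_into U \<phi>)}"

text \<open>The smooth compact-open topology, given by the seminorms
  \<open>f \<mapsto> sup\<^sub>K |\<partial>\<^sub>v\<^sub>k \<dots> \<partial>\<^sub>v\<^sub>1 (f \<circ> \<phi>\<^sup>-\<^sup>1)|\<close> for charts \<open>(U, \<phi>)\<close>, compact
  \<open>K \<subseteq> \<phi>(U)\<close> and directions \<open>v\<^sub>1, \<dots>, v\<^sub>k\<close>: a subbasis consists of the open balls for these
  seminorms.  The whole space is added only for the case of an empty atlas.\<close>

definition smooth_topology :: "('a, 'e::real_inner) mfd \<Rightarrow> ('a \<Rightarrow> complex) topology" where
  "smooth_topology P = topology_generated_by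
     (insert (smooth_functions P)
       {{g \<in> smooth_functions P. \<forall>x\<in>K.
           cmod (iter_deriv vs (g \<circ> inv_into U \<phi>) x - iter_deriv vs (f \<circ> inv_into U \<phi>) x) < \<epsilon>}
        | f U \<phi> K vs \<epsilon>. f \<in> smooth_functions P \<and> (U, \<phi>) \<in> atlas P \<and>
            compact K \<and> K \<subseteq> \<phi> ` U \<and> \<epsilon> > 0})"

definition C_infinity :: "('a, 'e::real_inner) mfd \<Rightarrow> ('a \<Rightarrow> complex) lc_alg" where
  "C_infinity P =
     \<lparr>carrier = smooth_functions P,
      mult = (\<lambda>f g. \<lambda>p\<in>pts P. f p * g p),
      one = (\<lambda>p\<in>pts P. 1),
      zero = (\<lambda>p\<in>pts P. 0),
      add = (\<lambda>f g. \<lambda>p\<in>pts P. f p + g p),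
      smult = (\<lambda>c f. \<lambda>p\<in>pts P. c * f p),
      topo = smooth_topology P\<rparr>"

definition point_eval :: "('a, 'e::real_inner) mfd \<Rightarrow> 'a \<Rightarrow> ('a \<Rightarrow> complex) \<Rightarrow> complex" where
  "point_eval P p = (\<lambda>f\<in>carrier (C_infinity P). f p)"

definition induced_action ::
    "('a, 'e::real_inner) mfd \<Rightarrow> (complex \<Rightarrow> ('a \<Rightarrow> complex) \<Rightarrow> 'a \<Rightarrow> complex) \<Rightarrow>
     'a \<Rightarrow> complex \<Rightarrow> 'a" where
  "induced_action P \<alpha> p z =
     (THE r. r \<in> pts P \<and>
        point_eval P r = compose (carrier (C_infinity P)) (point_eval P p) (\<alpha> z))"

definition pullback_action ::
    "('a, 'e::real_inner) mfd \<Rightarrow> ('a \<Rightarrow> complex \<Rightarrow> 'a) \<Rightarrow>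
     complex \<Rightarrow> ('a \<Rightarrow> complex) \<Rightarrow> 'a \<Rightarrow> complex" where
  "pullback_action P \<sigma> z = (\<lambda>f\<in>carrier (C_infinity P). \<lambda>p\<in>pts P. f (\<sigma> p z))"

end

theory Submission
  imports Defs
begin

text \<open>
  (a) Composing an evaluation with \<open>\<alpha>(\<zeta>\<^sup>k)\<close> gives a continuous character of \<open>C\<^sup>\<infinity>(P)\<close>. Such a character depends only
  on the germ of a function along a compact set, and a compactness argument shows that it is again an
  evaluation; since smooth functions separate points and detect smoothness, this gives a smooth action \<open>\<sigma>\<close>.
  An element \<open>a\<close> of the first isotypic component with \<open>a\<^sup>n = 1\<close> is a locally constant map \<open>P \<rightarrow> C\<^sub>n\<close> with
  \<open>a(\<sigma>(p,z)) = z a(p)\<close>. Hence \<open>\<sigma>\<close> is free, the orbit map restricts to a bijection from \<open>{a = 1}\<close> onto the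
  orbit space, and \<open>p \<mapsto> (pr(p), a(p))\<close> trivialises the bundle.
  (b) The \<open>C\<^sub>n\<close>-component \<open>u\<close> of a trivialisation is locally constant and equivariant, so \<open>u\<^sup>k\<close> is the required
  element of the \<open>k\<close>-th isotypic component.
\<close>


section \<open>Finite-dimensional inner product spaces\<close>

text \<open>Two features of the definitions shape the work. The model space may have dimension 0, so
  no canonical basis is at hand; finite sets with
  \<open>(\<Sum>c\<in>C. (x \<bullet> c) *\<^sub>R c) = x\<close> replace it, and both the chain
  rule and the compactness of closed balls are drawn from this identity. Moreover, a dynamical
  system acts continuously, so an evaluation composed with the action is a continuous character; a
  compact set supplied by the topology then does what an exhausting function does in the classical
  argument for arbitrary characters. The orbit space is hardly treated as an abstract quotient: the
  label gives a continuous section of the orbit map, through which the Hausdorff property, second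
  countability and paracompactness are carried over. The converse needs little geometry, but the
  system in it must be shown to be one: products and pullbacks have to be continuous for the smooth
  compact-open topology. This is why iterated derivatives of products and composites are first
  expanded into finite sums whose shape does not vary with the functions.\<close>

definition parseval_frame :: "'e::real_inner set \<Rightarrow> bool" where
  "parseval_frame C \<longleftrightarrow> finite C \<and> (\<forall>x. (\<Sum>c\<in>C. (x \<bullet> c) *\<^sub>R c) = x)"

text \<open>Orthogonalise a finite spanning set and normalise its nonzero members. The zero vector
  has to be discarded because orthogonalisation may leave it in the set; in dimension 0 nothing
  remains and the frame is empty.\<close>

lemma parseval_frame_exists:
  assumes "\<exists>B::'e set. finite B \<and> span B = UNIV"
  obtains C :: "'e::real_inner set" where "parseval_frame C"
proof -
  obtain B :: "'e set" where "finite B" "span B = UNIV"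
    using assms by blast
  then obtain C :: "'e set" where C: "finite C" "span C = UNIV" "pairwise orthogonal C"
    using basis_orthogonal by metis
  define D where "D = (\<lambda>c. c /\<^sub>R norm c) ` (C - {0})"
  \<comment> \<open>Orthogonal vectors with equal normalisations would give a unit vector orthogonal
    to itself. Injectivity is what allows the sum over \<open>D\<close> to be rewritten as a sum
    over \<open>C - {0}\<close>.\<close>
  have inj: "inj_on (\<lambda>c. c /\<^sub>R norm c) (C - {0})"
  proof (rule inj_onI, rule ccontr)
    fix a b assume ab: "a \<in> C - {0}" "b \<in> C - {0}" "a /\<^sub>R norm a = b /\<^sub>R norm b" "a \<noteq> b"
    then have "a \<bullet> b = 0"
      using C(3) by (auto simp: pairwise_def orthogonal_def)
    then have "(a /\<^sub>R norm a) \<bullet> (b /\<^sub>R norm b) = 0" by simp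
    with ab(3) have "(b /\<^sub>R norm b) \<bullet> (b /\<^sub>R norm b) = 0" by simp
    then show False using ab by simp
  qed
  \<comment> \<open>Both sides are linear in \<open>x\<close>, so induction over the span reduces
    the expansion to members of \<open>C\<close>, where orthogonality leaves at most one
    term.\<close>
  have *: "(\<Sum>c\<in>C - {0}. ((x \<bullet> c) / (c \<bullet> c)) *\<^sub>R c) = x" for x
  proof -
    have "x \<in> span C" using C by simp
    then show ?thesis
    proof (induction rule: span_induct_alt)
      case base
      then show ?case by simp
    next
      case (step a d y)
      have "(\<Sum>c\<in>C - {0}. (((a *\<^sub>R d + y) \<bullet> c) / (c \<bullet> c)) *\<^sub>R c)
          = a *\<^sub>R (\<Sum>c\<in>C - {0}. ((d \<bullet> c) / (c \<bullet> c)) *\<^sub>R c)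
            + (\<Sum>c\<in>C - {0}. ((y \<bullet> c) / (c \<bullet> c)) *\<^sub>R c)"
        by (simp add: inner_add_left add_divide_distrib scaleR_add_left sum.distrib scaleR_sum_right)
      also have "(\<Sum>c\<in>C - {0}. ((d \<bullet> c) / (c \<bullet> c)) *\<^sub>R c)
          = (\<Sum>c\<in>C - {0}. if c = d then d else 0)"
        by (rule sum.cong) (use step(1) C(3) in \<open>auto simp: pairwise_def orthogonal_def\<close>)
      also have "\<dots> = d" using C(1) step(1) by auto
      finally show ?case using step by simp
    qed
  qed
  have "(\<Sum>c\<in>D. (x \<bullet> c) *\<^sub>R c) = x" for x
  proof -
    have "(\<Sum>c\<in>D. (x \<bullet> c) *\<^sub>R c) = (\<Sum>c\<in>C - {0}. ((x \<bullet> c) / (c \<bullet> c)) *\<^sub>R c)"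
      unfolding D_def sum.reindex[OF inj] comp_def
      by (rule sum.cong)
         (auto simp: power2_norm_eq_inner[symmetric] power2_eq_square divide_inverse ac_simps)
    with * show ?thesis by simp
  qed
  then have "parseval_frame D"
    using C(1) by (auto simp: parseval_frame_def D_def)
  then show ?thesis using that by blast
qed

lemma parseval_frame_Basis: "parseval_frame (Basis :: 'a::euclidean_space set)"
  by (simp add: parseval_frame_def euclidean_representation)

text \<open>Heine-Borel for a space known only through a frame: the vectors with coefficients
  bounded by \<open>s\<close> form a finite Minkowski sum of compact segments, and the ball is a
  closed subset of such a box. The bound \<open>s\<close> is the Cauchy-Schwarz estimate, with the
  sum of all norms serving every frame vector at once.\<close>

lemma compact_cball_parseval_frame:
  fixes a :: "'e::real_inner"
  assumes "parseval_frame (C :: 'e set)"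
  shows "compact (cball a r)"
proof -
  let ?box = "\<lambda>D s. {\<Sum>c\<in>D. t c *\<^sub>R c | t. \<forall>c\<in>D. \<bar>t c\<bar> \<le> s}"
  have box: "compact (?box D s)" if "finite D" for D :: "'e set" and s
    using that
  proof (induction D rule: finite_induct)
    case empty
    then show ?case by simp
  next
    case (insert d D)
    have "compact ((\<lambda>t. t *\<^sub>R d) ` {-s..s})"
      by (intro compact_continuous_image continuous_intros) auto
    with insert have "compact {x + y | x y. x \<in> (\<lambda>t. t *\<^sub>R d) ` {-s..s} \<and>
        y \<in> ?box D s}"
      by (intro compact_sums) auto
    also have "\<dots> = ?box (insert d D) s" (is "?L = ?R")
    proof
      show "?L \<subseteq> ?R"
      proof
        fix z assume "z \<in> ?L"
        then obtain a t where t: "z = a *\<^sub>R d + (\<Sum>c\<in>D. t c *\<^sub>R c)" "a \<in> {-s..s}" "\<forall>c\<in>D. \<bar>t c\<bar> \<le> s"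
          by blast
        have "z = (\<Sum>c\<in>insert d D. (t(d := a)) c *\<^sub>R c)"
          using insert t(1) by (auto intro!: sum.cong)
        moreover have "\<forall>c\<in>insert d D. \<bar>(t(d := a)) c\<bar> \<le> s" using t by auto
        ultimately show "z \<in> ?R" by blast
      qed
      show "?R \<subseteq> ?L"
        using insert by (fastforce simp: abs_le_iff)
    qed
    finally show ?case .
  qed
  define s where "s = (norm a + r) * (\<Sum>c\<in>C. norm c)"
  have fin: "finite C" using assms by (simp add: parseval_frame_def)
  have "cball a r \<subseteq> ?box C s"
  proof
    fix x assume x: "x \<in> cball a r"
    have "norm x \<le> norm a + r"
      using x norm_triangle_sub[of x a] by (simp add: dist_norm norm_minus_commute)
    have "\<bar>x \<bullet> c\<bar> \<le> s" if "c \<in> C" for c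
    proof -
      have "\<bar>x \<bullet> c\<bar> \<le> norm x * norm c" by (rule Cauchy_Schwarz_ineq2)
      also have "\<dots> \<le> s"
        unfolding s_def using \<open>norm x \<le> norm a + r\<close> that fin order_trans[OF norm_ge_zero \<open>norm x \<le> norm a + r\<close>]
        by (intro mult_mono member_le_sum) auto
      finally show ?thesis .
    qed
    moreover have "x = (\<Sum>c\<in>C. (x \<bullet> c) *\<^sub>R c)" using assms by (simp add: parseval_frame_def)
    ultimately show "x \<in> ?box C s"
      by blast
  qed
  then have "cball a r = ?box C s \<inter> cball a r"
    by blast
  then show ?thesis
    using compact_Int_closed[OF box[OF fin, of s] closed_cball[of a r]] by simp
qed


section \<open>Calculus of smooth functions on open sets\<close>

text \<open>\<open>frechet_derivative\<close> chooses among the derivatives at a point. Functions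
  that agree near the point have the same set of derivatives, so the choices coincide even where
  this set is empty.\<close>

lemma frechet_derivative_cong_open:
  assumes "open S" "x \<in> S" "\<And>y. y \<in> S \<Longrightarrow> f y = g y"
  shows "frechet_derivative f (at x) = frechet_derivative g (at x)"
proof -
  have "(f has_derivative D) (at x) \<longleftrightarrow> (g has_derivative D) (at x)" for D
    using assms has_derivative_transform_within_open[of _ D x UNIV S] by metis
  then show ?thesis by (simp add: frechet_derivative_def)
qed

lemma higher_differentiable_on_cong:
  assumes "open S" "\<And>x. x \<in> S \<Longrightarrow> f x = g x" "higher_differentiable_on S f k"
  shows "higher_differentiable_on S g k"
  using assms(2,3)
proof (induction k arbitrary: f g)
  case 0
  then show ?case by (metis continuous_on_cong higher_differentiable_on.simps(1))
next
  case (Suc k)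
  have "g differentiable (at x)" if "x \<in> S" for x
  proof -
    have "f differentiable (at x)"
      using Suc.prems(2) that by simp
    then obtain D where "(f has_derivative D) (at x)"
      unfolding differentiable_def ..
    then have "(g has_derivative D) (at x)"
      using assms(1) that Suc.prems(1) by (rule has_derivative_transform_within_open)
    then show ?thesis by (auto simp: differentiable_def)
  qed
  moreover have "higher_differentiable_on S (\<lambda>x. frechet_derivative g (at x) v) k" for v
    by (rule Suc.IH[of "\<lambda>x. frechet_derivative f (at x) v"])
       (use Suc.prems frechet_derivative_cong_open[OF assms(1), of _ f g] in auto)
  ultimately show ?case by simp
qed

lemma higher_differentiable_on_subset:
  "higher_differentiable_on S f k \<Longrightarrow> T \<subseteq> S \<Longrightarrow> higher_differentiable_on T f k"
  by (induction k arbitrary: f) (auto intro: continuous_on_subset)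

text \<open>Derivatives are taken in the full space at each point, so differentiability can be
  tested locally. This permits different formulas for one function on different pieces of a chart
  image.\<close>

lemma higher_differentiable_on_local:
  assumes "\<And>x. x \<in> S \<Longrightarrow> \<exists>T. open T \<and> x \<in> T \<and> higher_differentiable_on T f k"
  shows "higher_differentiable_on S f k"
  using assms
proof (induction k arbitrary: f)
  case 0
  then have "isCont f x" if "x \<in> S" for x
    using that by (metis continuous_on_eq_continuous_at higher_differentiable_on.simps(1))
  then show ?case by (simp add: continuous_at_imp_continuous_on)
next
  case (Suc k)
  have "f differentiable (at x)" if "x \<in> S" for x
    using Suc.prems[OF that] by auto
  moreover have "higher_differentiable_on S (\<lambda>x. frechet_derivative f (at x) v) k" for v
  proof (rule Suc.IH)
    fix x assume "x \<in> S"
    then obtain T where "open T" "x \<in> T" "higher_differentiable_on T f (Suc k)"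
      using Suc.prems by blast
    then show "\<exists>T. open T \<and> x \<in> T \<and> higher_differentiable_on T (\<lambda>x. frechet_derivative f (at x) v) k"
      by auto
  qed
  ultimately show ?case by simp
qed

lemma higher_differentiable_on_Suc_imp:
  "higher_differentiable_on S f (Suc k) \<Longrightarrow> higher_differentiable_on S f k"
proof (induction k arbitrary: f)
  case 0
  then show ?case
    by (auto intro!: continuous_at_imp_continuous_on differentiable_imp_continuous_within)
next
  case (Suc k)
  have "f differentiable (at x)" if "x \<in> S" for x
    using Suc.prems that by simp
  moreover have "higher_differentiable_on S (\<lambda>x. frechet_derivative f (at x) v) k" for v
    using Suc.prems by (intro Suc.IH) (simp only: higher_differentiable_on.simps(2)[of S f "Suc k"])
  ultimately show ?case by simp
qed

lemma higher_differentiable_on_const: "higher_differentiable_on S (\<lambda>x. c) k"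
  by (induction k arbitrary: c) auto

lemma higher_differentiable_on_bounded_linear_comp:
  assumes "bounded_linear L" "open S" "higher_differentiable_on S f k"
  shows "higher_differentiable_on S (\<lambda>x. L (f x)) k"
  using assms(3)
proof (induction k arbitrary: f)
  case 0
  then show ?case
    using bounded_linear.continuous_on[OF assms(1)] by auto
next
  case (Suc k)
  have D: "((\<lambda>x. L (f x)) has_derivative (\<lambda>v. L (frechet_derivative f (at x) v))) (at x)" if "x \<in> S" for x
    using Suc.prems that by (intro bounded_linear.has_derivative[OF assms(1)]) (simp add: frechet_derivative_works)
  have "higher_differentiable_on S (\<lambda>x. frechet_derivative (\<lambda>x. L (f x)) (at x) v) k" for v
    by (rule higher_differentiable_on_cong[OF assms(2) _ Suc.IH[of "\<lambda>x. frechet_derivative f (at x) v"]])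
       (use Suc.prems frechet_derivative_at[OF D] in \<open>auto dest: fun_cong\<close>)
  then show ?case using D by (auto simp: differentiable_def)
qed

lemma higher_differentiable_on_add:
  assumes "open S" "higher_differentiable_on S f k" "higher_differentiable_on S g k"
  shows "higher_differentiable_on S (\<lambda>x. f x + g x) k"
  using assms(2,3)
proof (induction k arbitrary: f g)
  case 0
  then show ?case by (auto intro: continuous_intros)
next
  case (Suc k)
  have D: "((\<lambda>x. f x + g x) has_derivative
      (\<lambda>v. frechet_derivative f (at x) v + frechet_derivative g (at x) v)) (at x)" if "x \<in> S" for x
    using Suc.prems that by (intro has_derivative_add) (auto simp: frechet_derivative_works)
  have "higher_differentiable_on S (\<lambda>x. frechet_derivative (\<lambda>x. f x + g x) (at x) v) k" for v
    by (rule higher_differentiable_on_cong[OF assms(1) _ Suc.IH[of "\<lambda>x. frechet_derivative f (at x) v" "\<lambda>x. frechet_derivative g (at x) v"]])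
       (use Suc.prems frechet_derivative_at[OF D] in \<open>auto dest: fun_cong\<close>)
  then show ?case using D by (auto simp: differentiable_def)
qed

lemma higher_differentiable_on_sum:
  assumes "open S" "\<And>i. i \<in> I \<Longrightarrow> higher_differentiable_on S (f i) k"
  shows "higher_differentiable_on S (\<lambda>x. \<Sum>i\<in>I. f i x) k"
  using assms(2)
  by (induction I rule: infinite_finite_induct)
     (auto intro: higher_differentiable_on_const higher_differentiable_on_add[OF assms(1)])

lemma higher_differentiable_on_bilinear:
  assumes B: "bounded_bilinear B" and "open S"
    and "higher_differentiable_on S f k" "higher_differentiable_on S g k"
  shows "higher_differentiable_on S (\<lambda>x. B (f x) (g x)) k"
  using assms(3,4)
proof (induction k arbitrary: f g)
  case 0
  then show ?case by (auto intro: bounded_bilinear.continuous_on[OF B])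
next
  case (Suc k)
  have D: "((\<lambda>x. B (f x) (g x)) has_derivative
      (\<lambda>v. B (f x) (frechet_derivative g (at x) v) + B (frechet_derivative f (at x) v) (g x))) (at x)" if "x \<in> S" for x
    using Suc.prems that by (intro bounded_bilinear.FDERIV[OF B]) (auto simp: frechet_derivative_works)
  have "higher_differentiable_on S (\<lambda>x. frechet_derivative (\<lambda>x. B (f x) (g x)) (at x) v) k" for v
  proof (rule higher_differentiable_on_cong[OF assms(2)])
    show "higher_differentiable_on S (\<lambda>x. B (f x) (frechet_derivative g (at x) v)
        + B (frechet_derivative f (at x) v) (g x)) k"
      using Suc.prems higher_differentiable_on_Suc_imp[of S f k] higher_differentiable_on_Suc_imp[of S g k]
      by (intro higher_differentiable_on_add[OF assms(2)] Suc.IH) auto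
  qed (use frechet_derivative_at[OF D] in \<open>auto dest: fun_cong\<close>)
  then show ?case using D by (auto simp: differentiable_def)
qed

text \<open>In the chain rule the outer function is differentiated in a direction that moves with
  \<open>x\<close>, while the induction hypothesis speaks of fixed directions. Expanding the moving
  direction in the frame turns the derivative into a finite sum of products of a scalar coefficient
  with a composite of lower order.\<close>

lemma higher_differentiable_on_compose:
  fixes f :: "'d::real_normed_vector \<Rightarrow> 'e::real_inner" and g :: "'e \<Rightarrow> 'f::real_normed_vector"
  assumes C: "parseval_frame (C :: 'e set)" and S: "open S" and fS: "f ` S \<subseteq> T"
    and "higher_differentiable_on S f k" "higher_differentiable_on T g k"
  shows "higher_differentiable_on S (\<lambda>x. g (f x)) k"
  using assms(4,5)
proof (induction k arbitrary: g)
  case 0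
  then show ?case using fS by (auto intro: continuous_on_compose2)
next
  case (Suc k)
  have D: "((\<lambda>x. g (f x)) has_derivative
      (\<lambda>v. frechet_derivative g (at (f x)) (frechet_derivative f (at x) v))) (at x)" if "x \<in> S" for x
    using Suc.prems that fS diff_chain_at[of f _ x g] by (auto simp: frechet_derivative_works comp_def)
  have "higher_differentiable_on S (\<lambda>x. frechet_derivative (\<lambda>x. g (f x)) (at x) v) k" for v
  proof (rule higher_differentiable_on_cong[OF S])
    show "higher_differentiable_on S (\<lambda>x. \<Sum>c\<in>C. (frechet_derivative f (at x) v \<bullet> c) *\<^sub>R frechet_derivative g (at (f x)) c) k"
      using Suc.prems higher_differentiable_on_Suc_imp[of S f k]
      by (intro higher_differentiable_on_sum higher_differentiable_on_bilinear[OF bounded_bilinear_scaleR]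
          higher_differentiable_on_bounded_linear_comp[OF bounded_linear_inner_left] S
          Suc.IH[of "\<lambda>y. frechet_derivative g (at y) _"]) auto
    fix x assume x: "x \<in> S"
    have lin: "linear (frechet_derivative g (at (f x)))"
      using Suc.prems x fS by (intro linear_frechet_derivative) auto
    have "frechet_derivative (\<lambda>x. g (f x)) (at x) v = frechet_derivative g (at (f x)) (frechet_derivative f (at x) v)"
      using fun_cong[OF frechet_derivative_at[OF D[OF x]]] by simp
    also have "\<dots> = frechet_derivative g (at (f x)) (\<Sum>c\<in>C. (frechet_derivative f (at x) v \<bullet> c) *\<^sub>R c)"
      using C by (simp add: parseval_frame_def)
    also have "\<dots> = (\<Sum>c\<in>C. (frechet_derivative f (at x) v \<bullet> c) *\<^sub>R frechet_derivative g (at (f x)) c)"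
      by (simp add: linear_sum[OF lin] linear_scale[OF lin])
    finally show "(\<Sum>c\<in>C. (frechet_derivative f (at x) v \<bullet> c) *\<^sub>R frechet_derivative g (at (f x)) c)
        = frechet_derivative (\<lambda>x. g (f x)) (at x) v" by simp
  qed
  then show ?case using D by (auto simp: differentiable_def)
qed

section \<open>Closure properties of functions that are smooth of all orders\<close>

lemma smooth_on_cong:
  "open S \<Longrightarrow> smooth_on S f \<Longrightarrow> (\<And>x. x \<in> S \<Longrightarrow> f x = g x) \<Longrightarrow> smooth_on S g"
  unfolding smooth_on_def using higher_differentiable_on_cong by blast

lemma smooth_on_subset: "smooth_on S f \<Longrightarrow> T \<subseteq> S \<Longrightarrow> smooth_on T f"
  unfolding smooth_on_def using higher_differentiable_on_subset by blast

lemma smooth_on_local: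
  assumes "\<And>x. x \<in> S \<Longrightarrow> \<exists>T. open T \<and> x \<in> T \<and> smooth_on T f"
  shows "smooth_on S f"
  unfolding smooth_on_def
proof
  fix k
  show "higher_differentiable_on S f k"
    by (rule higher_differentiable_on_local) (metis assms smooth_on_def)
qed

lemma smooth_on_continuous_on: "smooth_on S f \<Longrightarrow> continuous_on S f"
  unfolding smooth_on_def by (drule spec[of _ 0]) simp

lemma smooth_on_differentiable: "smooth_on S f \<Longrightarrow> x \<in> S \<Longrightarrow> f differentiable (at x)"
  unfolding smooth_on_def by (drule spec[of _ 1]) simp

lemma smooth_on_frechet_derivative: "smooth_on S f \<Longrightarrow> smooth_on S (\<lambda>x. frechet_derivative f (at x) v)"
  unfolding smooth_on_def
proof
  fix k assume "\<forall>k. higher_differentiable_on S f k"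
  then have "higher_differentiable_on S f (Suc k)" ..
  then show "higher_differentiable_on S (\<lambda>x. frechet_derivative f (at x) v) k" by simp
qed

lemma smooth_on_const: "smooth_on S (\<lambda>x. c)"
  by (simp add: smooth_on_def higher_differentiable_on_const)

lemma smooth_on_id: "smooth_on S (\<lambda>x. x)"
proof -
  have "higher_differentiable_on S (\<lambda>x. x) k" for k
    by (cases k) (auto intro: higher_differentiable_on_const)
  then show ?thesis by (simp add: smooth_on_def)
qed

lemma smooth_on_bounded_linear_comp:
  "bounded_linear L \<Longrightarrow> open S \<Longrightarrow> smooth_on S f \<Longrightarrow> smooth_on S (\<lambda>x. L (f x))"
  by (auto simp: smooth_on_def intro: higher_differentiable_on_bounded_linear_comp)

lemma smooth_on_add:
  "open S \<Longrightarrow> smooth_on S f \<Longrightarrow> smooth_on S g \<Longrightarrow> smooth_on S (\<lambda>x. f x + g x)"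
  by (auto simp: smooth_on_def intro: higher_differentiable_on_add)

lemma smooth_on_diff:
  assumes "open S" "smooth_on S f" "smooth_on S g"
  shows "smooth_on S (\<lambda>x. f x - g x)"
  using smooth_on_add[OF assms(1,2)
      smooth_on_bounded_linear_comp[OF bounded_linear_minus[OF bounded_linear_ident] assms(1,3)]]
  by simp

lemma smooth_on_sum:
  "open S \<Longrightarrow> (\<And>i. i \<in> I \<Longrightarrow> smooth_on S (f i)) \<Longrightarrow> smooth_on S (\<lambda>x. \<Sum>i\<in>I. f i x)"
  by (auto simp: smooth_on_def intro: higher_differentiable_on_sum)

lemma smooth_on_bilinear:
  "bounded_bilinear B \<Longrightarrow> open S \<Longrightarrow> smooth_on S f \<Longrightarrow> smooth_on S g \<Longrightarrow> smooth_on S (\<lambda>x. B (f x) (g x))"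
  by (auto simp: smooth_on_def intro: higher_differentiable_on_bilinear)

lemmas smooth_on_mult = smooth_on_bilinear[OF bounded_bilinear_mult]
lemmas smooth_on_scaleR = smooth_on_bilinear[OF bounded_bilinear_scaleR]

lemma smooth_on_compose:
  fixes f :: "'d::real_normed_vector \<Rightarrow> 'e::real_inner" and g :: "'e \<Rightarrow> 'f::real_normed_vector"
  assumes "parseval_frame (C :: 'e set)" "open S" "f ` S \<subseteq> T" "smooth_on S f" "smooth_on T g"
  shows "smooth_on S (\<lambda>x. g (f x))"
  using assms higher_differentiable_on_compose[OF assms(1,2,3)] unfolding smooth_on_def by blast

text \<open>The derivative is again a product of copies of \<open>inverse\<close> with a constant,
  so the induction on the order feeds on itself.\<close>

lemma smooth_on_inverse: "smooth_on (- {0}) (inverse :: complex \<Rightarrow> complex)"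
proof -
  have D: "((inverse :: complex \<Rightarrow> complex) has_derivative (\<lambda>v. - (inverse x * v * inverse x))) (at x)"
    if "x \<in> - {0}" for x :: complex
    using that has_derivative_inverse'[of x UNIV] by auto
  have op: "open (- {0 :: complex})" by auto
  have "higher_differentiable_on (- {0}) (inverse :: complex \<Rightarrow> complex) k" for k
  proof (induction k)
    case 0
    then show ?case by (auto intro!: continuous_intros)
  next
    case (Suc k)
    have "higher_differentiable_on (- {0::complex}) (\<lambda>x. frechet_derivative inverse (at x) v) k" for v
    proof (rule higher_differentiable_on_cong[OF op])
      show "higher_differentiable_on (- {0::complex}) (\<lambda>x. - ((inverse x * v) * inverse x)) k"
        by (intro higher_differentiable_on_bounded_linear_comp[OF bounded_linear_minus[OF bounded_linear_ident]]
            higher_differentiable_on_bilinear[OF bounded_bilinear_mult] Suc op higher_differentiable_on_const)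
    qed (use frechet_derivative_at[OF D] in \<open>auto dest: fun_cong\<close>)
    then show ?case using D by (auto simp: differentiable_def)
  qed
  then show ?thesis by (simp add: smooth_on_def)
qed

text \<open>The powers of \<open>1/t\<close> make the family closed under differentiation.\<close>

definition flat :: "nat \<Rightarrow> real \<Rightarrow> real" where
  "flat k t = (if t > 0 then inverse t ^ k * exp (- inverse t) else 0)"

lemma flat_pos: "t > 0 \<Longrightarrow> flat k t > 0"
  by (simp add: flat_def)

lemma flat_nonpos: "t \<le> 0 \<Longrightarrow> flat k t = 0"
  by (simp add: flat_def)

text \<open>In the variable \<open>1/t\<close> the limit from the right says that the exponential
  dominates every power; on the left the function is constantly 0.\<close>

lemma flat_tendsto_0: "(flat k \<longlongrightarrow> 0) (at 0)"
proof -
  have "((\<lambda>x::real. x ^ k / exp x) \<longlongrightarrow> 0) at_top"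
    by (rule tendsto_power_div_exp_0)
  then have "((\<lambda>t::real. inverse t ^ k / exp (inverse t)) \<longlongrightarrow> 0) (at_right 0)"
    by (rule filterlim_compose[OF _ filterlim_inverse_at_top_right])
  moreover have "\<forall>\<^sub>F t in at_right 0. inverse t ^ k / exp (inverse t) = flat k t"
    by (auto simp: eventually_at_right_field flat_def exp_minus divide_inverse intro!: exI[of _ 1])
  ultimately have "(flat k \<longlongrightarrow> 0) (at_right 0)"
    by (rule Lim_transform_eventually)
  moreover have "(flat k \<longlongrightarrow> 0) (at_left 0)"
    by (rule Lim_transform_eventually[OF tendsto_const])
       (auto simp: eventually_at_left_field flat_def intro!: exI[of _ "-1"])
  ultimately show ?thesis by (simp add: filterlim_split_at)
qed

lemma flat_has_derivative:
  "(flat k has_field_derivative flat (k + 2) t - real k * flat (k + 1) t) (at t)"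
proof -
  consider "t > 0" | "t < 0" | "t = 0" by linarith
  then show ?thesis
  proof cases
    case 1
    have "((\<lambda>t. inverse t ^ k * exp (- inverse t)) has_field_derivative
        flat (k + 2) t - real k * flat (k + 1) t) (at t)"
    proof (rule DERIV_cong)
      show "((\<lambda>t. inverse t ^ k * exp (- inverse t)) has_field_derivative
          real k * inverse t ^ (k - 1) * (- (inverse t * inverse t)) * exp (- inverse t)
          + inverse t ^ k * (exp (- inverse t) * (inverse t * inverse t))) (at t)"
        using 1 by (auto intro!: derivative_eq_intros simp: algebra_simps)
    \<comment> \<open>For \<open>k = 0\<close> the truncated exponent \<open>k - 1\<close> does no
      harm, as the factor \<open>real k\<close> vanishes.\<close>
    qed (use 1 in \<open>cases k; simp add: flat_def algebra_simps\<close>)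
    then show ?thesis
      by (rule has_field_derivative_transform_within_open[where S = "{0<..}"]) (use 1 in \<open>auto simp: flat_def\<close>)
  next
    case 2
    have "((\<lambda>t. 0) has_field_derivative flat (k + 2) t - real k * flat (k + 1) t) (at t)"
      using 2 by (simp add: flat_def)
    then show ?thesis
      by (rule has_field_derivative_transform_within_open[where S = "{..<0}"]) (use 2 in \<open>auto simp: flat_def\<close>)
  next
    case 3
    \<comment> \<open>The difference quotient of \<open>flat k\<close> at 0 is
      \<open>flat (Suc k)\<close>, so the limit just established for the whole family says that the
      derivative at 0 is 0.\<close>
    have "((\<lambda>h. (flat k (0 + h) - flat k 0) / h) \<longlongrightarrow> 0) (at 0)"
      by (rule Lim_transform_eventually[OF flat_tendsto_0[of "Suc k"]])
         (auto simp: flat_def divide_inverse ac_simps)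
    then show ?thesis using 3 by (simp add: DERIV_def flat_nonpos)
  qed
qed

lemma smooth_on_flat: "smooth_on UNIV (flat k)"
proof -
  have D: "(flat k has_derivative (\<lambda>v. (flat (k + 2) t - real k * flat (k + 1) t) * v)) (at t)" for k t
    using flat_has_derivative by (simp add: has_field_derivative_def mult_commute_abs)
  have "higher_differentiable_on UNIV (flat k) m" for m
  proof (induction m arbitrary: k)
    case 0
    then show ?case
      using DERIV_isCont[OF flat_has_derivative] by (simp add: continuous_at_imp_continuous_on)
  next
    case (Suc m)
    have "higher_differentiable_on UNIV (\<lambda>t. frechet_derivative (flat k) (at t) v) m" for v
    proof (rule higher_differentiable_on_cong[OF open_UNIV])
      show "higher_differentiable_on UNIV (\<lambda>t. (flat (k + 2) t + (- real k) * flat (k + 1) t) * v) m"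
        by (intro higher_differentiable_on_bilinear[OF bounded_bilinear_mult]
            higher_differentiable_on_add Suc open_UNIV higher_differentiable_on_const)
    qed (use frechet_derivative_at[OF D] in \<open>auto dest: fun_cong\<close>)
    then show ?case using D by (auto simp: differentiable_def)
  qed
  then show ?thesis by (simp add: smooth_on_def)
qed

lemma parseval_frame_real: "parseval_frame {1 :: real}"
  by (simp add: parseval_frame_def)


section \<open>Iterated directional derivatives\<close>

text \<open>The recursion differentiates inside along the head of the list. Product and chain rules
  instead need the last derivative outermost, so that a formula already known can be differentiated
  once more; hence the reverse inductions below.\<close>

lemma iter_deriv_snoc:
  "iter_deriv (vs @ [v]) f = (\<lambda>x. frechet_derivative (iter_deriv vs f) (at x) v)"
  by (induction vs arbitrary: f) auto

lemma smooth_on_iter_deriv: "smooth_on S f \<Longrightarrow> smooth_on S (iter_deriv vs f)"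
  by (induction vs arbitrary: f) (auto intro: smooth_on_frechet_derivative)

lemma iter_deriv_cong_open:
  assumes "open S" "\<And>y. y \<in> S \<Longrightarrow> f y = g y" "x \<in> S"
  shows "iter_deriv vs f x = iter_deriv vs g x"
  using assms(2)
proof (induction vs arbitrary: f g)
  case Nil
  then show ?case using assms(3) by simp
next
  case (Cons v vs)
  show ?case
    unfolding iter_deriv.simps
    by (rule Cons.IH) (use frechet_derivative_cong_open[OF assms(1), of _ f g] Cons.prems in auto)
qed

lemma iter_deriv_const: "iter_deriv vs (\<lambda>x. c) = (\<lambda>x. if vs = [] then c else 0)"
  by (induction vs arbitrary: c) auto

lemma iter_deriv_add:
  assumes "open S" "smooth_on S f" "smooth_on S g" "x \<in> S"
  shows "iter_deriv vs (\<lambda>x. f x + g x) x = iter_deriv vs f x + iter_deriv vs g x"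
  using assms(2,3)
proof (induction vs arbitrary: f g)
  case Nil
  then show ?case by simp
next
  case (Cons v vs)
  have "frechet_derivative (\<lambda>x. f x + g x) (at y) v
      = frechet_derivative f (at y) v + frechet_derivative g (at y) v" if "y \<in> S" for y
  proof -
    have "((\<lambda>x. f x + g x) has_derivative
        (\<lambda>v. frechet_derivative f (at y) v + frechet_derivative g (at y) v)) (at y)"
      using smooth_on_differentiable[OF Cons.prems(1) that] smooth_on_differentiable[OF Cons.prems(2) that]
      by (intro has_derivative_add) (auto simp: frechet_derivative_works)
    from fun_cong[OF frechet_derivative_at[OF this]] show ?thesis by simp
  qed
  then have "iter_deriv (v # vs) (\<lambda>x. f x + g x) x
      = iter_deriv vs (\<lambda>y. frechet_derivative f (at y) v + frechet_derivative g (at y) v) x"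
    unfolding iter_deriv.simps by (intro iter_deriv_cong_open[OF assms(1) _ assms(4)]) auto
  then show ?case
    using Cons by (simp add: smooth_on_frechet_derivative)
qed

lemma iter_deriv_bounded_linear:
  assumes "bounded_linear L" "open S" "smooth_on S f" "x \<in> S"
  shows "iter_deriv vs (\<lambda>x. L (f x)) x = L (iter_deriv vs f x)"
  using assms(3)
proof (induction vs arbitrary: f)
  case Nil
  then show ?case by simp
next
  case (Cons v vs)
  have "frechet_derivative (\<lambda>x. L (f x)) (at y) v = L (frechet_derivative f (at y) v)" if "y \<in> S" for y
  proof -
    have "((\<lambda>x. L (f x)) has_derivative (\<lambda>v. L (frechet_derivative f (at y) v))) (at y)"
      using smooth_on_differentiable[OF Cons.prems(1) that]
      by (intro bounded_linear.has_derivative[OF assms(1)]) (auto simp: frechet_derivative_works)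
    from fun_cong[OF frechet_derivative_at[OF this]] show ?thesis by simp
  qed
  then have "iter_deriv (v # vs) (\<lambda>x. L (f x)) x
      = iter_deriv vs (\<lambda>y. L (frechet_derivative f (at y) v)) x"
    unfolding iter_deriv.simps by (intro iter_deriv_cong_open[OF assms(2) _ assms(4)]) auto
  then show ?case
    using Cons by (simp add: smooth_on_frechet_derivative)
qed

lemmas iter_deriv_cmult = iter_deriv_bounded_linear[OF bounded_linear_mult_right]

lemma has_derivative_sum_list:
  assumes "\<And>p. p \<in> set ps \<Longrightarrow> (F p has_derivative D p) (at x)"
  shows "((\<lambda>x. \<Sum>p\<leftarrow>ps. F p x) has_derivative (\<lambda>v. \<Sum>p\<leftarrow>ps. D p v)) (at x)"
  using assms by (induction ps) (auto intro!: has_derivative_add)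

lemma sum_list_concat_map: "(\<Sum>p\<leftarrow>concat (map h ps). F p) = (\<Sum>p\<leftarrow>ps. \<Sum>r\<leftarrow>h p. (F r :: 'b::comm_monoid_add))"
  by (induction ps) auto

text \<open>The index list is obtained before the functions, so one finite Leibniz sum serves all of
  them; the continuity of multiplication depends on this. Each further derivative splits every pair
  in two, and a list keeps the multiplicities that a set would lose.\<close>

lemma iter_deriv_mult:
  obtains ps :: "('e::real_normed_vector list \<times> 'e list) list" where
    "\<And>S (f :: 'e \<Rightarrow> complex) g x. open S \<Longrightarrow> smooth_on S f \<Longrightarrow> smooth_on S g \<Longrightarrow> x \<in> S \<Longrightarrow>
       iter_deriv vs (\<lambda>x. f x * g x) x = (\<Sum>(u, w)\<leftarrow>ps. iter_deriv u f x * iter_deriv w g x)"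
proof (induction vs arbitrary: thesis rule: rev_induct)
  case Nil
  show ?case by (rule Nil[of "[([], [])]"]) simp
next
  case (snoc v vs)
  obtain ps :: "('e list \<times> 'e list) list" where ps:
    "\<And>S (f :: 'e \<Rightarrow> complex) g x. open S \<Longrightarrow> smooth_on S f \<Longrightarrow> smooth_on S g \<Longrightarrow> x \<in> S \<Longrightarrow>
       iter_deriv vs (\<lambda>x. f x * g x) x = (\<Sum>(u, w)\<leftarrow>ps. iter_deriv u f x * iter_deriv w g x)"
    using snoc.IH by blast
  show ?case
  proof (rule snoc.prems)
    fix S x and f g :: "'e \<Rightarrow> complex"
    assume A: "open S" "smooth_on S f" "smooth_on S g" "x \<in> S"
    have "iter_deriv (vs @ [v]) (\<lambda>x. f x * g x) x
        = frechet_derivative (\<lambda>x. \<Sum>(u, w)\<leftarrow>ps. iter_deriv u f x * iter_deriv w g x) (at x) v"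
      unfolding iter_deriv_snoc
      by (subst frechet_derivative_cong_open[OF A(1,4)]) (use ps A in auto)
    also have "\<dots> = (\<Sum>(u, w)\<leftarrow>ps. iter_deriv u f x * iter_deriv (w @ [v]) g x
        + iter_deriv (u @ [v]) f x * iter_deriv w g x)"
    proof -
      have "((\<lambda>x. \<Sum>p\<leftarrow>ps. iter_deriv (fst p) f x * iter_deriv (snd p) g x) has_derivative
         (\<lambda>v. \<Sum>p\<leftarrow>ps. iter_deriv (fst p) f x * frechet_derivative (iter_deriv (snd p) g) (at x) v
           + frechet_derivative (iter_deriv (fst p) f) (at x) v * iter_deriv (snd p) g x)) (at x)"
        using smooth_on_differentiable[OF smooth_on_iter_deriv[OF A(2)] A(4)]
          smooth_on_differentiable[OF smooth_on_iter_deriv[OF A(3)] A(4)]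
        by (intro has_derivative_sum_list bounded_bilinear.FDERIV[OF bounded_bilinear_mult])
           (auto simp: frechet_derivative_works)
      from fun_cong[OF frechet_derivative_at[OF this], of v]
      show ?thesis by (simp add: iter_deriv_snoc case_prod_unfold)
    qed
    also have "\<dots> = (\<Sum>(u, w)\<leftarrow>concat (map (\<lambda>(u, w). [(u, w @ [v]), (u @ [v], w)]) ps).
        iter_deriv u f x * iter_deriv w g x)"
      by (simp add: sum_list_concat_map case_prod_unfold)
    finally show "iter_deriv (vs @ [v]) (\<lambda>x. f x * g x) x
      = (\<Sum>(u, w)\<leftarrow>concat (map (\<lambda>(u, w). [(u, w @ [v]), (u @ [v], w)]) ps).
        iter_deriv u f x * iter_deriv w g x)" .
  qed
qed

text \<open>The coefficients depend on the inner map \<open>F\<close> and on \<open>vs\<close> but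
  not on \<open>f\<close>. A derivative of \<open>f \<circ> F\<close> is therefore a fixed finite
  combination of derivatives of \<open>f\<close>, which is what makes pullback continuous.\<close>

lemma iter_deriv_compose:
  fixes F :: "'d::real_normed_vector \<Rightarrow> 'e::real_inner"
  assumes C: "parseval_frame (C :: 'e set)" and S: "open S" "smooth_on S F" "F ` S \<subseteq> T"
  obtains ps :: "(('d \<Rightarrow> complex) \<times> 'e list) list" where
    "\<And>c w. (c, w) \<in> set ps \<Longrightarrow> smooth_on S c"
    "\<And>(f :: 'e \<Rightarrow> complex) x. smooth_on T f \<Longrightarrow> x \<in> S \<Longrightarrow>
       iter_deriv vs (\<lambda>x. f (F x)) x = (\<Sum>(c, w)\<leftarrow>ps. c x * iter_deriv w f (F x))"
proof (induction vs arbitrary: thesis rule: rev_induct)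
  case Nil
  show ?case by (rule Nil[of "[(\<lambda>_. 1, [])]"]) (auto intro: smooth_on_const)
next
  case (snoc v vs)
  obtain ps :: "(('d \<Rightarrow> complex) \<times> 'e list) list" where
    sm: "\<And>c w. (c, w) \<in> set ps \<Longrightarrow> smooth_on S c" and ps:
    "\<And>(f :: 'e \<Rightarrow> complex) x. smooth_on T f \<Longrightarrow> x \<in> S \<Longrightarrow>
       iter_deriv vs (\<lambda>x. f (F x)) x = (\<Sum>(c, w)\<leftarrow>ps. c x * iter_deriv w f (F x))"
    using snoc.IH by blast
  have finC: "finite C" using C by (simp add: parseval_frame_def)
  obtain cs where cs: "set cs = C" "distinct cs" using finite_distinct_list[OF finC] by blast
  \<comment> \<open>Differentiating a term \<open>c x * iter_deriv w f (F x)\<close> once along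
    \<open>v\<close> yields one term with the derivative of \<open>c\<close> and, for each frame
    vector \<open>e\<close>, one with the \<open>e\<close>-component of the derivative of
    \<open>F\<close> as an extra factor and \<open>e\<close> appended to \<open>w\<close>.\<close>
  define h where "h = (\<lambda>(c :: 'd \<Rightarrow> complex, w). (\<lambda>x. frechet_derivative c (at x) v, w) #
      map (\<lambda>e. (\<lambda>x. c x * complex_of_real (frechet_derivative F (at x) v \<bullet> e), w @ [e])) cs)"
  show ?case
  proof (rule snoc.prems)
    fix c w assume "(c, w) \<in> set (concat (map h ps))"
    then obtain d u where du: "(d, u) \<in> set ps" "(c, w) \<in> set (h (d, u))" by auto
    then show "smooth_on S c"
      by (auto simp: h_def intro!: smooth_on_frechet_derivative smooth_on_mult S(1) sm[OF du(1)]
          smooth_on_bounded_linear_comp[OF bounded_linear_of_real]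
          smooth_on_bounded_linear_comp[OF bounded_linear_inner_left] S(2))
  next
    fix f :: "'e \<Rightarrow> complex" and x assume A: "smooth_on T f" "x \<in> S"
    have D: "((\<lambda>x. iter_deriv w f (F x)) has_derivative
        (\<lambda>v. frechet_derivative (iter_deriv w f) (at (F x)) (frechet_derivative F (at x) v))) (at x)" for w
    proof -
      have "F x \<in> T" using S(3) A(2) by blast
      then show ?thesis
        using smooth_on_differentiable[OF S(2) A(2)]
          smooth_on_differentiable[OF smooth_on_iter_deriv[OF A(1), of w], of "F x"]
          diff_chain_at[of F _ x "iter_deriv w f"]
        by (auto simp: frechet_derivative_works comp_def)
    qed
    have E: "frechet_derivative (iter_deriv w f) (at (F x)) u
        = (\<Sum>e\<leftarrow>cs. complex_of_real (u \<bullet> e) * iter_deriv (w @ [e]) f (F x))" for w u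
    proof -
      have lin: "linear (frechet_derivative (iter_deriv w f) (at (F x)))"
        using smooth_on_differentiable[OF smooth_on_iter_deriv[OF A(1)], of "F x"] S(3) A(2)
        by (intro linear_frechet_derivative) auto
      have "frechet_derivative (iter_deriv w f) (at (F x)) u
        = frechet_derivative (iter_deriv w f) (at (F x)) (\<Sum>e\<in>C. (u \<bullet> e) *\<^sub>R e)"
        using C by (simp add: parseval_frame_def)
      also have "\<dots> = (\<Sum>e\<in>C. complex_of_real (u \<bullet> e) * iter_deriv (w @ [e]) f (F x))"
        by (simp add: linear_sum[OF lin] linear_scale[OF lin] iter_deriv_snoc scaleR_conv_of_real)
      also have "\<dots> = (\<Sum>e\<leftarrow>cs. complex_of_real (u \<bullet> e) * iter_deriv (w @ [e]) f (F x))"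
        unfolding cs(1)[symmetric] by (rule sum.distinct_set_conv_list[OF cs(2)])
      finally show ?thesis .
    qed
    have "iter_deriv (vs @ [v]) (\<lambda>x. f (F x)) x
        = frechet_derivative (\<lambda>x. \<Sum>(c, w)\<leftarrow>ps. c x * iter_deriv w f (F x)) (at x) v"
      unfolding iter_deriv_snoc
      by (subst frechet_derivative_cong_open[OF S(1) A(2)]) (use ps A in auto)
    also have "\<dots> = (\<Sum>(c, w)\<leftarrow>ps. c x * frechet_derivative (iter_deriv w f) (at (F x)) (frechet_derivative F (at x) v)
        + frechet_derivative c (at x) v * iter_deriv w f (F x))"
    proof -
      have "((\<lambda>x. \<Sum>p\<leftarrow>ps. fst p x * iter_deriv (snd p) f (F x)) has_derivative
         (\<lambda>v. \<Sum>p\<leftarrow>ps. fst p x * frechet_derivative (iter_deriv (snd p) f) (at (F x)) (frechet_derivative F (at x) v)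
           + frechet_derivative (fst p) (at x) v * iter_deriv (snd p) f (F x))) (at x)"
        using smooth_on_differentiable[OF sm A(2)] D
        by (intro has_derivative_sum_list bounded_bilinear.FDERIV[OF bounded_bilinear_mult])
           (auto simp: frechet_derivative_works)
      from fun_cong[OF frechet_derivative_at[OF this], of v]
      show ?thesis by (simp add: case_prod_unfold)
    qed
    also have "\<dots> = (\<Sum>(c, w)\<leftarrow>concat (map h ps). c x * iter_deriv w f (F x))"
      unfolding E sum_list_concat_map
      by (intro arg_cong[of _ _ sum_list] map_cong)
         (auto simp: h_def comp_def sum_list_const_mult[symmetric] ac_simps)
    finally show "iter_deriv (vs @ [v]) (\<lambda>x. f (F x)) x
        = (\<Sum>(c, w)\<leftarrow>concat (map h ps). c x * iter_deriv w f (F x))" .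
  qed
qed


section \<open>Charts\<close>

lemma chart_inj_on: "chart X (U, \<phi>) \<Longrightarrow> inj_on \<phi> U"
  using openin_subset by (fastforce dest: homeomorphic_imp_injective_map simp: inf.absorb2)

lemma chart_subset: "chart X (U, \<phi>) \<Longrightarrow> U \<subseteq> topspace X"
  by (simp add: openin_subset)

lemma chart_inv_into: "chart X (U, \<phi>) \<Longrightarrow> p \<in> U \<Longrightarrow> inv_into U \<phi> (\<phi> p) = p"
  by (rule inv_into_f_f[OF chart_inj_on])

lemma chart_open_image:
  assumes "chart X (U, \<phi>)" "openin X W" "W \<subseteq> U"
  shows "open (\<phi> ` W)"
proof -
  have "open_map (subtopology X U) (top_of_set (\<phi> ` U)) \<phi>"
    using assms by (auto intro: homeomorphic_imp_open_map)
  then have "openin (top_of_set (\<phi> ` U)) (\<phi> ` W)"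
    using assms by (auto simp: open_map_def openin_open_subtopology)
  then show ?thesis
    using assms by (auto intro: openin_open_trans)
qed

lemma chart_open_image_Int:
  "chart X (U, \<phi>) \<Longrightarrow> openin X W \<Longrightarrow> open (\<phi> ` (U \<inter> W))"
  by (rule chart_open_image) auto

lemma chart_openin_preimage:
  assumes "chart X (U, \<phi>)" "open S"
  shows "openin X {p \<in> U. \<phi> p \<in> S}"
proof -
  have "continuous_map (subtopology X U) (top_of_set (\<phi> ` U)) \<phi>"
    using assms by (auto intro: homeomorphic_imp_continuous_map)
  then have "openin (subtopology X U) {p \<in> topspace (subtopology X U). \<phi> p \<in> S}"
    using assms(2) by (intro openin_continuous_map_preimage[of _ euclidean])
      (auto simp: continuous_map_in_subtopology)
  moreover have "topspace (subtopology X U) = U"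
    using chart_subset[OF assms(1)] by auto
  ultimately have "openin (subtopology X U) {p \<in> U. \<phi> p \<in> S}"
    by (simp only:)
  then show ?thesis
    using assms(1) by (simp add: openin_open_subtopology)
qed

lemma chart_continuous_inv:
  assumes "chart X (U, \<phi>)"
  shows "continuous_map (top_of_set (\<phi> ` U)) X (inv_into U \<phi>)"
proof -
  have "openin (top_of_set (\<phi> ` U)) {x \<in> \<phi> ` U. inv_into U \<phi> x \<in> W}" if "openin X W" for W
  proof -
    have "{x \<in> \<phi> ` U. inv_into U \<phi> x \<in> W} = \<phi> ` (U \<inter> W)"
      using chart_inv_into[OF assms] by auto
    then show ?thesis
      using chart_open_image_Int[OF assms that] assms by (auto simp: openin_open_eq)
  qed
  then show ?thesis
    using chart_subset[OF assms] chart_inv_into[OF assms] by (auto simp: continuous_map)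
qed

lemma chart_compactin:
  assumes "chart X (U, \<phi>)" "compact K" "K \<subseteq> \<phi> ` U"
  shows "compactin X (inv_into U \<phi> ` K)"
  by (rule image_compactin[OF _ chart_continuous_inv[OF assms(1)]])
     (use assms in \<open>auto simp: compactin_subtopology\<close>)

lemma chart_restrict:
  assumes "chart X (U, \<phi>)" "openin X W" "W \<subseteq> U"
  shows "chart X (W, \<phi>)"
proof -
  have "homeomorphic_map (subtopology (subtopology X U) W) (subtopology (top_of_set (\<phi> ` U)) (\<phi> ` W)) \<phi>"
  proof (rule homeomorphic_map_subtopologies)
    show "homeomorphic_map (subtopology X U) (top_of_set (\<phi> ` U)) \<phi>" using assms by simp
    show "\<phi> ` (topspace (subtopology X U) \<inter> W) = topspace (top_of_set (\<phi> ` U)) \<inter> \<phi> ` W"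
      using assms chart_subset[OF assms(1)] by auto
  qed
  moreover have "subtopology (subtopology X U) W = subtopology X W"
    "subtopology (top_of_set (\<phi> ` U)) (\<phi> ` W) = top_of_set (\<phi> ` W)"
    using assms by (auto simp: subtopology_subtopology inf.absorb2 image_mono)
  ultimately show ?thesis
    using assms chart_open_image[OF assms] by simp
qed


section \<open>Smooth maps between manifolds\<close>

lemma manifold_frame:
  fixes P :: "('a, 'e::real_inner) mfd"
  assumes "manifold P"
  obtains C :: "'e set" where "parseval_frame C"
  using assms parseval_frame_exists unfolding manifold_def by blast

lemma manifold_chart: "manifold P \<Longrightarrow> c \<in> atlas P \<Longrightarrow> chart (mtop P) c"
  by (simp add: manifold_def)

lemma manifold_compatible: "manifold P \<Longrightarrow> c \<in> atlas P \<Longrightarrow> d \<in> atlas P \<Longrightarrow> compatible c d"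
  by (simp add: manifold_def)

lemma manifold_chart_at:
  assumes "manifold P" "p \<in> pts P"
  obtains U \<phi> where "(U, \<phi>) \<in> atlas P" "p \<in> U"
proof -
  have "p \<in> (\<Union>c\<in>atlas P. fst c)" using assms by (simp add: manifold_def)
  then show ?thesis using that by force
qed

lemma atlas_subset_maximal: "manifold P \<Longrightarrow> atlas P \<subseteq> maximal_atlas P"
  by (auto simp: manifold_def maximal_atlas_def)

lemma maximal_atlas_chart: "c \<in> maximal_atlas P \<Longrightarrow> chart (mtop P) c"
  by (simp add: maximal_atlas_def)

lemma maximal_atlas_compatible: "c \<in> maximal_atlas P \<Longrightarrow> d \<in> atlas P \<Longrightarrow> compatible c d"
  by (simp add: maximal_atlas_def)

text \<open>Lets a chart be shrunk until the orbit map is injective on its domain. The inverses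
  chosen on \<open>U\<close> and on \<open>W\<close> agree on the image of \<open>W\<close>, which
  is open, so smoothness passes from one to the other.\<close>

lemma maximal_atlas_restrict:
  assumes P: "manifold P" and U: "(U, \<phi>) \<in> maximal_atlas P" and W: "openin (mtop P) W" "W \<subseteq> U"
  shows "(W, \<phi>) \<in> maximal_atlas P"
proof -
  have ch: "chart (mtop P) (U, \<phi>)" using U by (rule maximal_atlas_chart)
  have "compatible (W, \<phi>) (V, \<psi>)" if V: "(V, \<psi>) \<in> atlas P" for V \<psi>
  proof -
    have chV: "chart (mtop P) (V, \<psi>)" using P V by (rule manifold_chart)
    have comp: "smooth_on (\<phi> ` (U \<inter> V)) (\<psi> \<circ> inv_into U \<phi>)" "smooth_on (\<psi> ` (U \<inter> V)) (\<phi> \<circ> inv_into V \<psi>)"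
      using U V by (auto simp: maximal_atlas_def)
    have "openin (mtop P) (W \<inter> V)" using W chV by auto
    then have "open (\<phi> ` (W \<inter> V))"
      using W by (intro chart_open_image[OF ch]) auto
    then have "smooth_on (\<phi> ` (W \<inter> V)) (\<psi> \<circ> inv_into W \<phi>)"
    proof (rule smooth_on_cong)
      show "smooth_on (\<phi> ` (W \<inter> V)) (\<psi> \<circ> inv_into U \<phi>)"
        by (rule smooth_on_subset[OF comp(1)]) (use W in auto)
      fix x assume "x \<in> \<phi> ` (W \<inter> V)"
      then obtain p where "p \<in> W" "x = \<phi> p" by auto
      then show "(\<psi> \<circ> inv_into U \<phi>) x = (\<psi> \<circ> inv_into W \<phi>) x"
        using inv_into_f_f[OF inj_on_subset[OF chart_inj_on[OF ch] W(2)]] chart_inv_into[OF ch] W(2)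
        by auto
    qed
    moreover have "smooth_on (\<psi> ` (W \<inter> V)) (\<phi> \<circ> inv_into V \<psi>)"
      by (rule smooth_on_subset[OF comp(2)]) (use W in auto)
    ultimately show ?thesis by simp
  qed
  then show ?thesis
    using chart_restrict[OF ch W] by (auto simp: maximal_atlas_def)
qed

lemma smooth_map_continuous: "smooth_map P Q h \<Longrightarrow> continuous_map (mtop P) (mtop Q) h"
  by (simp add: smooth_map_def)

lemma smooth_map_in_pts: "smooth_map P Q h \<Longrightarrow> p \<in> pts P \<Longrightarrow> h p \<in> pts Q"
  using continuous_map_image_subset_topspace smooth_map_continuous by blast

lemma smooth_map_charts:
  "smooth_map P Q h \<Longrightarrow> (U, \<phi>) \<in> atlas P \<Longrightarrow> (V, \<psi>) \<in> atlas Q \<Longrightarrow>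
    smooth_on (\<phi> ` (U \<inter> h -` V)) (\<psi> \<circ> h \<circ> inv_into U \<phi>)"
  unfolding smooth_map_def by fast

lemma smooth_mapI:
  assumes "continuous_map (mtop P) (mtop Q) h"
    and "\<And>U \<phi> V \<psi>. (U, \<phi>) \<in> atlas P \<Longrightarrow> (V, \<psi>) \<in> atlas Q \<Longrightarrow>
      smooth_on (\<phi> ` (U \<inter> h -` V)) (\<psi> \<circ> h \<circ> inv_into U \<phi>)"
  shows "smooth_map P Q h"
  using assms unfolding smooth_map_def by fast

text \<open>Smooth maps are tested in the given atlases only. Charts of the maximal atlases are
  reached by inserting atlas charts around the point and its image, which factors the coordinate
  expression into two transition maps and a tested one. The comparison map \<open>g\<close> may vary
  with the point, because the maps of interest coincide with an action map only locally.\<close>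

lemma smooth_on_maximal_charts:
  fixes P :: "('a, 'e::real_inner) mfd" and Q :: "('b, 'f::real_inner) mfd"
  assumes P: "manifold P" and Q: "manifold Q"
    and U: "(U, \<phi>) \<in> maximal_atlas P" and V: "(V, \<psi>) \<in> maximal_atlas Q" and AU: "A \<subseteq> U"
    and hA: "\<And>p. p \<in> A \<Longrightarrow> h p \<in> V"
    and loc: "\<And>p. p \<in> A \<Longrightarrow> \<exists>N g. openin (mtop P) N \<and> p \<in> N \<and> smooth_map P Q g \<and> (\<forall>q\<in>N. h q = g q)"
  shows "smooth_on (\<phi> ` A) (\<psi> \<circ> h \<circ> inv_into U \<phi>)"
proof (rule smooth_on_local)
  fix x assume "x \<in> \<phi> ` A"
  then obtain p where p: "p \<in> A" "x = \<phi> p" by blast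
  obtain N g where N: "openin (mtop P) N" "p \<in> N" "smooth_map P Q g" "\<And>q. q \<in> N \<Longrightarrow> h q = g q"
    using loc[OF p(1)] by blast
  have chU: "chart (mtop P) (U, \<phi>)" and chV: "chart (mtop Q) (V, \<psi>)"
    using U V by (auto intro: maximal_atlas_chart simp del: chart.simps)
  have pU: "p \<in> U" "p \<in> pts P" using p AU chart_subset[OF chU] by auto
  have gp: "g p \<in> V" "g p \<in> pts Q" using hA[OF p(1)] N(2,4) chart_subset[OF chV] by auto
  obtain U' \<phi>' where U': "(U', \<phi>') \<in> atlas P" "p \<in> U'" by (rule manifold_chart_at[OF P pU(2)])
  obtain V' \<psi>' where V': "(V', \<psi>') \<in> atlas Q" "g p \<in> V'" by (rule manifold_chart_at[OF Q gp(2)])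
  have chU': "chart (mtop P) (U', \<phi>')" and chV': "chart (mtop Q) (V', \<psi>')"
    using U' V' manifold_chart[OF P] manifold_chart[OF Q] by blast+
  \<comment> \<open>The open set on which \<open>h\<close> equals \<open>g\<close> and all three
    factors of the coordinate expression are defined.\<close>
  define Om where "Om = N \<inter> (U \<inter> U') \<inter> {q \<in> pts P. g q \<in> V \<inter> V'}"
  have "openin (mtop Q) (V \<inter> V')" using chV chV' by auto
  then have "openin (mtop P) {q \<in> pts P. g q \<in> V \<inter> V'}"
    by (rule openin_continuous_map_preimage[OF smooth_map_continuous[OF N(3)]])
  then have Om: "openin (mtop P) Om" unfolding Om_def using N(1) chU chU' by auto
  have T: "open (\<phi> ` Om)" by (rule chart_open_image[OF chU Om]) (auto simp: Om_def)
  obtain C :: "'e set" where C: "parseval_frame C" by (rule manifold_frame[OF P])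
  obtain D :: "'f set" where D: "parseval_frame D" by (rule manifold_frame[OF Q])
  have s1: "smooth_on (\<phi> ` Om) (\<phi>' \<circ> inv_into U \<phi>)"
  proof (rule smooth_on_subset)
    show "smooth_on (\<phi> ` (U \<inter> U')) (\<phi>' \<circ> inv_into U \<phi>)"
      using maximal_atlas_compatible[OF U U'(1)] by simp
  qed (auto simp: Om_def)
  have s2: "smooth_on (\<phi>' ` (U' \<inter> g -` V')) (\<psi>' \<circ> g \<circ> inv_into U' \<phi>')"
    by (rule smooth_map_charts[OF N(3) U'(1) V'(1)])
  have s3: "smooth_on (\<psi>' ` (V \<inter> V')) (\<psi> \<circ> inv_into V' \<psi>')"
    using maximal_atlas_compatible[OF V V'(1)] by simp
  have s12: "smooth_on (\<phi> ` Om) (\<lambda>y. (\<psi>' \<circ> g \<circ> inv_into U' \<phi>') ((\<phi>' \<circ> inv_into U \<phi>) y))"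
    by (rule smooth_on_compose[OF C T _ s1 s2]) (auto simp: Om_def chart_inv_into[OF chU])
  have s4: "smooth_on (\<phi> ` Om) (\<lambda>y. (\<psi> \<circ> inv_into V' \<psi>') ((\<psi>' \<circ> g \<circ> inv_into U' \<phi>') ((\<phi>' \<circ> inv_into U \<phi>) y)))"
    by (rule smooth_on_compose[OF D T _ s12 s3])
       (auto simp: Om_def chart_inv_into[OF chU] chart_inv_into[OF chU'])
  have "smooth_on (\<phi> ` Om) (\<psi> \<circ> h \<circ> inv_into U \<phi>)"
    by (rule smooth_on_cong[OF T s4])
       (auto simp: Om_def N(4) chart_inv_into[OF chU] chart_inv_into[OF chU'] chart_inv_into[OF chV'])
  moreover have "x \<in> \<phi> ` Om" using p pU U' V' gp N by (auto simp: Om_def)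
  ultimately show "\<exists>T. open T \<and> x \<in> T \<and> smooth_on T (\<psi> \<circ> h \<circ> inv_into U \<phi>)"
    using T by blast
qed

section \<open>Maps out of and into a product with a discrete factor\<close>

lemma continuous_map_prod_discrete_iff:
  "continuous_map (prod_topology X (discrete_topology G)) Y F \<longleftrightarrow>
    (\<forall>g\<in>G. continuous_map X Y (\<lambda>p. F (p, g)))"
proof
  assume L: "continuous_map (prod_topology X (discrete_topology G)) Y F"
  show "\<forall>g\<in>G. continuous_map X Y (\<lambda>p. F (p, g))"
  proof
    fix g assume "g \<in> G"
    then have "continuous_map X (prod_topology X (discrete_topology G)) (\<lambda>p. (p, g))"
      by (simp add: continuous_map_pairwise comp_def)
    from continuous_map_compose[OF this L] show "continuous_map X Y (\<lambda>p. F (p, g))"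
      by (simp add: comp_def)
  qed
next
  assume R: "\<forall>g\<in>G. continuous_map X Y (\<lambda>p. F (p, g))"
  have "openin (prod_topology X (discrete_topology G)) {z \<in> topspace X \<times> G. F z \<in> W}" if "openin Y W" for W
  proof -
    have "{z \<in> topspace X \<times> G. F z \<in> W} = (\<Union>g\<in>G. {p \<in> topspace X. F (p, g) \<in> W} \<times> {g})" by auto
    moreover have "openin (prod_topology X (discrete_topology G)) ({p \<in> topspace X. F (p, g) \<in> W} \<times> {g})"
      if "g \<in> G" for g
      using R that \<open>openin Y W\<close> by (auto simp: openin_prod_Times_iff intro: openin_continuous_map_preimage)
    ultimately show ?thesis by (auto intro!: openin_Union)
  qed
  moreover have "F z \<in> topspace Y" if "z \<in> topspace X \<times> G" for z
    using R that by (cases z) (auto simp: continuous_map_def)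
  ultimately show "continuous_map (prod_topology X (discrete_topology G)) Y F"
    by (auto simp: continuous_map)
qed

text \<open>Each chart of the product lies over a single element of \<open>G\<close>, so the slices
  can be tested one by one.\<close>

lemma smooth_map_prod_discrete_iff:
  assumes P: "manifold P" and Q: "manifold Q"
  shows "smooth_map (prod_discrete P G) Q F \<longleftrightarrow> (\<forall>g\<in>G. smooth_map P Q (\<lambda>p. F (p, g)))"
proof -
  \<comment> \<open>The two expressions agree only on the set where they are tested; continuity of
    the slice is what makes this set open, so that derivatives agree there as well.\<close>
  have *: "smooth_on ((\<phi> \<circ> fst) ` (U \<times> {g} \<inter> F -` V)) (\<psi> \<circ> F \<circ> inv_into (U \<times> {g}) (\<phi> \<circ> fst)) \<longleftrightarrow>
      smooth_on (\<phi> ` (U \<inter> (\<lambda>p. F (p, g)) -` V)) (\<psi> \<circ> (\<lambda>p. F (p, g)) \<circ> inv_into U \<phi>)" (is "?L \<longleftrightarrow> ?R")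
    if U: "(U, \<phi>) \<in> atlas P" and V: "(V, \<psi>) \<in> atlas Q" and c: "continuous_map (mtop P) (mtop Q) (\<lambda>p. F (p, g))"
    for U \<phi> V \<psi> g
  proof -
    have chU: "chart (mtop P) (U, \<phi>)" and chV: "chart (mtop Q) (V, \<psi>)"
      using manifold_chart[OF P U] manifold_chart[OF Q V] .
    have e: "(\<phi> \<circ> fst) ` (U \<times> {g} \<inter> F -` V) = \<phi> ` (U \<inter> (\<lambda>p. F (p, g)) -` V)" by force
    have "U \<inter> (\<lambda>p. F (p, g)) -` V = U \<inter> {p \<in> pts P. F (p, g) \<in> V}"
      using chart_subset[OF chU] by auto
    then have op: "open (\<phi> ` (U \<inter> (\<lambda>p. F (p, g)) -` V))"
      using chart_open_image_Int[OF chU openin_continuous_map_preimage[OF c, of V]] chV by auto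
    have inj: "inj_on (\<phi> \<circ> fst) (U \<times> {g})"
      using chart_inj_on[OF chU] by (auto simp: inj_on_def)
    have "inv_into (U \<times> {g}) (\<phi> \<circ> fst) (\<phi> p) = (p, g)" if "p \<in> U" for p
      using inv_into_f_f[OF inj, of "(p, g)"] that by simp
    then have "(\<psi> \<circ> F \<circ> inv_into (U \<times> {g}) (\<phi> \<circ> fst)) x = (\<psi> \<circ> (\<lambda>p. F (p, g)) \<circ> inv_into U \<phi>) x"
      if "x \<in> \<phi> ` (U \<inter> (\<lambda>p. F (p, g)) -` V)" for x
      using that chart_inv_into[OF chU] by auto
    then show ?thesis
      unfolding e using smooth_on_cong[OF op] by metis
  qed
  have cont: "continuous_map (mtop (prod_discrete P G)) (mtop Q) F \<longleftrightarrow>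
      (\<forall>g\<in>G. continuous_map (mtop P) (mtop Q) (\<lambda>p. F (p, g)))"
    by (simp add: prod_discrete_def continuous_map_prod_discrete_iff)
  show ?thesis
  proof
    assume L: "smooth_map (prod_discrete P G) Q F"
    show "\<forall>g\<in>G. smooth_map P Q (\<lambda>p. F (p, g))"
    proof
      fix g assume g: "g \<in> G"
      show "smooth_map P Q (\<lambda>p. F (p, g))"
      proof (rule smooth_mapI)
        show c: "continuous_map (mtop P) (mtop Q) (\<lambda>p. F (p, g))"
          using smooth_map_continuous[OF L] g by (simp add: cont)
        fix U \<phi> V \<psi> assume UV: "(U, \<phi>) \<in> atlas P" "(V, \<psi>) \<in> atlas Q"
        then have "(U \<times> {g}, \<phi> \<circ> fst) \<in> atlas (prod_discrete P G)"
          using g by (auto simp: prod_discrete_def)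
        from smooth_map_charts[OF L this UV(2)]
        show "smooth_on (\<phi> ` (U \<inter> (\<lambda>p. F (p, g)) -` V)) (\<psi> \<circ> (\<lambda>p. F (p, g)) \<circ> inv_into U \<phi>)"
          using *[OF UV c] by simp
      qed
    qed
  next
    assume R: "\<forall>g\<in>G. smooth_map P Q (\<lambda>p. F (p, g))"
    show "smooth_map (prod_discrete P G) Q F"
    proof (rule smooth_mapI)
      show "continuous_map (mtop (prod_discrete P G)) (mtop Q) F"
        using R by (simp add: cont smooth_map_continuous)
      fix U' \<phi>' V \<psi> assume "(U', \<phi>') \<in> atlas (prod_discrete P G)" and V: "(V, \<psi>) \<in> atlas Q"
      then obtain U \<phi> g where U: "U' = U \<times> {g}" "\<phi>' = \<phi> \<circ> fst" "(U, \<phi>) \<in> atlas P" "g \<in> G"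
        by (auto simp: prod_discrete_def)
      from R U(4) have sm: "smooth_map P Q (\<lambda>p. F (p, g))" by blast
      show "smooth_on (\<phi>' ` (U' \<inter> F -` V)) (\<psi> \<circ> F \<circ> inv_into U' \<phi>')"
        using smooth_map_charts[OF sm U(3) V] *[OF U(3) V smooth_map_continuous[OF sm]] U(1,2) by simp
    qed
  qed
qed

lemma smooth_map_into_prod_discrete:
  assumes "smooth_map P Q h" "continuous_map (mtop P) (discrete_topology G) u"
  shows "smooth_map P (prod_discrete Q G) (\<lambda>p. (h p, u p))"
proof (rule smooth_mapI)
  show "continuous_map (mtop P) (mtop (prod_discrete Q G)) (\<lambda>p. (h p, u p))"
    using assms by (simp add: prod_discrete_def continuous_map_pairwise comp_def smooth_map_continuous)
next
  fix U \<phi> V' \<psi>' assume U: "(U, \<phi>) \<in> atlas P" and "(V', \<psi>') \<in> atlas (prod_discrete Q G)"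
  then obtain V \<psi> g where V: "V' = V \<times> {g}" "\<psi>' = \<psi> \<circ> fst" "(V, \<psi>) \<in> atlas Q"
    by (auto simp: prod_discrete_def)
  have "smooth_on (\<phi> ` (U \<inter> (\<lambda>p. (h p, u p)) -` (V \<times> {g}))) (\<psi> \<circ> h \<circ> inv_into U \<phi>)"
    by (rule smooth_on_subset[OF smooth_map_charts[OF assms(1) U V(3)]]) auto
  then show "smooth_on (\<phi> ` (U \<inter> (\<lambda>p. (h p, u p)) -` V')) (\<psi>' \<circ> (\<lambda>p. (h p, u p)) \<circ> inv_into U \<phi>)"
    using V by (simp add: comp_def)
qed

text \<open>A literal equality of records, so that a global trivialisation can serve as the local
  one around every point of the base.\<close>

lemma open_submanifold_pts:
  assumes "manifold P"
  shows "open_submanifold P (pts P) = P"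
proof -
  have "(\<lambda>(U, \<phi>). (U \<inter> pts P, \<phi>)) c = c" if "c \<in> atlas P" for c
    using chart_subset manifold_chart[OF assms that] by (cases c) (auto simp del: chart.simps)
  then have "(\<lambda>(U, \<phi>). (U \<inter> pts P, \<phi>)) ` atlas P = atlas P"
    by (simp add: image_def)
  then show ?thesis by (simp add: open_submanifold_def)
qed


section \<open>Smooth functions on a manifold\<close>

lemma smooth_functions_chart:
  "f \<in> smooth_functions P \<Longrightarrow> (U, \<phi>) \<in> atlas P \<Longrightarrow> smooth_on (\<phi> ` U) (f \<circ> inv_into U \<phi>)"
  unfolding smooth_functions_def by fast

lemma smooth_functionsI:
  assumes "f \<in> extensional (pts P)"
    and "\<And>U \<phi>. (U, \<phi>) \<in> atlas P \<Longrightarrow> smooth_on (\<phi> ` U) (f \<circ> inv_into U \<phi>)"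
  shows "f \<in> smooth_functions P"
  using assms unfolding smooth_functions_def by fast

lemma smooth_functions_restrict: "f \<in> smooth_functions P \<Longrightarrow> restrict f (pts P) = f"
  by (simp add: smooth_functions_def extensional_restrict)

lemma smooth_functions_restrictI:
  assumes P: "manifold P"
    and "\<And>U \<phi>. (U, \<phi>) \<in> atlas P \<Longrightarrow> smooth_on (\<phi> ` U) (\<lambda>x. f (inv_into U \<phi> x))"
  shows "restrict f (pts P) \<in> smooth_functions P"
proof (rule smooth_functionsI)
  fix U \<phi> assume U: "(U, \<phi>) \<in> atlas P"
  have ch: "chart (mtop P) (U, \<phi>)" by (rule manifold_chart[OF P U])
  then have "open (\<phi> ` U)" by simp
  then show "smooth_on (\<phi> ` U) (restrict f (pts P) \<circ> inv_into U \<phi>)"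
    by (rule smooth_on_cong[OF _ assms(2)[OF U]]) (use chart_subset[OF ch] chart_inv_into[OF ch] in auto)
qed auto

lemma smooth_functions_local:
  assumes P: "manifold P" and f: "f \<in> extensional (pts P)"
    and loc: "\<And>p. p \<in> pts P \<Longrightarrow> \<exists>N g. openin (mtop P) N \<and> p \<in> N \<and> g \<in> smooth_functions P \<and> (\<forall>q\<in>N. f q = g q)"
  shows "f \<in> smooth_functions P"
proof (rule smooth_functionsI[OF f], rule smooth_on_local)
  fix U \<phi> x assume U: "(U, \<phi>) \<in> atlas P" and "x \<in> \<phi> ` U"
  then obtain p where p: "p \<in> U" "x = \<phi> p" by blast
  have ch: "chart (mtop P) (U, \<phi>)" by (rule manifold_chart[OF P U])
  obtain N g where N: "openin (mtop P) N" "p \<in> N" "g \<in> smooth_functions P" "\<And>q. q \<in> N \<Longrightarrow> f q = g q"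
    using loc[of p] p chart_subset[OF ch] by blast
  have op: "open (\<phi> ` (U \<inter> N))" by (rule chart_open_image_Int[OF ch N(1)])
  have "smooth_on (\<phi> ` (U \<inter> N)) (f \<circ> inv_into U \<phi>)"
    by (rule smooth_on_cong[OF op smooth_on_subset[OF smooth_functions_chart[OF N(3) U]]])
       (auto simp: N(4) chart_inv_into[OF ch])
  then show "\<exists>T. open T \<and> x \<in> T \<and> smooth_on T (f \<circ> inv_into U \<phi>)"
    using op p N(2) by blast
qed

lemma smooth_functions_const: "manifold P \<Longrightarrow> (\<lambda>p\<in>pts P. c) \<in> smooth_functions P"
  by (rule smooth_functions_restrictI) (auto intro: smooth_on_const)

text \<open>A continuous map into a discrete space is locally constant, so locality of smoothness
  reduces the claim to constant functions.\<close>

lemma smooth_functions_locally_constant: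
  assumes P: "manifold P" and u: "continuous_map (mtop P) (discrete_topology G) u"
  shows "(\<lambda>p\<in>pts P. F (u p)) \<in> smooth_functions P"
proof (rule smooth_functions_local[OF P])
  fix p assume p: "p \<in> pts P"
  have "u p \<in> G" using u p by (auto simp: continuous_map_def)
  then have "openin (mtop P) {q \<in> pts P. u q \<in> {u p}}"
    by (intro openin_continuous_map_preimage[OF u]) auto
  then show "\<exists>N g. openin (mtop P) N \<and> p \<in> N \<and> g \<in> smooth_functions P \<and> (\<forall>q\<in>N. (\<lambda>p\<in>pts P. F (u p)) q = g q)"
    using smooth_functions_const[OF P, of "F (u p)"] p
    by (intro exI[of _ "{q \<in> pts P. u q \<in> {u p}}"] exI[of _ "\<lambda>q\<in>pts P. F (u p)"]) auto
qed auto

lemma smooth_functions_add: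
  assumes P: "manifold P" and "f \<in> smooth_functions P" "g \<in> smooth_functions P"
  shows "(\<lambda>p\<in>pts P. f p + g p) \<in> smooth_functions P"
  using assms(2,3) manifold_chart[OF P]
  by (intro smooth_functions_restrictI[OF P] smooth_on_add) (auto dest: smooth_functions_chart simp: comp_def)

lemma smooth_functions_mult:
  assumes P: "manifold P" and "f \<in> smooth_functions P" "g \<in> smooth_functions P"
  shows "(\<lambda>p\<in>pts P. f p * g p) \<in> smooth_functions P"
  using assms(2,3) manifold_chart[OF P]
  by (intro smooth_functions_restrictI[OF P] smooth_on_mult) (auto dest: smooth_functions_chart simp: comp_def)

lemma smooth_functions_bounded_linear:
  assumes P: "manifold P" and "bounded_linear L" "f \<in> smooth_functions P"
  shows "(\<lambda>p\<in>pts P. L (f p)) \<in> smooth_functions P"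
  using assms(3) manifold_chart[OF P]
  by (intro smooth_functions_restrictI[OF P] smooth_on_bounded_linear_comp[OF assms(2)])
     (auto dest: smooth_functions_chart simp: comp_def)

lemma smooth_functions_compose_smooth:
  assumes P: "manifold P" and f: "f \<in> smooth_functions P" and "\<And>p. p \<in> pts P \<Longrightarrow> f p \<in> T" and G: "smooth_on T G"
  shows "(\<lambda>p\<in>pts P. G (f p)) \<in> smooth_functions P"
proof (rule smooth_functions_restrictI[OF P])
  fix U \<phi> assume U: "(U, \<phi>) \<in> atlas P"
  have ch: "chart (mtop P) (U, \<phi>)" by (rule manifold_chart[OF P U])
  have "smooth_on (\<phi> ` U) (\<lambda>x. G ((f \<circ> inv_into U \<phi>) x))"
    by (rule smooth_on_compose[OF parseval_frame_Basis _ _ smooth_functions_chart[OF f U] G])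
       (use ch assms(3) chart_subset[OF ch] chart_inv_into[OF ch] in auto)
  then show "smooth_on (\<phi> ` U) (\<lambda>x. G (f (inv_into U \<phi> x)))" by simp
qed

lemma smooth_functions_continuous:
  assumes P: "manifold P" and f: "f \<in> smooth_functions P"
  shows "continuous_map (mtop P) euclidean f"
proof -
  have "openin (mtop P) {p \<in> pts P. f p \<in> S}" if S: "open S" for S
  proof (subst openin_subopen, intro ballI)
    fix p assume "p \<in> {p \<in> pts P. f p \<in> S}"
    then have p: "p \<in> pts P" "f p \<in> S" by auto
    obtain U \<phi> where U: "(U, \<phi>) \<in> atlas P" "p \<in> U" by (rule manifold_chart_at[OF P p(1)])
    have ch: "chart (mtop P) (U, \<phi>)" by (rule manifold_chart[OF P U(1)])
    have "open (\<phi> ` U)" using ch by simp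
    with smooth_on_continuous_on[OF smooth_functions_chart[OF f U(1)]] S
    have "open ((f \<circ> inv_into U \<phi>) -` S \<inter> \<phi> ` U)"
      by (simp only: continuous_on_open_vimage)
    then have "openin (mtop P) {q \<in> U. \<phi> q \<in> (f \<circ> inv_into U \<phi>) -` S \<inter> \<phi> ` U}"
      by (rule chart_openin_preimage[OF ch])
    moreover have "p \<in> {q \<in> U. \<phi> q \<in> (f \<circ> inv_into U \<phi>) -` S \<inter> \<phi> ` U}"
      using U p chart_inv_into[OF ch] by simp
    moreover have "{q \<in> U. \<phi> q \<in> (f \<circ> inv_into U \<phi>) -` S \<inter> \<phi> ` U} \<subseteq> {p \<in> pts P. f p \<in> S}"
    proof
      fix q assume "q \<in> {q \<in> U. \<phi> q \<in> (f \<circ> inv_into U \<phi>) -` S \<inter> \<phi> ` U}"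
      then have "q \<in> U" "f (inv_into U \<phi> (\<phi> q)) \<in> S" by simp_all
      then show "q \<in> {p \<in> pts P. f p \<in> S}"
        using chart_subset[OF ch] chart_inv_into[OF ch] by auto
    qed
    ultimately show "\<exists>T. openin (mtop P) T \<and> p \<in> T \<and> T \<subseteq> {p \<in> pts P. f p \<in> S}"
      by blast
  qed
  then show ?thesis by (auto simp: continuous_map)
qed

lemma smooth_functions_pullback:
  fixes P :: "('a, 'e::real_inner) mfd" and Q :: "('b, 'f::real_inner) mfd"
  assumes P: "manifold P" and Q: "manifold Q" and h: "smooth_map P Q h" and f: "f \<in> smooth_functions Q"
  shows "(\<lambda>p\<in>pts P. f (h p)) \<in> smooth_functions P"
proof (rule smooth_functions_restrictI[OF P], rule smooth_on_local)
  fix U \<phi> x assume U: "(U, \<phi>) \<in> atlas P" and "x \<in> \<phi> ` U"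
  then obtain p where p: "p \<in> U" "x = \<phi> p" by blast
  have chU: "chart (mtop P) (U, \<phi>)" by (rule manifold_chart[OF P U])
  have "h p \<in> pts Q" using smooth_map_in_pts[OF h] p chart_subset[OF chU] by blast
  then obtain V \<psi> where V: "(V, \<psi>) \<in> atlas Q" "h p \<in> V" by (rule manifold_chart_at[OF Q])
  have chV: "chart (mtop Q) (V, \<psi>)" by (rule manifold_chart[OF Q V(1)])
  have "openin (mtop P) {q \<in> pts P. h q \<in> V}"
    by (rule openin_continuous_map_preimage[OF smooth_map_continuous[OF h]]) (use chV in auto)
  then have op: "open (\<phi> ` (U \<inter> {q \<in> pts P. h q \<in> V}))" (is "open ?T")
    by (rule chart_open_image_Int[OF chU])
  obtain D :: "'f set" where D: "parseval_frame D" by (rule manifold_frame[OF Q])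
  have s1: "smooth_on ?T (\<psi> \<circ> h \<circ> inv_into U \<phi>)"
    by (rule smooth_on_subset[OF smooth_map_charts[OF h U V(1)]]) auto
  have "smooth_on ?T (\<lambda>y. (f \<circ> inv_into V \<psi>) ((\<psi> \<circ> h \<circ> inv_into U \<phi>) y))"
    by (rule smooth_on_compose[OF D op _ s1 smooth_functions_chart[OF f V(1)]])
       (auto simp: chart_inv_into[OF chU])
  then have "smooth_on ?T (\<lambda>x. f (h (inv_into U \<phi> x)))"
    by (rule smooth_on_cong[OF op]) (auto simp: chart_inv_into[OF chU] chart_inv_into[OF chV])
  moreover have "x \<in> ?T" using p V chart_subset[OF chU] by auto
  ultimately show "\<exists>T. open T \<and> x \<in> T \<and> smooth_on T (\<lambda>x. f (h (inv_into U \<phi> x)))"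
    using op by blast
qed


section \<open>Bump functions\<close>

text \<open>The product of the bump with \<open>g\<close> is smooth on \<open>V\<close> and vanishes
  off a compact, hence closed, subset of \<open>V\<close>; these two open pieces cover the manifold.
  The bump \<open>b\<close> lives on the model space and is fixed before \<open>g\<close>, so that
  the extensions of the coordinates and of the constant 1 share it and their quotients recover the
  coordinates.\<close>

lemma bump_extension:
  fixes P :: "('a, 'e::real_inner) mfd"
  assumes P: "manifold P" and V: "(V, \<psi>) \<in> atlas P" and p: "p \<in> V" and W: "openin (mtop P) W" "p \<in> W"
  obtains b :: "'e \<Rightarrow> real" where
    "continuous_on UNIV b" "\<And>x. b x \<ge> 0" "b (\<psi> p) > 0"
    "\<And>q. q \<in> V \<Longrightarrow> b (\<psi> q) \<noteq> 0 \<Longrightarrow> q \<in> W"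
    "\<And>g :: 'e \<Rightarrow> complex. smooth_on (\<psi> ` V) g \<Longrightarrow>
       (\<lambda>q\<in>pts P. if q \<in> V then complex_of_real (b (\<psi> q)) * g (\<psi> q) else 0) \<in> smooth_functions P"
proof -
  obtain C :: "'e set" where C: "parseval_frame C" by (rule manifold_frame[OF P])
  have ch: "chart (mtop P) (V, \<psi>)" by (rule manifold_chart[OF P V])
  have "open (\<psi> ` (V \<inter> W))" by (rule chart_open_image_Int[OF ch W(1)])
  then obtain r where r: "r > 0" "cball (\<psi> p) r \<subseteq> \<psi> ` (V \<inter> W)"
    using p W(2) unfolding open_contains_cball by blast
  \<comment> \<open>The squared distance is written as an inner product: it is smooth by
    bilinearity, whereas the norm is not differentiable at the centre.\<close>
  define b where "b = (\<lambda>x. flat 0 (r\<^sup>2 - (x - \<psi> p) \<bullet> (x - \<psi> p)))"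
  have "smooth_on UNIV (\<lambda>x. x - \<psi> p)"
    by (rule smooth_on_diff[OF open_UNIV smooth_on_id smooth_on_const])
  then have "smooth_on UNIV (\<lambda>x. (x - \<psi> p) \<bullet> (x - \<psi> p))"
    using smooth_on_bilinear[OF bounded_bilinear_inner open_UNIV] by blast
  then have sf: "smooth_on UNIV (\<lambda>x. r\<^sup>2 - (x - \<psi> p) \<bullet> (x - \<psi> p))"
    by (rule smooth_on_diff[OF open_UNIV smooth_on_const])
  have sb: "smooth_on UNIV b"
    unfolding b_def by (rule smooth_on_compose[OF parseval_frame_real open_UNIV _ sf smooth_on_flat]) simp
  have b0: "x \<in> cball (\<psi> p) r" if "b x \<noteq> 0" for x
  proof -
    have "(norm (x - \<psi> p))\<^sup>2 < r\<^sup>2"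
      using that flat_nonpos[of "r\<^sup>2 - (x - \<psi> p) \<bullet> (x - \<psi> p)" 0] by (force simp: b_def power2_norm_eq_inner)
    then show ?thesis
      using r(1) by (simp add: dist_norm norm_minus_commute power2_less_imp_less less_imp_le)
  qed
  define K where "K = inv_into V \<psi> ` cball (\<psi> p) r"
  have "compactin (mtop P) K"
    unfolding K_def using r(2) by (intro chart_compactin[OF ch] compact_cball_parseval_frame[OF C]) auto
  \<comment> \<open>The Hausdorff property enters here: without it the extension by zero could fail
    to be smooth at boundary points outside \<open>V\<close>.\<close>
  then have K: "closedin (mtop P) K"
    using P compactin_imp_closedin unfolding manifold_def by blast
  have bK: "q \<in> K" if "q \<in> V" "b (\<psi> q) \<noteq> 0" for q
    using that b0 chart_inv_into[OF ch] unfolding K_def by (metis imageI)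
  have KV: "K \<subseteq> V \<inter> W"
    unfolding K_def using r(2) chart_inv_into[OF ch] by fastforce
  show ?thesis
  proof (rule that)
    show "continuous_on UNIV b" by (rule smooth_on_continuous_on[OF sb])
    show "b x \<ge> 0" for x by (simp add: b_def flat_def)
    show "b (\<psi> p) > 0" using r(1) by (simp add: b_def flat_pos)
    show "q \<in> W" if "q \<in> V" "b (\<psi> q) \<noteq> 0" for q using bK[OF that] KV by blast
    fix g :: "'e \<Rightarrow> complex" assume g: "smooth_on (\<psi> ` V) g"
    show "(\<lambda>q\<in>pts P. if q \<in> V then complex_of_real (b (\<psi> q)) * g (\<psi> q) else 0) \<in> smooth_functions P"
    proof (rule smooth_functions_restrictI[OF P], rule smooth_on_local)
      fix U \<phi> x assume U: "(U, \<phi>) \<in> atlas P" and "x \<in> \<phi> ` U"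
      then obtain q where q: "q \<in> U" "x = \<phi> q" by blast
      have chU: "chart (mtop P) (U, \<phi>)" by (rule manifold_chart[OF P U])
      let ?F = "\<lambda>q. if q \<in> V then complex_of_real (b (\<psi> q)) * g (\<psi> q) else 0"
      show "\<exists>T. open T \<and> x \<in> T \<and> smooth_on T (\<lambda>x. ?F (inv_into U \<phi> x))"
      proof (cases "q \<in> V")
        case True
        have op: "open (\<phi> ` (U \<inter> V))" using ch by (intro chart_open_image_Int[OF chU]) simp
        have opV: "open (\<psi> ` V)" using ch by simp
        have s1: "smooth_on (\<phi> ` (U \<inter> V)) (\<psi> \<circ> inv_into U \<phi>)"
          using manifold_compatible[OF P U V] by simp
        have s2: "smooth_on (\<psi> ` V) (\<lambda>x. complex_of_real (b x) * g x)"
          by (intro smooth_on_mult g smooth_on_bounded_linear_comp[OF bounded_linear_of_real] opV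
              smooth_on_subset[OF sb]) auto
        have "smooth_on (\<phi> ` (U \<inter> V)) (\<lambda>x. complex_of_real (b ((\<psi> \<circ> inv_into U \<phi>) x)) * g ((\<psi> \<circ> inv_into U \<phi>) x))"
          by (rule smooth_on_compose[OF C op _ s1 s2]) (auto simp: chart_inv_into[OF chU])
        then have "smooth_on (\<phi> ` (U \<inter> V)) (\<lambda>x. ?F (inv_into U \<phi> x))"
          by (rule smooth_on_cong[OF op]) (auto simp: chart_inv_into[OF chU])
        then show ?thesis using op True q by blast
      next
        case False
        have "openin (mtop P) (pts P - K)" using K by blast
        then have op: "open (\<phi> ` (U \<inter> (pts P - K)))" by (rule chart_open_image_Int[OF chU])
        have "?F (inv_into U \<phi> x) = 0" if "x \<in> \<phi> ` (U \<inter> (pts P - K))" for x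
          using that bK chart_inv_into[OF chU] by fastforce
        then have "smooth_on (\<phi> ` (U \<inter> (pts P - K))) (\<lambda>x. ?F (inv_into U \<phi> x))"
          by (intro smooth_on_cong[OF op smooth_on_const[of _ 0]]) simp
        moreover have "x \<in> \<phi> ` (U \<inter> (pts P - K))"
          using q False KV chart_subset[OF chU] by blast
        ultimately show ?thesis using op by blast
      qed
    qed
  qed
qed

lemma bump_function:
  assumes P: "manifold P" and W: "openin (mtop P) W" "p \<in> W"
  obtains f where "f \<in> smooth_functions P" "f p \<noteq> 0" "\<And>q. q \<in> pts P \<Longrightarrow> f q \<noteq> 0 \<Longrightarrow> q \<in> W"
proof -
  have p: "p \<in> pts P" using W openin_subset by blast
  obtain V \<psi> where V: "(V, \<psi>) \<in> atlas P" "p \<in> V" by (rule manifold_chart_at[OF P p])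
  show ?thesis
  proof (rule bump_extension[OF P V W])
    fix b assume b: "b (\<psi> p) > 0" "\<And>q. q \<in> V \<Longrightarrow> b (\<psi> q) \<noteq> 0 \<Longrightarrow> q \<in> W"
      "\<And>g. smooth_on (\<psi> ` V) g \<Longrightarrow>
         (\<lambda>q\<in>pts P. if q \<in> V then complex_of_real (b (\<psi> q)) * g (\<psi> q) else 0) \<in> smooth_functions P"
    show ?thesis
      by (rule that[OF b(3)[OF smooth_on_const[of _ 1]]]) (use b(1,2) p V in \<open>auto split: if_splits\<close>)
  qed
qed

lemma smooth_functions_separate:
  assumes P: "manifold P" and "p \<in> pts P" "q \<in> pts P" "p \<noteq> q"
  obtains f where "f \<in> smooth_functions P" "f p \<noteq> f q"
proof -
  have "closedin (mtop P) {q}"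
    using P assms(3) by (auto simp: manifold_def intro!: closedin_Hausdorff_singleton)
  then have "openin (mtop P) (pts P - {q})" by blast
  then obtain f where "f \<in> smooth_functions P" "f p \<noteq> 0" "\<And>q'. q' \<in> pts P \<Longrightarrow> f q' \<noteq> 0 \<Longrightarrow> q' \<in> pts P - {q}"
    using bump_function[OF P, of "pts P - {q}" p] assms by (metis DiffI singletonD)
  then show ?thesis using that assms(3) by (metis DiffD2 singletonI)
qed

text \<open>A coordinate \<open>\<psi>\<^sub>c\<close> is a quotient \<open>(b \<psi>\<^sub>c) / b\<close> of globally defined smooth functions near any
  point at which the bump function \<open>b\<close> is positive.\<close>

lemma smooth_map_if_pullbacks_smooth:
  fixes P :: "('a, 'e::real_inner) mfd" and Q :: "('b, 'f::real_inner) mfd"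
  assumes P: "manifold P" and Q: "manifold Q" and h: "\<And>p. p \<in> pts P \<Longrightarrow> h p \<in> pts Q"
    and pb: "\<And>f. f \<in> smooth_functions Q \<Longrightarrow> (\<lambda>p\<in>pts P. f (h p)) \<in> smooth_functions P"
  shows "smooth_map P Q h"
proof (rule smooth_mapI)
  \<comment> \<open>Continuity also comes from functions: bump functions show that the nonvanishing
    sets of smooth functions form a base of the topology, and their preimages are nonvanishing sets
    of pullbacks.\<close>
  have "openin (mtop P) {p \<in> pts P. h p \<in> W}" if W: "openin (mtop Q) W" for W
  proof (subst openin_subopen, intro ballI)
    fix p assume "p \<in> {p \<in> pts P. h p \<in> W}"
    then have p: "p \<in> pts P" "h p \<in> W" by auto
    obtain f where f: "f \<in> smooth_functions Q" "f (h p) \<noteq> 0" "\<And>q. q \<in> pts Q \<Longrightarrow> f q \<noteq> 0 \<Longrightarrow> q \<in> W"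
      using bump_function[OF Q W p(2)] by metis
    have "openin (mtop P) {q \<in> pts P. (\<lambda>p\<in>pts P. f (h p)) q \<in> - {0}}"
      by (rule openin_continuous_map_preimage[OF smooth_functions_continuous[OF P pb[OF f(1)]]]) auto
    moreover have "{q \<in> pts P. (\<lambda>p\<in>pts P. f (h p)) q \<in> - {0}} \<subseteq> {p \<in> pts P. h p \<in> W}"
      using f(3) h by auto
    moreover have "p \<in> {q \<in> pts P. (\<lambda>p\<in>pts P. f (h p)) q \<in> - {0}}" using p f(2) by auto
    ultimately show "\<exists>T. openin (mtop P) T \<and> p \<in> T \<and> T \<subseteq> {p \<in> pts P. h p \<in> W}" by blast
  qed
  then show cont: "continuous_map (mtop P) (mtop Q) h" using h by (auto simp: continuous_map)
  fix U \<phi> V \<psi> assume U: "(U, \<phi>) \<in> atlas P" and V: "(V, \<psi>) \<in> atlas Q"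
  have chU: "chart (mtop P) (U, \<phi>)" by (rule manifold_chart[OF P U])
  have chV: "chart (mtop Q) (V, \<psi>)" by (rule manifold_chart[OF Q V])
  have opV: "open (\<psi> ` V)" and oV: "openin (mtop Q) V" using chV by auto
  obtain D :: "'f set" where D: "parseval_frame D" by (rule manifold_frame[OF Q])
  show "smooth_on (\<phi> ` (U \<inter> h -` V)) (\<psi> \<circ> h \<circ> inv_into U \<phi>)"
  proof (rule smooth_on_local)
    fix x assume "x \<in> \<phi> ` (U \<inter> h -` V)"
    then obtain p where p: "p \<in> U" "h p \<in> V" "x = \<phi> p" by blast
    obtain b where b: "continuous_on UNIV b" "b (\<psi> (h p)) > 0"
      "\<And>g. smooth_on (\<psi> ` V) g \<Longrightarrow>
         (\<lambda>q\<in>pts Q. if q \<in> V then complex_of_real (b (\<psi> q)) * g (\<psi> q) else 0) \<in> smooth_functions Q"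
      using bump_extension[OF Q V p(2) oV p(2)] by metis
    define B where "B = (\<lambda>c. \<lambda>q\<in>pts Q. if q \<in> V then complex_of_real (b (\<psi> q)) * complex_of_real (\<psi> q \<bullet> c) else 0)"
    define B1 where "B1 = (\<lambda>q\<in>pts Q. if q \<in> V then complex_of_real (b (\<psi> q)) * 1 else 0)"
    have "B c \<in> smooth_functions Q" for c
      unfolding B_def by (rule b(3)) (intro smooth_on_bounded_linear_comp[OF bounded_linear_of_real] opV
          smooth_on_bounded_linear_comp[OF bounded_linear_inner_left] smooth_on_id)
    then have sB: "smooth_on (\<phi> ` U) ((\<lambda>p\<in>pts P. B c (h p)) \<circ> inv_into U \<phi>)" for c
      by (intro smooth_functions_chart[OF pb U])
    have "B1 \<in> smooth_functions Q" unfolding B1_def by (rule b(3)) (rule smooth_on_const)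
    then have pB1: "(\<lambda>p\<in>pts P. B1 (h p)) \<in> smooth_functions P" by (rule pb)
    then have sB1: "smooth_on (\<phi> ` U) ((\<lambda>p\<in>pts P. B1 (h p)) \<circ> inv_into U \<phi>)"
      by (rule smooth_functions_chart[OF _ U])
    \<comment> \<open>\<open>B1\<close> is 0 off \<open>V\<close>, so its nonvanishing at
      \<open>h q\<close> both places \<open>h q\<close> in \<open>V\<close> and allows division by
      the bump.\<close>
    define N where "N = {q \<in> pts P. (\<lambda>p\<in>pts P. B1 (h p)) q \<in> - {0}}"
    have "openin (mtop P) N"
      unfolding N_def by (rule openin_continuous_map_preimage[OF smooth_functions_continuous[OF P pB1]]) auto
    then have op: "open (\<phi> ` (U \<inter> N))" by (rule chart_open_image_Int[OF chU])
    have NV: "h q \<in> V \<and> b (\<psi> (h q)) \<noteq> 0" if "q \<in> N" for q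
      using that h by (auto simp: N_def B1_def split: if_splits)
    let ?Q = "\<lambda>y. \<Sum>c\<in>D. Re (((\<lambda>p\<in>pts P. B c (h p)) \<circ> inv_into U \<phi>) y
        * inverse (((\<lambda>p\<in>pts P. B1 (h p)) \<circ> inv_into U \<phi>) y)) *\<^sub>R c"
    have "smooth_on (\<phi> ` (U \<inter> N)) (\<lambda>y. inverse (((\<lambda>p\<in>pts P. B1 (h p)) \<circ> inv_into U \<phi>) y))"
      by (rule smooth_on_compose[OF parseval_frame_Basis op _ smooth_on_subset[OF sB1] smooth_on_inverse])
         (auto simp: N_def chart_inv_into[OF chU])
    then have s: "smooth_on (\<phi> ` (U \<inter> N)) ?Q"
      by (intro smooth_on_sum op smooth_on_scaleR smooth_on_const
          smooth_on_bounded_linear_comp[OF bounded_linear_Re] smooth_on_mult smooth_on_subset[OF sB]) auto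
    have "smooth_on (\<phi> ` (U \<inter> N)) (\<psi> \<circ> h \<circ> inv_into U \<phi>)"
    proof (rule smooth_on_cong[OF op s])
      fix y assume "y \<in> \<phi> ` (U \<inter> N)"
      then obtain q where q: "q \<in> U" "q \<in> N" "y = \<phi> q" by blast
      have qP: "q \<in> pts P" using q chart_subset[OF chU] by blast
      have hq: "h q \<in> V" "b (\<psi> (h q)) \<noteq> 0" "h q \<in> pts Q" using NV[OF q(2)] h[OF qP] by auto
      have "?Q y = (\<Sum>c\<in>D. (\<psi> (h q) \<bullet> c) *\<^sub>R c)"
        using hq qP q by (intro sum.cong) (auto simp: chart_inv_into[OF chU] B_def B1_def power2_eq_square)
      also have "\<dots> = \<psi> (h q)" using D by (simp add: parseval_frame_def)
      finally show "?Q y = (\<psi> \<circ> h \<circ> inv_into U \<phi>) y"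
        using q by (simp add: chart_inv_into[OF chU])
    qed
    moreover have "x \<in> \<phi> ` (U \<inter> N)"
      using p b(2) chart_subset[OF chU] chart_subset[OF chV] by (auto simp: N_def B1_def)
    ultimately show "\<exists>T. open T \<and> x \<in> T \<and> smooth_on T (\<psi> \<circ> h \<circ> inv_into U \<phi>)"
      using op by blast
  qed
qed

text \<open>Pulling functions back twice avoids composing coordinate expressions; the pullback
  criterion then returns a smooth map.\<close>

lemma smooth_map_compose:
  assumes P: "manifold P" and Q: "manifold Q" and R: "manifold R"
    and h: "smooth_map P Q h" and k: "smooth_map Q R k"
  shows "smooth_map P R (\<lambda>p. k (h p))"
proof (rule smooth_map_if_pullbacks_smooth[OF P R])
  show "k (h p) \<in> pts R" if "p \<in> pts P" for p
    using smooth_map_in_pts[OF k smooth_map_in_pts[OF h that]] .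
  fix f assume "f \<in> smooth_functions R"
  then have "(\<lambda>p\<in>pts P. (\<lambda>x\<in>pts Q. f (k x)) (h p)) \<in> smooth_functions P"
    by (intro smooth_functions_pullback[OF P Q h] smooth_functions_pullback[OF Q R k])
  moreover have "(\<lambda>p\<in>pts P. (\<lambda>x\<in>pts Q. f (k x)) (h p)) = (\<lambda>p\<in>pts P. f (k (h p)))"
    using smooth_map_in_pts[OF h] by auto
  ultimately show "(\<lambda>p\<in>pts P. f (k (h p))) \<in> smooth_functions P" by simp
qed


section \<open>The smooth compact-open topology\<close>

definition smooth_ball ::
    "('a, 'e::real_inner) mfd \<Rightarrow> ('a \<Rightarrow> complex) \<Rightarrow> 'a set \<Rightarrow> ('a \<Rightarrow> 'e) \<Rightarrow> 'e set \<Rightarrow> 'e list \<Rightarrow> real \<Rightarrow>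
     ('a \<Rightarrow> complex) set" where
  "smooth_ball P f U \<phi> K vs \<epsilon> = {g \<in> smooth_functions P. \<forall>x\<in>K.
     cmod (iter_deriv vs (g \<circ> inv_into U \<phi>) x - iter_deriv vs (f \<circ> inv_into U \<phi>) x) < \<epsilon>}"

definition smooth_subbasis :: "('a, 'e::real_inner) mfd \<Rightarrow> ('a \<Rightarrow> complex) set set" where
  "smooth_subbasis P = insert (smooth_functions P) {smooth_ball P f U \<phi> K vs \<epsilon> | f U \<phi> K vs \<epsilon>.
     f \<in> smooth_functions P \<and> (U, \<phi>) \<in> atlas P \<and> compact K \<and> K \<subseteq> \<phi> ` U \<and> \<epsilon> > 0}"

lemma smooth_topology_eq: "smooth_topology P = topology_generated_by (smooth_subbasis P)"
  by (simp add: smooth_topology_def smooth_subbasis_def smooth_ball_def)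

lemma smooth_subbasisE:
  assumes "W \<in> smooth_subbasis P"
  obtains "W = smooth_functions P" | f U \<phi> K vs \<epsilon> where "W = smooth_ball P f U \<phi> K vs \<epsilon>"
    "f \<in> smooth_functions P" "(U, \<phi>) \<in> atlas P" "compact K" "K \<subseteq> \<phi> ` U" "\<epsilon> > 0"
  using assms unfolding smooth_subbasis_def by blast

lemma openin_smooth_topology: "openin (smooth_topology P) W \<longleftrightarrow> generate_topology_on (smooth_subbasis P) W"
  by (simp add: smooth_topology_eq openin_topology_generated_by_iff)

lemma openin_smooth_ball:
  assumes "f \<in> smooth_functions P" "(U, \<phi>) \<in> atlas P" "compact K" "K \<subseteq> \<phi> ` U" "\<epsilon> > 0"
  shows "openin (smooth_topology P) (smooth_ball P f U \<phi> K vs \<epsilon>)"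
  unfolding openin_smooth_topology
  by (rule generate_topology_on.Basis) (use assms in \<open>auto simp: smooth_subbasis_def\<close>)

lemma topspace_smooth_topology: "topspace (smooth_topology P) = smooth_functions P"
  unfolding smooth_topology_eq topology_generated_by_topspace by (auto simp: smooth_subbasis_def smooth_ball_def)

text \<open>One half of a dictionary between this topology and uniform limits along neighbourhood
  filters. The next introduction rule for continuous maps is the other half, and with both the
  continuity of an operation becomes a computation with uniform limits.\<close>

lemma uniform_limit_iter_deriv:
  assumes "f0 \<in> smooth_functions P" "(U, \<phi>) \<in> atlas P" "compact K" "K \<subseteq> \<phi> ` U"
  shows "uniform_limit K (\<lambda>f. iter_deriv vs (f \<circ> inv_into U \<phi>)) (iter_deriv vs (f0 \<circ> inv_into U \<phi>))
    (nhdsin (smooth_topology P) f0)"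
proof (rule uniform_limitI)
  fix e :: real assume e: "e > 0"
  have "f0 \<in> smooth_ball P f0 U \<phi> K vs e" using assms(1) e by (simp add: smooth_ball_def)
  then show "\<forall>\<^sub>F f in nhdsin (smooth_topology P) f0. \<forall>x\<in>K.
      dist (iter_deriv vs (f \<circ> inv_into U \<phi>) x) (iter_deriv vs (f0 \<circ> inv_into U \<phi>) x) < e"
    unfolding eventually_nhdsin using openin_smooth_ball[OF assms e]
    by (intro disjI2 exI[of _ "smooth_ball P f0 U \<phi> K vs e"]) (auto simp: smooth_ball_def dist_norm)
qed

lemma smooth_functions_iter_deriv_continuous:
  assumes "f \<in> smooth_functions P" "(U, \<phi>) \<in> atlas P" "K \<subseteq> \<phi> ` U"
  shows "continuous_on K (iter_deriv vs (f \<circ> inv_into U \<phi>))"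
  by (rule continuous_on_subset[OF smooth_on_continuous_on[OF smooth_on_iter_deriv[OF smooth_functions_chart[OF assms(1,2)]]] assms(3)])

lemma bounded_iter_deriv:
  assumes "f \<in> smooth_functions P" "(U, \<phi>) \<in> atlas P" "compact K" "K \<subseteq> \<phi> ` U"
  shows "bounded (iter_deriv vs (f \<circ> inv_into U \<phi>) ` K)"
  by (rule compact_imp_bounded[OF compact_continuous_image[OF
        smooth_functions_iter_deriv_continuous[OF assms(1,2,4)] assms(3)]])

text \<open>A subbasic ball need not be centred at \<open>T y\<close>, so the uniform limit at
  \<open>T y\<close> has to fit into whatever room the ball leaves around that function.\<close>

lemma continuous_map_smooth_topologyI:
  assumes SF: "\<And>y. y \<in> topspace X \<Longrightarrow> T y \<in> smooth_functions P"
    and lim: "\<And>y U \<phi> K vs. y \<in> topspace X \<Longrightarrow> (U, \<phi>) \<in> atlas P \<Longrightarrow> compact K \<Longrightarrow> K \<subseteq> \<phi> ` U \<Longrightarrow>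
      uniform_limit K (\<lambda>y. iter_deriv vs (T y \<circ> inv_into U \<phi>)) (iter_deriv vs (T y \<circ> inv_into U \<phi>)) (nhdsin X y)"
  shows "continuous_map X (smooth_topology P) T"
  unfolding smooth_topology_eq
proof (rule continuous_on_generated_topo)
  show "T ` topspace X \<subseteq> \<Union>(smooth_subbasis P)" using SF by (auto simp: smooth_subbasis_def)
  fix W assume "W \<in> smooth_subbasis P"
  then show "openin X (T -` W \<inter> topspace X)"
  proof (cases rule: smooth_subbasisE)
    case 1
    then have "T -` W \<inter> topspace X = topspace X" using SF by auto
    then show ?thesis by simp
  next
    case (2 f U \<phi> K vs \<epsilon>)
    let ?D = "\<lambda>g. iter_deriv vs (g \<circ> inv_into U \<phi>)"
    show ?thesis
    proof (subst openin_subopen, intro ballI)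
      fix y assume "y \<in> T -` W \<inter> topspace X"
      then have y: "y \<in> topspace X" "T y \<in> smooth_functions P" "\<And>x. x \<in> K \<Longrightarrow> cmod (?D (T y) x - ?D f x) < \<epsilon>"
        using 2(1) by (auto simp: smooth_ball_def)
      \<comment> \<open>Strict inequality at each point alone gives no uniform margin. The maximum
        over the compact set does, and \<open>\<epsilon> - m\<close> becomes the tolerance; for
        empty \<open>K\<close> any number below \<open>\<epsilon>\<close> will do.\<close>
      obtain m where m: "m < \<epsilon>" "\<And>x. x \<in> K \<Longrightarrow> cmod (?D (T y) x - ?D f x) \<le> m"
      proof (cases "K = {}")
        case True
        show ?thesis by (rule that[of "\<epsilon> - 1"]) (use True in auto)
      next
        case False
        have "continuous_on K (\<lambda>x. cmod (?D (T y) x - ?D f x))"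
          using 2 y(2) by (intro continuous_intros smooth_functions_iter_deriv_continuous)
        from continuous_attains_sup[OF 2(4) False this] obtain x where "x \<in> K"
          "\<forall>z\<in>K. cmod (?D (T y) z - ?D f z) \<le> cmod (?D (T y) x - ?D f x)" by blast
        then show ?thesis using that y(3) by blast
      qed
      have "\<forall>\<^sub>F z in nhdsin X y. \<forall>x\<in>K. dist (?D (T z) x) (?D (T y) x) < \<epsilon> - m"
        using uniform_limitD[OF lim[OF y(1) 2(3-5)], of "\<epsilon> - m"] m(1) by simp
      then obtain N where N: "openin X N" "y \<in> N" "\<And>z x. z \<in> N \<Longrightarrow> x \<in> K \<Longrightarrow> dist (?D (T z) x) (?D (T y) x) < \<epsilon> - m"
        unfolding eventually_nhdsin using y(1) by blast
      have "N \<subseteq> T -` W \<inter> topspace X"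
      proof
        fix z assume z: "z \<in> N"
        have zX: "z \<in> topspace X" using z N(1) openin_subset by blast
        have "cmod (?D (T z) x - ?D f x) < \<epsilon>" if "x \<in> K" for x
          using N(3)[OF z that] m(2)[OF that] norm_triangle_ineq[of "?D (T z) x - ?D (T y) x" "?D (T y) x - ?D f x"]
          by (simp add: dist_norm)
        then show "z \<in> T -` W \<inter> topspace X" using SF[OF zX] zX 2(1) by (auto simp: smooth_ball_def)
      qed
      then show "\<exists>N. openin X N \<and> y \<in> N \<and> N \<subseteq> T -` W \<inter> topspace X" using N by blast
    qed
  qed
qed

lemma filterlim_nhdsin_continuous:
  assumes "continuous_map X Y h" "x \<in> topspace X"
  shows "filterlim h (nhdsin Y (h x)) (nhdsin X x)"
  unfolding filterlim_iff
proof (intro allI impI)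
  fix R assume R: "eventually R (nhdsin Y (h x))"
  have "h x \<in> topspace Y" using assms by (auto simp: continuous_map_def)
  then obtain S where S: "openin Y S" "h x \<in> S" "\<forall>y\<in>S. R y" using R by (auto simp: eventually_nhdsin)
  have "openin X {x \<in> topspace X. h x \<in> S}"
    using assms(1) S(1) by (rule openin_continuous_map_preimage)
  then show "\<forall>\<^sub>F x in nhdsin X x. R (h x)"
    unfolding eventually_nhdsin using S assms(2) by (intro disjI2 exI[of _ "{x \<in> topspace X. h x \<in> S}"]) auto
qed

lemma uniform_limit_iter_deriv_compose:
  assumes "continuous_map X (smooth_topology P) T" "y \<in> topspace X"
    and "(U, \<phi>) \<in> atlas P" "compact K" "K \<subseteq> \<phi> ` U"
  shows "uniform_limit K (\<lambda>y. iter_deriv vs (T y \<circ> inv_into U \<phi>)) (iter_deriv vs (T y \<circ> inv_into U \<phi>)) (nhdsin X y)"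
proof -
  have "T y \<in> smooth_functions P"
    using assms(1,2) by (auto simp: continuous_map_def topspace_smooth_topology)
  from filterlim_compose[OF uniform_limit_iter_deriv[OF this assms(3-5)] filterlim_nhdsin_continuous[OF assms(1,2)]]
  show ?thesis .
qed

lemma iter_deriv_restrict:
  assumes P: "manifold P" and U: "(U, \<phi>) \<in> atlas P" and x: "x \<in> \<phi> ` U"
  shows "iter_deriv vs (restrict f (pts P) \<circ> inv_into U \<phi>) x = iter_deriv vs (\<lambda>x. f (inv_into U \<phi> x)) x"
proof -
  have ch: "chart (mtop P) (U, \<phi>)" by (rule manifold_chart[OF P U])
  have "open (\<phi> ` U)" using ch by simp
  then show ?thesis
    by (rule iter_deriv_cong_open) (use chart_subset[OF ch] chart_inv_into[OF ch] x in auto)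
qed

lemma uniform_limit_iter_deriv_eq:
  assumes "y \<in> topspace X" "uniform_limit K D (D y) (nhdsin X y)"
    and "\<And>z x. z \<in> topspace X \<Longrightarrow> x \<in> K \<Longrightarrow> iter_deriv vs (T z) x = D z x"
  shows "uniform_limit K (\<lambda>z. iter_deriv vs (T z)) (iter_deriv vs (T y)) (nhdsin X y)"
proof -
  have "\<forall>\<^sub>F z in nhdsin X y. z \<in> topspace X"
    using assms(1) by (auto simp: eventually_nhdsin)
  then have "\<forall>\<^sub>F z in nhdsin X y. \<forall>x\<in>K. D z x = iter_deriv vs (T z) x"
    by (rule eventually_mono) (simp add: assms(3))
  then show ?thesis
    using uniform_limit_cong[of K D "\<lambda>z. iter_deriv vs (T z)" "nhdsin X y" "D y" "iter_deriv vs (T y)"] assms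
    by simp
qed

section \<open>Continuity of the algebra operations and of pullback\<close>

lemma continuous_map_smooth_add:
  assumes P: "manifold P" and S: "continuous_map X (smooth_topology P) S" and T: "continuous_map X (smooth_topology P) T"
  shows "continuous_map X (smooth_topology P) (\<lambda>y. \<lambda>p\<in>pts P. S y p + T y p)"
proof (rule continuous_map_smooth_topologyI)
  have SF: "S y \<in> smooth_functions P" "T y \<in> smooth_functions P" if "y \<in> topspace X" for y
    using S T that by (auto simp: continuous_map_def topspace_smooth_topology)
  then show "(\<lambda>p\<in>pts P. S y p + T y p) \<in> smooth_functions P" if "y \<in> topspace X" for y
    using that by (intro smooth_functions_add[OF P])
  fix y U \<phi> K vs assume y: "y \<in> topspace X" and U: "(U, \<phi>) \<in> atlas P" and K: "compact K" "K \<subseteq> \<phi> ` U"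
  have op: "open (\<phi> ` U)" using manifold_chart[OF P U] by simp
  show "uniform_limit K (\<lambda>y. iter_deriv vs ((\<lambda>p\<in>pts P. S y p + T y p) \<circ> inv_into U \<phi>))
      (iter_deriv vs ((\<lambda>p\<in>pts P. S y p + T y p) \<circ> inv_into U \<phi>)) (nhdsin X y)"
  proof (rule uniform_limit_iter_deriv_eq[OF y uniform_limit_add[OF
          uniform_limit_iter_deriv_compose[OF S y U K] uniform_limit_iter_deriv_compose[OF T y U K]]])
    fix z x assume z: "z \<in> topspace X" and "x \<in> K"
    then have x: "x \<in> \<phi> ` U" using K by blast
    show "iter_deriv vs ((\<lambda>p\<in>pts P. S z p + T z p) \<circ> inv_into U \<phi>) x
        = iter_deriv vs (S z \<circ> inv_into U \<phi>) x + iter_deriv vs (T z \<circ> inv_into U \<phi>) x"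
      unfolding iter_deriv_restrict[OF P U x]
      using iter_deriv_add[OF op smooth_functions_chart[OF SF(1)[OF z] U] smooth_functions_chart[OF SF(2)[OF z] U] x, of vs]
      by simp
  qed
qed

lemma uniform_limit_sum_list:
  fixes F :: "'p \<Rightarrow> 'a \<Rightarrow> 'b \<Rightarrow> 'c::real_normed_vector"
  assumes "\<And>p. p \<in> set ps \<Longrightarrow> uniform_limit K (F p) (l p) N"
  shows "uniform_limit K (\<lambda>y x. \<Sum>p\<leftarrow>ps. F p y x) (\<lambda>x. \<Sum>p\<leftarrow>ps. l p x) N"
  using assms by (induction ps) (auto intro!: uniform_limit_add uniform_limit_const)

text \<open>The Leibniz sum is a finite sum of products of uniformly convergent factors. Products of
  uniform limits need bounded limit functions, and compactness of \<open>K\<close> provides the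
  bounds.\<close>

lemma continuous_map_smooth_mult:
  fixes P :: "('a, 'e::real_inner) mfd"
  assumes P: "manifold P" and S: "continuous_map X (smooth_topology P) S" and T: "continuous_map X (smooth_topology P) T"
  shows "continuous_map X (smooth_topology P) (\<lambda>y. \<lambda>p\<in>pts P. S y p * T y p)"
proof (rule continuous_map_smooth_topologyI)
  have SF: "S y \<in> smooth_functions P" "T y \<in> smooth_functions P" if "y \<in> topspace X" for y
    using S T that by (auto simp: continuous_map_def topspace_smooth_topology)
  then show "(\<lambda>p\<in>pts P. S y p * T y p) \<in> smooth_functions P" if "y \<in> topspace X" for y
    using that by (intro smooth_functions_mult[OF P])
  fix y U \<phi> K and vs :: "'e list"
  assume y: "y \<in> topspace X" and U: "(U, \<phi>) \<in> atlas P" and K: "compact K" "K \<subseteq> \<phi> ` U"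
  have op: "open (\<phi> ` U)" using manifold_chart[OF P U] by simp
  obtain ps :: "('e list \<times> 'e list) list" where ps:
    "\<And>S f g x. open S \<Longrightarrow> smooth_on S f \<Longrightarrow> smooth_on S g \<Longrightarrow> x \<in> S \<Longrightarrow>
       iter_deriv vs (\<lambda>x. f x * g x :: complex) x = (\<Sum>(u, w)\<leftarrow>ps. iter_deriv u f x * iter_deriv w g x)"
    using iter_deriv_mult[of vs] by blast
  let ?D = "\<lambda>z x. \<Sum>r\<leftarrow>ps. iter_deriv (fst r) (S z \<circ> inv_into U \<phi>) x * iter_deriv (snd r) (T z \<circ> inv_into U \<phi>) x"
  have "uniform_limit K ?D (?D y) (nhdsin X y)"
    by (intro uniform_limit_sum_list uniform_lim_mult uniform_limit_iter_deriv_compose[OF S y U K]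
        uniform_limit_iter_deriv_compose[OF T y U K] bounded_iter_deriv[OF SF(1)[OF y] U K]
        bounded_iter_deriv[OF SF(2)[OF y] U K])
  then show "uniform_limit K (\<lambda>y. iter_deriv vs ((\<lambda>p\<in>pts P. S y p * T y p) \<circ> inv_into U \<phi>))
      (iter_deriv vs ((\<lambda>p\<in>pts P. S y p * T y p) \<circ> inv_into U \<phi>)) (nhdsin X y)"
  proof (rule uniform_limit_iter_deriv_eq[OF y])
    fix z x assume z: "z \<in> topspace X" and "x \<in> K"
    then have x: "x \<in> \<phi> ` U" using K by blast
    show "iter_deriv vs ((\<lambda>p\<in>pts P. S z p * T z p) \<circ> inv_into U \<phi>) x = ?D z x"
      unfolding iter_deriv_restrict[OF P U x]
      using ps[OF op smooth_functions_chart[OF SF(1)[OF z] U] smooth_functions_chart[OF SF(2)[OF z] U] x]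
      by (simp add: case_prod_unfold)
  qed
qed

text \<open>Embeds the scalars as constant functions, so that scalar multiplication becomes an
  instance of multiplication.\<close>

lemma continuous_map_smooth_const:
  fixes P :: "('a, 'e::real_inner) mfd"
  assumes P: "manifold P" and c: "continuous_map X euclidean c"
  shows "continuous_map X (smooth_topology P) (\<lambda>y. \<lambda>p\<in>pts P. c y)"
proof (rule continuous_map_smooth_topologyI)
  show "(\<lambda>p\<in>pts P. c y) \<in> smooth_functions P" for y by (rule smooth_functions_const[OF P])
  fix y U \<phi> K and vs :: "'e list"
  assume y: "y \<in> topspace X" and U: "(U, \<phi>) \<in> atlas P" and K: "compact K" "K \<subseteq> \<phi> ` U"
  have eq: "iter_deriv vs ((\<lambda>p\<in>pts P. c z) \<circ> inv_into U \<phi>) x = (if vs = [] then c z else 0)" if "x \<in> K" for z x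
  proof -
    have x: "x \<in> \<phi> ` U" using that K by blast
    show ?thesis unfolding iter_deriv_restrict[OF P U x] by (simp add: iter_deriv_const)
  qed
  have lim: "filterlim c (nhdsin euclidean (c y)) (nhdsin X y)"
    by (rule filterlim_nhdsin_continuous[OF c y])
  show "uniform_limit K (\<lambda>y. iter_deriv vs ((\<lambda>p\<in>pts P. c y) \<circ> inv_into U \<phi>))
      (iter_deriv vs ((\<lambda>p\<in>pts P. c y) \<circ> inv_into U \<phi>)) (nhdsin X y)"
  proof (rule uniform_limitI)
    fix e :: real assume e: "e > 0"
    have "\<forall>\<^sub>F w in nhdsin euclidean (c y). dist w (c y) < e"
      unfolding eventually_nhdsin using e by (intro disjI2 exI[of _ "ball (c y) e"]) (auto simp: dist_commute)
    then have "\<forall>\<^sub>F z in nhdsin X y. dist (c z) (c y) < e"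
      using lim by (auto simp: filterlim_iff)
    then show "\<forall>\<^sub>F z in nhdsin X y. \<forall>x\<in>K. dist (iter_deriv vs ((\<lambda>p\<in>pts P. c z) \<circ> inv_into U \<phi>) x)
        (iter_deriv vs ((\<lambda>p\<in>pts P. c y) \<circ> inv_into U \<phi>) x) < e"
      by (rule eventually_mono) (use e in \<open>auto simp: eq\<close>)
  qed
qed

text \<open>The image of a compact set under \<open>h\<close> need not lie in one chart of
  \<open>Q\<close>. Around each point there is a piece of \<open>K\<close> that does, where the
  chain rule applies with coefficients bounded by compactness; finitely many pieces cover
  \<open>K\<close>, and uniform limits pass to finite unions.\<close>

lemma continuous_map_pullback:
  fixes P :: "('a, 'e::real_inner) mfd" and Q :: "('b, 'f::real_inner) mfd"
  assumes P: "manifold P" and Q: "manifold Q" and h: "smooth_map P Q h"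
  shows "continuous_map (smooth_topology Q) (smooth_topology P) (\<lambda>f. \<lambda>p\<in>pts P. f (h p))"
proof (rule continuous_map_smooth_topologyI)
  show "(\<lambda>p\<in>pts P. f (h p)) \<in> smooth_functions P" if "f \<in> topspace (smooth_topology Q)" for f
    using smooth_functions_pullback[OF P Q h] that by (simp add: topspace_smooth_topology)
  fix f0 U \<phi> K and vs :: "'e list"
  assume "f0 \<in> topspace (smooth_topology Q)" and U: "(U, \<phi>) \<in> atlas P" and K: "compact K" "K \<subseteq> \<phi> ` U"
  then have f0: "f0 \<in> smooth_functions Q" by (simp add: topspace_smooth_topology)
  have chU: "chart (mtop P) (U, \<phi>)" by (rule manifold_chart[OF P U])
  obtain D :: "'f set" where D: "parseval_frame D" by (rule manifold_frame[OF Q])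
  let ?T = "\<lambda>f. \<lambda>p\<in>pts P. f (h p)"
  let ?lim = "\<lambda>K. uniform_limit K (\<lambda>f. iter_deriv vs (?T f \<circ> inv_into U \<phi>))
    (iter_deriv vs (?T f0 \<circ> inv_into U \<phi>)) (nhdsin (smooth_topology Q) f0)"
  have loc: "\<exists>r>0. ?lim (K \<inter> cball x r)" if x: "x \<in> K" for x
  proof -
    obtain p where p: "p \<in> U" "x = \<phi> p" using x K(2) by blast
    have "h p \<in> pts Q" using smooth_map_in_pts[OF h] p chart_subset[OF chU] by blast
    then obtain V \<psi> where V: "(V, \<psi>) \<in> atlas Q" "h p \<in> V" by (rule manifold_chart_at[OF Q])
    have chV: "chart (mtop Q) (V, \<psi>)" by (rule manifold_chart[OF Q V(1)])
    define S where "S = \<phi> ` (U \<inter> {q \<in> pts P. h q \<in> V})"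
    have "openin (mtop P) {q \<in> pts P. h q \<in> V}"
      by (rule openin_continuous_map_preimage[OF smooth_map_continuous[OF h]]) (use chV in auto)
    then have S: "open S" unfolding S_def by (rule chart_open_image_Int[OF chU])
    define F where "F = \<psi> \<circ> h \<circ> inv_into U \<phi>"
    have sF: "smooth_on S F" unfolding F_def S_def
      by (rule smooth_on_subset[OF smooth_map_charts[OF h U V(1)]]) auto
    have FS: "F ` S \<subseteq> \<psi> ` V" unfolding F_def S_def by (auto simp: chart_inv_into[OF chU])
    have fF: "f (h (inv_into U \<phi> y)) = (f \<circ> inv_into V \<psi>) (F y)" if "y \<in> S" for f y
      using that by (auto simp: S_def F_def chart_inv_into[OF chU] chart_inv_into[OF chV])
    obtain ps :: "(('e \<Rightarrow> complex) \<times> 'f list) list" where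
      c: "\<And>c w. (c, w) \<in> set ps \<Longrightarrow> smooth_on S c" and ps:
      "\<And>(f :: 'f \<Rightarrow> complex) x. smooth_on (\<psi> ` V) f \<Longrightarrow> x \<in> S \<Longrightarrow>
         iter_deriv vs (\<lambda>x. f (F x)) x = (\<Sum>(c, w)\<leftarrow>ps. c x * iter_deriv w f (F x))"
      using iter_deriv_compose[OF D S sF FS, of vs] by blast
    have "x \<in> S" using p V chart_subset[OF chU] by (auto simp: S_def)
    then obtain r where r: "r > 0" "cball x r \<subseteq> S" using S unfolding open_contains_cball by blast
    define K' where "K' = K \<inter> cball x r"
    have K': "compact K'" "K' \<subseteq> S" using K(1) r(2) by (auto simp: K'_def compact_Int_closed)
    \<comment> \<open>The image of \<open>K'\<close> is a compact subset of the chart image of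
      \<open>V\<close>, so the topology on the functions on \<open>Q\<close> controls their
      derivatives along it uniformly.\<close>
    have FK: "compact (F ` K')" "F ` K' \<subseteq> \<psi> ` V"
      using K' FS smooth_on_continuous_on[OF sF]
      by (auto intro!: compact_continuous_image intro: continuous_on_subset)
    let ?D = "\<lambda>f y. \<Sum>r\<leftarrow>ps. fst r y * iter_deriv (snd r) (f \<circ> inv_into V \<psi>) (F y)"
    have eq: "iter_deriv vs (?T f \<circ> inv_into U \<phi>) y = ?D f y" if "f \<in> smooth_functions Q" "y \<in> K'" for f y
    proof -
      have y: "y \<in> \<phi> ` U" "y \<in> S" using that(2) K' K(2) by (auto simp: K'_def)
      have "iter_deriv vs (?T f \<circ> inv_into U \<phi>) y = iter_deriv vs (\<lambda>x. f (h (inv_into U \<phi> x))) y"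
        by (rule iter_deriv_restrict[OF P U y(1)])
      also have "\<dots> = iter_deriv vs (\<lambda>x. (f \<circ> inv_into V \<psi>) (F x)) y"
        by (rule iter_deriv_cong_open[OF S fF y(2)])
      also have "\<dots> = ?D f y"
        using ps[OF smooth_functions_chart[OF that(1) V(1)] y(2)] by (simp add: case_prod_unfold)
      finally show ?thesis .
    qed
    have lim: "uniform_limit K' (\<lambda>f y. iter_deriv w (f \<circ> inv_into V \<psi>) (F y))
        (\<lambda>y. iter_deriv w (f0 \<circ> inv_into V \<psi>) (F y)) (nhdsin (smooth_topology Q) f0)" for w
    proof (rule uniform_limitI)
      fix e :: real assume "e > 0"
      from uniform_limitD[OF uniform_limit_iter_deriv[OF f0 V(1) FK] this]
      show "\<forall>\<^sub>F f in nhdsin (smooth_topology Q) f0. \<forall>y\<in>K'.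
         dist (iter_deriv w (f \<circ> inv_into V \<psi>) (F y)) (iter_deriv w (f0 \<circ> inv_into V \<psi>) (F y)) < e"
        by (rule eventually_mono) blast
    qed
    have bd: "bounded ((\<lambda>y. iter_deriv w (f0 \<circ> inv_into V \<psi>) (F y)) ` K')" for w
      using bounded_iter_deriv[OF f0 V(1) FK, of w] by (simp add: image_image)
    have bc: "bounded (fst r ` K')" if "r \<in> set ps" for r
      using c[of "fst r" "snd r"] that K'
      by (intro compact_imp_bounded compact_continuous_image)
         (auto intro: continuous_on_subset[OF smooth_on_continuous_on])
    have "uniform_limit K' ?D (?D f0) (nhdsin (smooth_topology Q) f0)"
      by (intro uniform_limit_sum_list uniform_lim_mult uniform_limit_const lim bd bc)
    then have "?lim K'"
      by (rule uniform_limit_iter_deriv_eq[rotated]) (simp_all add: eq f0 topspace_smooth_topology)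
    then show ?thesis using r(1) unfolding K'_def by blast
  qed
  then obtain r where r: "\<And>x. x \<in> K \<Longrightarrow> r x > 0"
    "\<And>x. x \<in> K \<Longrightarrow> ?lim (K \<inter> cball x (r x))"
    by metis
  have "K \<subseteq> (\<Union>x\<in>K. ball x (r x))" using r(1) by force
  then obtain C where C: "C \<subseteq> K" "finite C" "K \<subseteq> (\<Union>x\<in>C. ball x (r x))"
    using compactE_image[OF K(1), of K "\<lambda>x. ball x (r x)"] by auto
  have "?lim (\<Union>((\<lambda>x. K \<inter> cball x (r x)) ` C))"
    by (rule uniform_limit_on_Union) (use C r(2) in auto)
  then show "?lim K"
    by (rule uniform_limit_on_subset) (use C(3) in \<open>force dest: subsetD[OF ball_subset_cball]\<close>)
qed


section \<open>Characters of the algebra of smooth functions\<close>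

text \<open>A subbasic ball tests derivatives along one compact set, and these are fixed by the
  values near it; finite intersections unite the compact sets, and a union uses the set of a member
  containing \<open>f\<close>. Agreement is required on a neighbourhood of \<open>K\<close> because
  values on \<open>K\<close> alone do not fix derivatives.\<close>

lemma smooth_topology_compact_dependence:
  assumes P: "manifold P" and W: "openin (smooth_topology P) W" and f: "f \<in> W"
  obtains K where "compactin (mtop P) K"
    "\<And>g N. g \<in> smooth_functions P \<Longrightarrow> openin (mtop P) N \<Longrightarrow> K \<subseteq> N \<Longrightarrow> (\<And>q. q \<in> N \<Longrightarrow> g q = f q) \<Longrightarrow> g \<in> W"
proof -
  define dep where "dep W f K \<longleftrightarrow> compactin (mtop P) K \<and> (\<forall>g\<in>smooth_functions P. \<forall>N. openin (mtop P) N \<and> K \<subseteq> N \<and>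
      (\<forall>q\<in>N. g q = f q) \<longrightarrow> g \<in> W)" for W f K
  have "generate_topology_on (smooth_subbasis P) W"
    using W by (simp add: openin_smooth_topology)
  then have "\<forall>f\<in>W. \<exists>K. dep W f K"
  proof induction
    case Empty
    then show ?case by simp
  next
    case (Int a b)
    show ?case
    proof
      fix f assume "f \<in> a \<inter> b"
      then obtain K L where "dep a f K" "dep b f L" using Int.IH by blast
      then have "dep (a \<inter> b) f (K \<union> L)"
        unfolding dep_def by (auto simp: compactin_Un)
      then show "\<exists>K. dep (a \<inter> b) f K" ..
    qed
  next
    case (UN A)
    show ?case
    proof
      fix f assume "f \<in> \<Union>A"
      then obtain a where "a \<in> A" "f \<in> a" by blast
      then obtain K where "dep a f K" using UN.IH by blast
      then have "dep (\<Union>A) f K" using \<open>a \<in> A\<close> unfolding dep_def by blast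
      then show "\<exists>K. dep (\<Union>A) f K" ..
    qed
  next
    case (Basis s)
    show ?case
    proof
      fix f assume f: "f \<in> s"
      from Basis show "\<exists>K. dep s f K"
      proof (cases rule: smooth_subbasisE)
        case 1
        then have "dep s f {}" by (simp add: dep_def)
        then show ?thesis ..
      next
        case (2 f0 U \<phi> K vs \<epsilon>)
        have ch: "chart (mtop P) (U, \<phi>)" by (rule manifold_chart[OF P 2(3)])
        have "g \<in> s" if g: "g \<in> smooth_functions P" "openin (mtop P) N" "inv_into U \<phi> ` K \<subseteq> N" "\<And>q. q \<in> N \<Longrightarrow> g q = f q"
          for g N
        proof -
          have op: "open (\<phi> ` (U \<inter> N))" by (rule chart_open_image_Int[OF ch g(2)])
          have "iter_deriv vs (g \<circ> inv_into U \<phi>) x = iter_deriv vs (f \<circ> inv_into U \<phi>) x" if x: "x \<in> K" for x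
          proof (rule iter_deriv_cong_open[OF op])
            show "(g \<circ> inv_into U \<phi>) y = (f \<circ> inv_into U \<phi>) y" if "y \<in> \<phi> ` (U \<inter> N)" for y
              using that g(4) by (auto simp: chart_inv_into[OF ch])
            obtain p where "p \<in> U" "x = \<phi> p" using x 2(5) by blast
            then show "x \<in> \<phi> ` (U \<inter> N)" using x g(3) chart_inv_into[OF ch] by (metis IntI imageI subsetD)
          qed
          then show ?thesis using f g(1) 2(1) by (auto simp: smooth_ball_def)
        qed
        moreover have "compactin (mtop P) (inv_into U \<phi> ` K)" by (rule chart_compactin[OF ch 2(4,5)])
        ultimately have "dep s f (inv_into U \<phi> ` K)" unfolding dep_def by blast
        then show ?thesis ..
      qed
    qed
  qed
  then obtain K where K: "dep W f K" using f by blast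
  show ?thesis
  proof (rule that)
    show "compactin (mtop P) K" using K by (simp add: dep_def)
    fix g N assume g: "g \<in> smooth_functions P" "openin (mtop P) N" "K \<subseteq> N" "\<And>q. q \<in> N \<Longrightarrow> g q = f q"
    then have "\<forall>q\<in>N. g q = f q" by blast
    with g(1-3) show "g \<in> W" using K unfolding dep_def by blast
  qed
qed

text \<open>A continuous character \<open>\<xi>\<close> only sees a neighbourhood of some compact set \<open>K\<close>. If it were no evaluation
  in a point of \<open>K\<close>, finitely many functions in its kernel would give a kernel element \<open>g \<ge> 0\<close>
  that exceeds \<open>1/4\<close> near \<open>K\<close>; adding a function that vanishes exactly where \<open>g \<ge> 1/4\<close> gives an invertible
  element of the kernel.\<close>

lemma continuous_character_is_evaluation:
  assumes P: "manifold P"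
    and cont: "continuous_map (smooth_topology P) euclidean \<xi>"
    and one: "\<xi> (\<lambda>p\<in>pts P. 1) = (1 :: complex)"
    and add: "\<And>f g. f \<in> smooth_functions P \<Longrightarrow> g \<in> smooth_functions P \<Longrightarrow> \<xi> (\<lambda>p\<in>pts P. f p + g p) = \<xi> f + \<xi> g"
    and mult: "\<And>f g. f \<in> smooth_functions P \<Longrightarrow> g \<in> smooth_functions P \<Longrightarrow> \<xi> (\<lambda>p\<in>pts P. f p * g p) = \<xi> f * \<xi> g"
    and scale: "\<And>f c. f \<in> smooth_functions P \<Longrightarrow> \<xi> (\<lambda>p\<in>pts P. c * f p) = c * \<xi> f"
  shows "\<exists>q\<in>pts P. \<forall>f\<in>smooth_functions P. \<xi> f = f q"
proof (rule ccontr)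
  assume contra: "\<not> ?thesis"
  note SFc = smooth_functions_const[OF P]
  have SFs: "(\<lambda>p\<in>pts P. c * f p) \<in> smooth_functions P" if "f \<in> smooth_functions P" for c f
    by (rule smooth_functions_bounded_linear[OF P bounded_linear_mult_right that])
  have const: "\<xi> (\<lambda>p\<in>pts P. c) = c" for c
  proof -
    have "(\<lambda>p\<in>pts P. c * (\<lambda>p\<in>pts P. 1) p) = (\<lambda>p\<in>pts P. c)" by auto
    with scale[OF SFc[of 1], of c] one show ?thesis by simp
  qed
  \<comment> \<open>Membership in \<open>W\<close> bounds the character by 1, which a rescaled
    function can violate; this turns topological dependence on \<open>K\<close> into algebraic
    vanishing.\<close>
  define W where "W = {f \<in> topspace (smooth_topology P). \<xi> f \<in> ball 0 1}"
  have "openin (smooth_topology P) W"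
    unfolding W_def by (rule openin_continuous_map_preimage[OF cont]) auto
  moreover have "(\<lambda>p\<in>pts P. 0) \<in> W"
    using SFc const[of 0] by (simp add: W_def topspace_smooth_topology)
  ultimately obtain K where K: "compactin (mtop P) K" "\<And>g N. g \<in> smooth_functions P \<Longrightarrow> openin (mtop P) N \<Longrightarrow> K \<subseteq> N \<Longrightarrow>
      (\<And>q. q \<in> N \<Longrightarrow> g q = (\<lambda>p\<in>pts P. 0) q) \<Longrightarrow> g \<in> W"
    using smooth_topology_compact_dependence[OF P] by blast
  have KP: "K \<subseteq> pts P" using K(1) by (rule compactin_subset_topspace)
  \<comment> \<open>If \<open>\<xi> g\<close> were nonzero, dividing \<open>g\<close> by it would
    give a function that still vanishes near \<open>K\<close>, hence lies in \<open>W\<close>, but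
    has character value 1.\<close>
  have vanish: "\<xi> g = 0" if g: "g \<in> smooth_functions P" "openin (mtop P) N" "K \<subseteq> N" "\<And>q. q \<in> N \<Longrightarrow> g q = 0" for g N
  proof (rule ccontr)
    assume "\<xi> g \<noteq> 0"
    define h where "h = (\<lambda>p\<in>pts P. inverse (\<xi> g) * g p)"
    have "h \<in> W"
      by (rule K(2)[OF _ g(2,3)])
         (use g(4) openin_subset[OF g(2)] SFs[OF g(1)] in \<open>auto simp: h_def\<close>)
    moreover have "\<xi> h = 1" unfolding h_def using \<open>\<xi> g \<noteq> 0\<close> by (simp add: scale[OF g(1)])
    ultimately show False by (simp add: W_def)
  qed
  have "\<exists>f\<in>smooth_functions P. \<xi> f = 0 \<and> f q = 1" if q: "q \<in> K" for q
  proof -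
    have qP: "q \<in> pts P" using q KP by blast
    then obtain f where f: "f \<in> smooth_functions P" "\<xi> f \<noteq> f q" using contra by blast
    \<comment> \<open>Subtracting the constant \<open>\<xi> f\<close> moves \<open>f\<close> into
      the kernel without killing its value at \<open>q\<close>; the factor \<open>c\<close>
      normalises this value to 1.\<close>
    define c where "c = inverse (f q - \<xi> f)"
    define g where "g = (\<lambda>p\<in>pts P. c * (\<lambda>p\<in>pts P. f p + (\<lambda>p\<in>pts P. - \<xi> f) p) p)"
    have h: "(\<lambda>p\<in>pts P. f p + (\<lambda>p\<in>pts P. - \<xi> f) p) \<in> smooth_functions P"
      by (rule smooth_functions_add[OF P f(1) SFc])
    have "g \<in> smooth_functions P" unfolding g_def by (rule SFs[OF h])
    moreover have "\<xi> g = 0" unfolding g_def scale[OF h] add[OF f(1) SFc] const by simp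
    moreover have "g q = 1" using f(2) qP by (simp add: g_def c_def)
    ultimately show ?thesis by blast
  qed
  then obtain F where F: "\<And>q. q \<in> K \<Longrightarrow> F q \<in> smooth_functions P" "\<And>q. q \<in> K \<Longrightarrow> \<xi> (F q) = 0" "\<And>q. q \<in> K \<Longrightarrow> F q q = 1"
    by metis
  \<comment> \<open>The bound 1/2 leaves an open neighbourhood of \<open>q\<close>, on which the
    squared modulus exceeds the 1/4 used below.\<close>
  define V where "V = (\<lambda>q. {p \<in> pts P. F q p \<in> {w. cmod w > 1/2}})"
  have V: "openin (mtop P) (V q)" if "q \<in> K" for q
    unfolding V_def
    by (rule openin_continuous_map_preimage[OF smooth_functions_continuous[OF P F(1)[OF that]]])
       (simp add: open_Collect_less continuous_intros)
  have "K \<subseteq> \<Union>(V ` K)" using F(3) KP by (force simp: V_def)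
  then have "\<exists>A. finite A \<and> A \<subseteq> V ` K \<and> K \<subseteq> \<Union>A"
    using compactinD[OF K(1), of "V ` K"] V by blast
  then obtain A where A: "finite A" "A \<subseteq> V ` K" "K \<subseteq> \<Union>A" by blast
  obtain C where C: "finite C" "C \<subseteq> K" "K \<subseteq> (\<Union>q\<in>C. V q)"
    using finite_subset_image[OF A(1,2)] A(3) by blast
  have "\<exists>g\<in>smooth_functions P. \<xi> g = 0 \<and>
      (\<forall>p\<in>pts P. (\<exists>r\<ge>0. g p = complex_of_real r) \<and> ((\<exists>q\<in>C. p \<in> V q) \<longrightarrow> Re (g p) > 1/4))"
    using C(1,2)
  proof (induction C rule: finite_induct)
    case empty
    have "\<forall>p\<in>pts P. (\<exists>r\<ge>0. (\<lambda>p\<in>pts P. 0) p = complex_of_real r) \<and> ((\<exists>q\<in>{}. p \<in> V q) \<longrightarrow> Re ((\<lambda>p\<in>pts P. 0) p) > 1/4)"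
      by (auto intro: exI[of _ 0])
    then show ?case using SFc[of 0] const[of 0] by blast
  next
    case (insert q C)
    then obtain g where g: "g \<in> smooth_functions P" "\<xi> g = 0"
      "\<And>p. p \<in> pts P \<Longrightarrow> \<exists>r\<ge>0. g p = complex_of_real r"
      "\<And>p. p \<in> pts P \<Longrightarrow> \<exists>q\<in>C. p \<in> V q \<Longrightarrow> Re (g p) > 1/4" by blast
    have q: "F q \<in> smooth_functions P" "\<xi> (F q) = 0" using insert F by auto
    \<comment> \<open>The squared modulus is a multiple of \<open>F q\<close>, so multiplicativity
      alone puts it in the kernel; nothing is claimed about how \<open>\<xi>\<close> treats
      conjugation. Nonnegative summands cannot cancel each other.\<close>
    define k where "k = (\<lambda>p\<in>pts P. (\<lambda>p\<in>pts P. cnj (F q p)) p * F q p)"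
    have c: "(\<lambda>p\<in>pts P. cnj (F q p)) \<in> smooth_functions P"
      by (rule smooth_functions_bounded_linear[OF P bounded_linear_cnj q(1)])
    have k: "k \<in> smooth_functions P" "\<xi> k = 0"
      unfolding k_def using smooth_functions_mult[OF P c q(1)] mult[OF c q(1)] q(2) by auto
    have kp: "k p = complex_of_real ((cmod (F q p))\<^sup>2)" if "p \<in> pts P" for p
      using that by (simp add: k_def complex_norm_square mult.commute del: of_real_power)
    define g' where "g' = (\<lambda>p\<in>pts P. g p + k p)"
    have "(\<exists>r\<ge>0. g' p = complex_of_real r) \<and> ((\<exists>q\<in>insert q C. p \<in> V q) \<longrightarrow> Re (g' p) > 1/4)" if p: "p \<in> pts P" for p
    proof -
      obtain r where r: "r \<ge> 0" "g p = complex_of_real r" using g(3)[OF p] by blast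
      have g'p: "g' p = complex_of_real (r + (cmod (F q p))\<^sup>2)" using p r kp by (simp add: g'_def)
      have "r + (cmod (F q p))\<^sup>2 > 1/4" if "p \<in> V q"
      proof -
        have "(1/2)\<^sup>2 < (cmod (F q p))\<^sup>2" using that by (intro power_strict_mono) (auto simp: V_def)
        then show ?thesis using r(1) by (simp add: power2_eq_square)
      qed
      moreover have "r + (cmod (F q p))\<^sup>2 > 1/4" if "\<exists>q\<in>C. p \<in> V q"
      proof -
        have "r > 1/4" using g(4)[OF p that] r(2) by simp
        then show ?thesis using zero_le_power2[of "cmod (F q p)"] by linarith
      qed
      ultimately have "(\<exists>q\<in>insert q C. p \<in> V q) \<longrightarrow> r + (cmod (F q p))\<^sup>2 > 1/4" by blast
      moreover have "r + (cmod (F q p))\<^sup>2 \<ge> 0" using r(1) by simp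
      ultimately show ?thesis
        unfolding g'p Re_complex_of_real by blast
    qed
    moreover have "g' \<in> smooth_functions P" "\<xi> g' = 0"
      unfolding g'_def using smooth_functions_add[OF P g(1) k(1)] add[OF g(1) k(1)] g(2) k(2) by auto
    ultimately show ?case by blast
  qed
  then obtain g where g: "g \<in> smooth_functions P" "\<xi> g = 0"
    "\<And>p. p \<in> pts P \<Longrightarrow> \<exists>r\<ge>0. g p = complex_of_real r"
    "\<And>p. p \<in> pts P \<Longrightarrow> \<exists>q\<in>C. p \<in> V q \<Longrightarrow> Re (g p) > 1/4" by blast
  define G where "G = (\<lambda>w. complex_of_real (flat 0 (1/4 - Re w)))"
  have s1: "smooth_on UNIV (\<lambda>w. 1/4 - Re w)"
    by (rule smooth_on_diff[OF open_UNIV smooth_on_const smooth_on_bounded_linear_comp[OF bounded_linear_Re open_UNIV smooth_on_id]])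
  have "smooth_on UNIV (\<lambda>w. flat 0 (1/4 - Re w))"
    by (rule smooth_on_compose[OF parseval_frame_real open_UNIV _ s1 smooth_on_flat]) simp
  then have sG: "smooth_on UNIV G"
    unfolding G_def by (rule smooth_on_bounded_linear_comp[OF bounded_linear_of_real open_UNIV])
  define f where "f = (\<lambda>p\<in>pts P. G (g p))"
  have f: "f \<in> smooth_functions P"
    unfolding f_def by (rule smooth_functions_compose_smooth[OF P g(1) _ sG]) simp
  \<comment> \<open>On the neighbourhood of \<open>K\<close> covered by the sets \<open>V q\<close>
    the function \<open>g\<close> exceeds 1/4, and there the correction term is 0.\<close>
  have "\<xi> f = 0"
  proof (rule vanish[OF f])
    show "openin (mtop P) (\<Union>q\<in>C. V q)" using V C(2) by blast
    show "K \<subseteq> (\<Union>q\<in>C. V q)" by (rule C(3))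
    fix p assume p: "p \<in> (\<Union>q\<in>C. V q)"
    then have "p \<in> pts P" by (auto simp: V_def)
    then show "f p = 0" using g(4)[of p] p by (simp add: f_def G_def flat_nonpos)
  qed
  define u where "u = (\<lambda>p\<in>pts P. g p + f p)"
  have u: "u \<in> smooth_functions P" "\<xi> u = 0"
    unfolding u_def using smooth_functions_add[OF P g(1) f] add[OF g(1) f] g(2) \<open>\<xi> f = 0\<close> by auto
  have u0: "u p \<noteq> 0" if p: "p \<in> pts P" for p
  proof -
    obtain r where r: "r \<ge> 0" "g p = complex_of_real r" using g(3)[OF p] by blast
    have "u p = complex_of_real (r + flat 0 (1/4 - r))" using p r by (simp add: u_def f_def G_def)
    moreover have "r + flat 0 (1/4 - r) > 0"
      using r(1) flat_pos[of "1/4 - r" 0] by (cases "r < 1/4") (auto simp: flat_nonpos)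
    ultimately show ?thesis by (metis of_real_eq_0_iff less_irrefl)
  qed
  have v: "(\<lambda>p\<in>pts P. inverse (u p)) \<in> smooth_functions P"
    by (rule smooth_functions_compose_smooth[OF P u(1) _ smooth_on_inverse]) (use u0 in auto)
  have "(\<lambda>p\<in>pts P. u p * (\<lambda>p\<in>pts P. inverse (u p)) p) = (\<lambda>p\<in>pts P. 1)"
    using u0 by auto
  with mult[OF u(1) v] u(2) one show False by simp
qed


section \<open>The locally convex algebra of smooth functions\<close>

lemma C_infinity_simps:
  "carrier (C_infinity P) = smooth_functions P"
  "f \<otimes>\<^bsub>C_infinity P\<^esub> g = (\<lambda>p\<in>pts P. f p * g p)"
  "\<one>\<^bsub>C_infinity P\<^esub> = (\<lambda>p\<in>pts P. 1)"
  "\<zero>\<^bsub>C_infinity P\<^esub> = (\<lambda>p\<in>pts P. 0)"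
  "f \<oplus>\<^bsub>C_infinity P\<^esub> g = (\<lambda>p\<in>pts P. f p + g p)"
  "c \<odot>\<^bsub>C_infinity P\<^esub> f = (\<lambda>p\<in>pts P. c * f p)"
  "topo (C_infinity P) = smooth_topology P"
  by (simp_all add: C_infinity_def)

lemma smooth_functions_eqI:
  assumes "f \<in> smooth_functions P" "g \<in> smooth_functions P" "\<And>p. p \<in> pts P \<Longrightarrow> f p = g p"
  shows "f = g"
  using assms unfolding smooth_functions_def by (auto intro: extensionalityI)

lemma smooth_functions_scale:
  "manifold P \<Longrightarrow> f \<in> smooth_functions P \<Longrightarrow> (\<lambda>p\<in>pts P. c * f p) \<in> smooth_functions P"
  by (rule smooth_functions_bounded_linear[OF _ bounded_linear_mult_right])

lemma abelian_group_C_infinity: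
  assumes P: "manifold P"
  shows "abelian_group (C_infinity P)"
proof (rule abelian_groupI; unfold C_infinity_simps)
  fix f assume f: "f \<in> smooth_functions P"
  show "\<exists>g\<in>smooth_functions P. (\<lambda>p\<in>pts P. g p + f p) = (\<lambda>p\<in>pts P. 0)"
    by (rule bexI[OF _ smooth_functions_scale[OF P f, of "-1"]]) auto
  show "(\<lambda>p\<in>pts P. (\<lambda>p\<in>pts P. 0) p + f p) = f"
    by (rule smooth_functions_eqI[OF smooth_functions_add[OF P smooth_functions_const[OF P] f] f]) auto
qed (auto simp: smooth_functions_add[OF P] smooth_functions_const[OF P] algebra_simps)

lemma ring_C_infinity:
  assumes P: "manifold P"
  shows "ring (C_infinity P)"
proof (rule ringI)
  show "abelian_group (C_infinity P)" by (rule abelian_group_C_infinity[OF P])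
  show "monoid (C_infinity P)"
  proof (rule monoidI; unfold C_infinity_simps)
    fix f assume f: "f \<in> smooth_functions P"
    show "(\<lambda>p\<in>pts P. (\<lambda>p\<in>pts P. 1) p * f p) = f"
      by (rule smooth_functions_eqI[OF smooth_functions_mult[OF P smooth_functions_const[OF P] f] f]) auto
    show "(\<lambda>p\<in>pts P. f p * (\<lambda>p\<in>pts P. 1) p) = f"
      by (rule smooth_functions_eqI[OF smooth_functions_mult[OF P f smooth_functions_const[OF P]] f]) auto
  qed (auto simp: smooth_functions_mult[OF P] smooth_functions_const[OF P] algebra_simps)
qed (auto simp: C_infinity_simps algebra_simps)

lemma cring_complex_ring: "cring complex_ring"
proof (rule cringI)
  show "abelian_group complex_ring"
    by (rule abelian_groupI) (auto simp: complex_ring_def intro: exI[of _ "- _"])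
  show "comm_monoid complex_ring"
    by (rule comm_monoidI) (auto simp: complex_ring_def)
qed (auto simp: complex_ring_def algebra_simps)

lemma module_C_infinity:
  assumes P: "manifold P"
  shows "Module.module complex_ring (C_infinity P)"
proof (rule Module.moduleI)
  show "cring complex_ring" by (rule cring_complex_ring)
  show "abelian_group (C_infinity P)" by (rule abelian_group_C_infinity[OF P])
  show "\<one>\<^bsub>complex_ring\<^esub> \<odot>\<^bsub>C_infinity P\<^esub> f = f" if "f \<in> carrier (C_infinity P)" for f
    using that smooth_functions_restrict[of f P] by (simp add: C_infinity_simps complex_ring_def)
qed (auto simp: C_infinity_simps smooth_functions_scale[OF P]
    complex_ring_def algebra_simps)

text \<open>Subbasic balls are convex whatever their centre, and intersections of convex sets are
  convex. For a union only one member around \<open>f\<close> has to be kept, so the induction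
  carries a convex neighbourhood rather than convexity of the open set itself.\<close>

lemma smooth_topology_locally_convex:
  assumes P: "manifold P" and W: "openin (smooth_topology P) W" and f: "f \<in> W"
  obtains V where "openin (smooth_topology P) V" "f \<in> V" "V \<subseteq> W"
    "\<And>g h t. g \<in> V \<Longrightarrow> h \<in> V \<Longrightarrow> t \<in> {0..1} \<Longrightarrow>
      (\<lambda>p\<in>pts P. complex_of_real t * g p + complex_of_real (1 - t) * h p) \<in> V"
proof -
  define conv where "conv V \<longleftrightarrow> (\<forall>g\<in>V. \<forall>h\<in>V. \<forall>t\<in>{0..1}.
      (\<lambda>p\<in>pts P. complex_of_real t * g p + complex_of_real (1 - t) * h p) \<in> V)" for V
  let ?lc = "\<lambda>W f. \<exists>V. openin (smooth_topology P) V \<and> f \<in> V \<and> V \<subseteq> W \<and> conv V"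
  have comb: "(\<lambda>p\<in>pts P. complex_of_real t * g p + complex_of_real (1 - t) * h p) \<in> smooth_functions P"
    if "g \<in> smooth_functions P" "h \<in> smooth_functions P" for g h t
  proof -
    have "(\<lambda>p\<in>pts P. (\<lambda>p\<in>pts P. complex_of_real t * g p) p + (\<lambda>p\<in>pts P. complex_of_real (1 - t) * h p) p) \<in> smooth_functions P"
      using that by (intro smooth_functions_add[OF P] smooth_functions_scale[OF P])
    also have "(\<lambda>p\<in>pts P. (\<lambda>p\<in>pts P. complex_of_real t * g p) p + (\<lambda>p\<in>pts P. complex_of_real (1 - t) * h p) p)
        = (\<lambda>p\<in>pts P. complex_of_real t * g p + complex_of_real (1 - t) * h p)" by auto
    finally show ?thesis .
  qed
  have "generate_topology_on (smooth_subbasis P) W"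
    using W by (simp add: openin_smooth_topology)
  then have "\<forall>f\<in>W. ?lc W f"
  proof induction
    case Empty
    then show ?case by simp
  next
    case (Int a b)
    show ?case
    proof
      fix f assume "f \<in> a \<inter> b"
      then have "?lc a f" "?lc b f" using Int.IH by auto
      then obtain V V' where V: "openin (smooth_topology P) V" "f \<in> V" "V \<subseteq> a" "conv V"
        and V': "openin (smooth_topology P) V'" "f \<in> V'" "V' \<subseteq> b" "conv V'"
        by (elim exE conjE)
      have "conv (V \<inter> V')" using V(4) V'(4) unfolding conv_def by auto
      moreover have "openin (smooth_topology P) (V \<inter> V')" using V(1) V'(1) by (rule openin_Int)
      ultimately show "?lc (a \<inter> b) f" using V(2,3) V'(2,3) by (intro exI[of _ "V \<inter> V'"]) auto
    qed
  next
    case (UN A)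
    show ?case
    proof
      fix f assume "f \<in> \<Union>A"
      then obtain a where a: "a \<in> A" "f \<in> a" by blast
      then obtain V where "openin (smooth_topology P) V" "f \<in> V" "V \<subseteq> a" "conv V" using UN.IH by blast
      then show "?lc (\<Union>A) f" using a by (intro exI[of _ V]) auto
    qed
  next
    case (Basis s)
    have s: "openin (smooth_topology P) s"
      unfolding openin_smooth_topology by (rule generate_topology_on.Basis[OF Basis])
    from Basis have "conv s"
    proof (cases rule: smooth_subbasisE)
      case 1
      then show ?thesis using comb unfolding conv_def by blast
    next
      case (2 f0 U \<phi> K vs \<epsilon>)
      let ?D = "\<lambda>g. iter_deriv vs (g \<circ> inv_into U \<phi>)"
      have op: "open (\<phi> ` U)" using manifold_chart[OF P 2(3)] by simp
      show ?thesis
        unfolding conv_def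
      proof (intro ballI)
        fix g h and t :: real assume g: "g \<in> s" and h: "h \<in> s" and t: "t \<in> {0..1}"
        let ?k = "\<lambda>p\<in>pts P. complex_of_real t * g p + complex_of_real (1 - t) * h p"
        have sf: "g \<in> smooth_functions P" "h \<in> smooth_functions P" using g h 2(1) by (auto simp: smooth_ball_def)
        have "cmod (?D ?k x - ?D f0 x) < \<epsilon>" if "x \<in> K" for x
        proof -
          have x: "x \<in> \<phi> ` U" using that 2(5) by blast
          note sg = smooth_functions_chart[OF sf(1) 2(3)] and sh = smooth_functions_chart[OF sf(2) 2(3)]
          have "?D ?k x = iter_deriv vs (\<lambda>x. complex_of_real t * (g \<circ> inv_into U \<phi>) x
              + complex_of_real (1 - t) * (h \<circ> inv_into U \<phi>) x) x"
            unfolding iter_deriv_restrict[OF P 2(3) x] by simp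
          also have "\<dots> = complex_of_real t * ?D g x + complex_of_real (1 - t) * ?D h x"
            by (subst iter_deriv_add[OF op _ _ x])
               (auto intro!: smooth_on_mult smooth_on_const op sg sh
                 simp: iter_deriv_cmult[OF op sg x] iter_deriv_cmult[OF op sh x] simp del: of_real_diff comp_apply)
          finally have E: "?D ?k x - ?D f0 x
              = complex_of_real t * (?D g x - ?D f0 x) + complex_of_real (1 - t) * (?D h x - ?D f0 x)"
            by (simp add: algebra_simps)
          have "cmod (?D ?k x - ?D f0 x) \<le> cmod (complex_of_real t * (?D g x - ?D f0 x)) + cmod (complex_of_real (1 - t) * (?D h x - ?D f0 x))"
            unfolding E by (rule norm_triangle_ineq)
          also have "\<dots> = t * cmod (?D g x - ?D f0 x) + (1 - t) * cmod (?D h x - ?D f0 x)"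
            using t by (simp only: norm_mult norm_of_real abs_of_nonneg atLeastAtMost_iff diff_ge_0_iff_ge)
          also have "\<dots> < \<epsilon>"
          proof (rule convex_bound_lt)
            show "cmod (?D g x - ?D f0 x) < \<epsilon>" "cmod (?D h x - ?D f0 x) < \<epsilon>"
              using g h that 2(1) by (auto simp: smooth_ball_def)
          qed (use t in auto)
          finally show ?thesis .
        qed
        then show "?k \<in> s" using comb[OF sf] 2(1) unfolding smooth_ball_def by blast
      qed
    qed
    then show ?case using s by blast
  qed
  then obtain V where "openin (smooth_topology P) V" "f \<in> V" "V \<subseteq> W" "conv V"
    using f by blast
  then show ?thesis using that unfolding conv_def by blast
qed

lemma unital_lc_algebra_C_infinity:
  assumes P: "manifold P"
  shows "unital_lc_algebra (C_infinity P)"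
  unfolding unital_lc_algebra_def
proof (intro conjI)
  show "ring (C_infinity P)" by (rule ring_C_infinity[OF P])
  show "Module.module complex_ring (C_infinity P)" by (rule module_C_infinity[OF P])
  show "\<forall>c. \<forall>a\<in>carrier (C_infinity P). \<forall>b\<in>carrier (C_infinity P).
      (c \<odot>\<^bsub>C_infinity P\<^esub> a) \<otimes>\<^bsub>C_infinity P\<^esub> b = c \<odot>\<^bsub>C_infinity P\<^esub> (a \<otimes>\<^bsub>C_infinity P\<^esub> b) \<and>
      a \<otimes>\<^bsub>C_infinity P\<^esub> (c \<odot>\<^bsub>C_infinity P\<^esub> b) = c \<odot>\<^bsub>C_infinity P\<^esub> (a \<otimes>\<^bsub>C_infinity P\<^esub> b)"
    by (auto simp: C_infinity_simps)
  show "topspace (topo (C_infinity P)) = carrier (C_infinity P)"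
    by (simp add: C_infinity_simps topspace_smooth_topology)
  let ?X = "smooth_topology P"
  show "continuous_map (prod_topology (topo (C_infinity P)) (topo (C_infinity P))) (topo (C_infinity P))
     (\<lambda>(a, b). a \<oplus>\<^bsub>C_infinity P\<^esub> b)"
    unfolding C_infinity_simps case_prod_unfold
    by (rule continuous_map_smooth_add[OF P continuous_map_fst continuous_map_snd])
  show "continuous_map (prod_topology (topo (C_infinity P)) (topo (C_infinity P))) (topo (C_infinity P))
     (\<lambda>(a, b). a \<otimes>\<^bsub>C_infinity P\<^esub> b)"
    unfolding C_infinity_simps case_prod_unfold
    by (rule continuous_map_smooth_mult[OF P continuous_map_fst continuous_map_snd])
  \<comment> \<open>Scalar multiplication is rewritten as multiplication by a constant
    function.\<close>
  have "continuous_map (prod_topology euclidean ?X) ?X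
      (\<lambda>y. \<lambda>p\<in>pts P. (\<lambda>p\<in>pts P. fst y) p * snd y p)"
    by (rule continuous_map_smooth_mult[OF P continuous_map_smooth_const[OF P continuous_map_fst] continuous_map_snd])
  then show "continuous_map (prod_topology euclidean (topo (C_infinity P))) (topo (C_infinity P))
     (\<lambda>(c, a). c \<odot>\<^bsub>C_infinity P\<^esub> a)"
    unfolding C_infinity_simps case_prod_unfold by (simp cong: restrict_cong)
  show "\<forall>W. openin (topo (C_infinity P)) W \<and> \<zero>\<^bsub>C_infinity P\<^esub> \<in> W \<longrightarrow>
      (\<exists>V. openin (topo (C_infinity P)) V \<and> \<zero>\<^bsub>C_infinity P\<^esub> \<in> V \<and> V \<subseteq> W \<and>
         (\<forall>a\<in>V. \<forall>b\<in>V. \<forall>t\<in>{0..1}.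
            (complex_of_real t \<odot>\<^bsub>C_infinity P\<^esub> a) \<oplus>\<^bsub>C_infinity P\<^esub> (complex_of_real (1 - t) \<odot>\<^bsub>C_infinity P\<^esub> b) \<in> V))"
  proof (intro allI impI)
    fix W assume "openin (topo (C_infinity P)) W \<and> \<zero>\<^bsub>C_infinity P\<^esub> \<in> W"
    then have W: "openin ?X W" "(\<lambda>p\<in>pts P. 0) \<in> W" by (auto simp: C_infinity_simps)
    obtain V where V: "openin ?X V" "(\<lambda>p\<in>pts P. 0) \<in> V" "V \<subseteq> W"
      "\<And>g h t. g \<in> V \<Longrightarrow> h \<in> V \<Longrightarrow> t \<in> {0..1} \<Longrightarrow>
        (\<lambda>p\<in>pts P. complex_of_real t * g p + complex_of_real (1 - t) * h p) \<in> V"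
      using smooth_topology_locally_convex[OF P W] by blast
    have "(complex_of_real t \<odot>\<^bsub>C_infinity P\<^esub> a) \<oplus>\<^bsub>C_infinity P\<^esub> (complex_of_real (1 - t) \<odot>\<^bsub>C_infinity P\<^esub> b) \<in> V"
      if "a \<in> V" "b \<in> V" "t \<in> {0..1}" for a b t
      using V(4)[OF that] unfolding C_infinity_simps by (simp cong: restrict_cong)
    then show "\<exists>V. openin (topo (C_infinity P)) V \<and> \<zero>\<^bsub>C_infinity P\<^esub> \<in> V \<and> V \<subseteq> W \<and>
         (\<forall>a\<in>V. \<forall>b\<in>V. \<forall>t\<in>{0..1}.
            (complex_of_real t \<odot>\<^bsub>C_infinity P\<^esub> a) \<oplus>\<^bsub>C_infinity P\<^esub> (complex_of_real (1 - t) \<odot>\<^bsub>C_infinity P\<^esub> b) \<in> V)"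
      using V by (intro exI[of _ V]) (auto simp: C_infinity_simps(4,7))
  qed
qed


section \<open>Roots of unity\<close>

lemma Cn_simps:
  "carrier (Cn n) = {z. z \<noteq> 0 \<and> z ^ n = 1}"
  "z \<otimes>\<^bsub>Cn n\<^esub> w = z * w"
  by (simp_all add: Cn_def)

lemma one_in_Cn: "1 \<in> carrier (Cn n)"
  by (simp add: Cn_simps)

lemma mult_in_Cn: "z \<in> carrier (Cn n) \<Longrightarrow> w \<in> carrier (Cn n) \<Longrightarrow> z * w \<in> carrier (Cn n)"
  by (simp add: Cn_simps power_mult_distrib)

lemma inverse_in_Cn: "z \<in> carrier (Cn n) \<Longrightarrow> inverse z \<in> carrier (Cn n)"
  by (simp add: Cn_simps power_inverse)

lemma zeta_power_eq_cis: "zeta n ^ k = cis (2 * pi * real k / real n)"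
proof -
  have "zeta n = cis (2 * pi / real n)"
    by (simp add: zeta_def cis_conv_exp mult_ac)
  then show ?thesis by (simp add: Complex.DeMoivre mult_ac)
qed

lemma Cn_eq_zeta_powers:
  assumes "n \<ge> 1"
  shows "carrier (Cn n) = (\<lambda>k. zeta n ^ k) ` {..<n}"
proof -
  have "carrier (Cn n) = {z. z ^ n = 1}"
    using assms by (auto simp: Cn_simps zero_power)
  also have "\<dots> = (\<lambda>k. cis (2 * pi * real k / real n)) ` {..<n}"
    using Complex.bij_betw_roots_unity[of n] assms by (simp add: bij_betw_def)
  finally show ?thesis by (simp add: zeta_power_eq_cis)
qed

lemma finite_Cn: "n \<ge> 1 \<Longrightarrow> finite (carrier (Cn n))"
  by (simp add: Cn_eq_zeta_powers)

lemma zeta_power_in_Cn: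
  assumes "n \<ge> 1"
  shows "zeta n ^ k \<in> carrier (Cn n)"
proof -
  have "zeta n ^ n = 1" using assms by (simp add: zeta_power_eq_cis)
  then have "(zeta n ^ k) ^ n = 1" by (metis mult.commute power_mult power_one)
  then show ?thesis by (simp add: Cn_simps zeta_power_eq_cis)
qed


section \<open>Actions with an equivariant map to the structure group\<close>

text \<open>The map \<open>a\<close> trivialises the bundle: the points with \<open>a = 1\<close> form a global section.\<close>

locale equivariantly_labelled_action =
  fixes P :: "('a, 'e::real_inner) mfd" and n :: nat and \<sigma> :: "'a \<Rightarrow> complex \<Rightarrow> 'a" and a :: "'a \<Rightarrow> complex"
  assumes P: "manifold P" and n: "n \<ge> 1"
    and action: "smooth_action n P \<sigma>"
    and label: "continuous_map (mtop P) (discrete_topology (carrier (Cn n))) a"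
    and equivariant: "\<And>p z. p \<in> pts P \<Longrightarrow> z \<in> carrier (Cn n) \<Longrightarrow> a (\<sigma> p z) = z * a p"
begin

abbreviation "G \<equiv> carrier (Cn n)"
abbreviation "pr \<equiv> orbit_map n \<sigma>"
abbreviation "M \<equiv> orbit_manifold n P \<sigma>"

lemma G0: "z \<in> G \<Longrightarrow> z \<noteq> 0"
  by (simp add: Cn_simps)

lemma a_in: "p \<in> pts P \<Longrightarrow> a p \<in> G"
  using label by (auto simp: continuous_map_def)

lemma smooth_\<sigma>: "z \<in> G \<Longrightarrow> smooth_map P P (\<lambda>p. \<sigma> p z)"
  using action smooth_map_prod_discrete_iff[OF P P, of G "\<lambda>(p, z). \<sigma> p z"]
  by (auto simp: smooth_action_def)

lemma continuous_\<sigma>: "z \<in> G \<Longrightarrow> continuous_map (mtop P) (mtop P) (\<lambda>p. \<sigma> p z)"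
  by (rule smooth_map_continuous[OF smooth_\<sigma>])

lemma \<sigma>_in: "p \<in> pts P \<Longrightarrow> z \<in> G \<Longrightarrow> \<sigma> p z \<in> pts P"
  using smooth_map_in_pts[OF smooth_\<sigma>] by blast

lemma \<sigma>_one: "p \<in> pts P \<Longrightarrow> \<sigma> p 1 = p"
  using action by (simp add: smooth_action_def)

lemma \<sigma>_mult: "p \<in> pts P \<Longrightarrow> z \<in> G \<Longrightarrow> w \<in> G \<Longrightarrow> \<sigma> (\<sigma> p z) w = \<sigma> p (z * w)"
  using action by (simp add: smooth_action_def)

section \<open>Freeness and properness of the action\<close>

lemma free: "free_action n P \<sigma>"
  unfolding free_action_def
proof (intro ballI impI)
  fix p z assume pz: "p \<in> pts P" "z \<in> G" "\<sigma> p z = p"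
  then have "a p = z * a p" using equivariant by metis
  then show "z = 1" using G0[OF a_in[OF pz(1)]] by simp
qed

text \<open>An injective closed map is proper. The image of a closed set is a finite union, over the
  group, of graphs of continuous maps over closed sets, and such graphs are closed because the
  target is Hausdorff. Injectivity is read off the labels.\<close>

lemma proper: "proper_action n P \<sigma>"
  unfolding proper_action_def
proof (rule closed_injective_imp_proper_map)
  let ?X = "prod_topology (mtop P) (discrete_topology G)"
  have "Hausdorff_space (mtop P)" using P by (simp add: manifold_def)
  show "closed_map ?X (prod_topology (mtop P) (mtop P)) (\<lambda>(p, z). (p, \<sigma> p z))"
    unfolding closed_map_def
  proof (intro allI impI)
    fix C assume C: "closedin ?X C"
    have CX: "C \<subseteq> pts P \<times> G" using closedin_subset[OF C] by simp
    have "closedin (prod_topology (mtop P) (mtop P)) ((\<lambda>p. (p, \<sigma> p z)) ` {p \<in> pts P. (p, z) \<in> C})" if z: "z \<in> G" for z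
    proof -
      have "continuous_map (mtop P) ?X (\<lambda>p. (p, z))"
        using z by (simp add: continuous_map_pairwise comp_def)
      then have "closedin (mtop P) {p \<in> pts P. (p, z) \<in> C}"
        using C by (rule closedin_continuous_map_preimage)
      then show ?thesis
        using closed_map_paired_continuous_map_right[OF continuous_\<sigma>[OF z] \<open>Hausdorff_space (mtop P)\<close>]
        unfolding closed_map_def by blast
    qed
    then have "closedin (prod_topology (mtop P) (mtop P)) (\<Union>z\<in>G. (\<lambda>p. (p, \<sigma> p z)) ` {p \<in> pts P. (p, z) \<in> C})"
      using finite_Cn[OF n] by (intro closedin_Union) auto
    moreover have "(\<lambda>(p, z). (p, \<sigma> p z)) ` C = (\<Union>z\<in>G. (\<lambda>p. (p, \<sigma> p z)) ` {p \<in> pts P. (p, z) \<in> C})"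
      using CX by fastforce
    ultimately show "closedin (prod_topology (mtop P) (mtop P)) ((\<lambda>(p, z). (p, \<sigma> p z)) ` C)"
      by simp
  qed
  show "inj_on (\<lambda>(p, z). (p, \<sigma> p z)) (topspace ?X)"
  proof (rule inj_onI, clarsimp)
    fix p z w assume A: "p \<in> pts P" "z \<in> G" "w \<in> G" "\<sigma> p z = \<sigma> p w"
    then have "z * a p = w * a p" using equivariant by metis
    then show "z = w" using G0[OF a_in[OF A(1)]] by simp
  qed
qed

section \<open>Orbits and the quotient topology\<close>

lemma pr_\<sigma>:
  assumes "p \<in> pts P" "z \<in> G"
  shows "pr (\<sigma> p z) = pr p"
proof -
  have "\<sigma> (\<sigma> p z) w \<in> \<sigma> p ` G" if "w \<in> G" for w
    using assms that \<sigma>_mult mult_in_Cn by auto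
  moreover have "\<sigma> p w \<in> \<sigma> (\<sigma> p z) ` G" if "w \<in> G" for w
  proof -
    have "\<sigma> p w = \<sigma> (\<sigma> p z) (inverse z * w)"
      using assms that \<sigma>_mult[OF assms mult_in_Cn[OF inverse_in_Cn[OF assms(2)] that]] G0[OF assms(2)]
      by (simp add: mult.assoc[symmetric])
    then show ?thesis using mult_in_Cn[OF inverse_in_Cn[OF assms(2)] that] by blast
  qed
  ultimately show ?thesis unfolding orbit_map_def by blast
qed

lemma pr_eqD:
  assumes "p \<in> pts P" "q \<in> pts P" "pr p = pr q"
  obtains z where "z \<in> G" "q = \<sigma> p z"
proof -
  have "q \<in> pr q" using \<sigma>_one[OF assms(2)] one_in_Cn unfolding orbit_map_def by (metis imageI)
  then show ?thesis using that assms(3) by (auto simp: orbit_map_def)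
qed

text \<open>\<open>topology\<close> returns the intended open sets only for a predicate that
  satisfies the axioms, so these are verified before the definition can be unfolded.\<close>

lemma openin_M: "openin (mtop M) V \<longleftrightarrow> V \<subseteq> pr ` pts P \<and> openin (mtop P) {p \<in> pts P. pr p \<in> V}"
proof -
  have "istopology (\<lambda>V. V \<subseteq> pr ` pts P \<and> openin (mtop P) {p \<in> pts P. pr p \<in> V})"
    unfolding istopology_def
  proof (intro conjI allI impI)
    fix S T assume "S \<subseteq> pr ` pts P \<and> openin (mtop P) {p \<in> pts P. pr p \<in> S}"
      "T \<subseteq> pr ` pts P \<and> openin (mtop P) {p \<in> pts P. pr p \<in> T}"
    moreover have "{p \<in> pts P. pr p \<in> S \<inter> T} = {p \<in> pts P. pr p \<in> S} \<inter> {p \<in> pts P. pr p \<in> T}" by auto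
    ultimately show "S \<inter> T \<subseteq> pr ` pts P" "openin (mtop P) {p \<in> pts P. pr p \<in> S \<inter> T}" by auto
  next
    fix K assume K: "\<forall>V\<in>K. V \<subseteq> pr ` pts P \<and> openin (mtop P) {p \<in> pts P. pr p \<in> V}"
    moreover have "{p \<in> pts P. pr p \<in> \<Union>K} = (\<Union>V\<in>K. {p \<in> pts P. pr p \<in> V})" by auto
    ultimately show "\<Union>K \<subseteq> pr ` pts P" "openin (mtop P) {p \<in> pts P. pr p \<in> \<Union>K}" by auto
  qed
  then show ?thesis by (simp add: orbit_manifold_def topology_inverse')
qed

lemma pts_M: "pts M = pr ` pts P"
proof
  show "pts M \<subseteq> pr ` pts P" using openin_M[of "pts M"] by simp
  have "{p \<in> pts P. pr p \<in> pr ` pts P} = pts P" by auto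
  then show "pr ` pts P \<subseteq> pts M" using openin_M[of "pr ` pts P"] openin_subset by force
qed

lemma continuous_pr: "continuous_map (mtop P) (mtop M) pr"
  by (auto simp: continuous_map pts_M openin_M)

text \<open>The saturation of \<open>U\<close> is the union of its preimages under the
  homeomorphisms of the action, hence open.\<close>

lemma openin_pr_image:
  assumes U: "openin (mtop P) U"
  shows "openin (mtop M) (pr ` U)"
proof -
  have UP: "U \<subseteq> pts P" by (rule openin_subset[OF U])
  have "{p \<in> pts P. pr p \<in> pr ` U} = (\<Union>z\<in>G. {p \<in> pts P. \<sigma> p z \<in> U})"
  proof
    show "{p \<in> pts P. pr p \<in> pr ` U} \<subseteq> (\<Union>z\<in>G. {p \<in> pts P. \<sigma> p z \<in> U})"
    proof
      fix p assume "p \<in> {p \<in> pts P. pr p \<in> pr ` U}"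
      then obtain u where u: "p \<in> pts P" "u \<in> U" "pr p = pr u" by auto
      then obtain z where "z \<in> G" "u = \<sigma> p z" using pr_eqD[of p u] UP by blast
      then show "p \<in> (\<Union>z\<in>G. {p \<in> pts P. \<sigma> p z \<in> U})" using u by blast
    qed
    show "(\<Union>z\<in>G. {p \<in> pts P. \<sigma> p z \<in> U}) \<subseteq> {p \<in> pts P. pr p \<in> pr ` U}"
    proof
      fix p assume "p \<in> (\<Union>z\<in>G. {p \<in> pts P. \<sigma> p z \<in> U})"
      then obtain z where "z \<in> G" "p \<in> pts P" "\<sigma> p z \<in> U" by blast
      then show "p \<in> {p \<in> pts P. pr p \<in> pr ` U}" using pr_\<sigma>[of p z] by (metis (mono_tags) imageI mem_Collect_eq)
    qed
  qed
  moreover have "openin (mtop P) {p \<in> pts P. \<sigma> p z \<in> U}" if "z \<in> G" for z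
    by (rule openin_continuous_map_preimage[OF continuous_\<sigma>[OF that] U])
  ultimately have "openin (mtop P) {p \<in> pts P. pr p \<in> pr ` U}" by auto
  then show ?thesis using UP by (auto simp: openin_M)
qed

section \<open>The retraction onto the points of label 1 and the global section it induces\<close>

definition r where "r p = \<sigma> p (inverse (a p))"
text \<open>Each orbit has exactly one point of label 1, and \<open>r\<close> moves every point of
  the orbit to it. The arbitrary representative chosen here therefore does not influence the
  value.\<close>

definition s where "s x = r (SOME p. p \<in> pts P \<and> pr p = x)"

lemma r_in: "p \<in> pts P \<Longrightarrow> r p \<in> pts P"
  unfolding r_def by (intro \<sigma>_in inverse_in_Cn a_in)

lemma pr_r: "p \<in> pts P \<Longrightarrow> pr (r p) = pr p"
  unfolding r_def by (intro pr_\<sigma> inverse_in_Cn a_in)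

lemma a_r: "p \<in> pts P \<Longrightarrow> a (r p) = 1"
  unfolding r_def using equivariant[of p "inverse (a p)"] inverse_in_Cn[OF a_in] G0[OF a_in] by simp

lemma r_\<sigma>:
  assumes "p \<in> pts P" "z \<in> G"
  shows "r (\<sigma> p z) = r p"
proof -
  have "r (\<sigma> p z) = \<sigma> p (z * inverse (z * a p))"
    unfolding r_def equivariant[OF assms]
    by (rule \<sigma>_mult[OF assms inverse_in_Cn[OF mult_in_Cn[OF assms(2) a_in[OF assms(1)]]]])
  then show ?thesis using G0[OF assms(2)] by (simp add: r_def field_simps)
qed

lemma s_pr:
  assumes "p \<in> pts P"
  shows "s (pr p) = r p"
proof -
  define q where "q = (SOME q. q \<in> pts P \<and> pr q = pr p)"
  have q: "q \<in> pts P \<and> pr q = pr p" unfolding q_def by (rule someI[of _ p]) (use assms in simp)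
  then obtain z where "z \<in> G" "q = \<sigma> p z" using pr_eqD[OF assms] by metis
  then show ?thesis using r_\<sigma>[OF assms] by (simp add: s_def q_def[symmetric])
qed

lemma s_in: "x \<in> pts M \<Longrightarrow> s x \<in> pts P"
  using s_pr r_in by (auto simp: pts_M)

lemma pr_s: "x \<in> pts M \<Longrightarrow> pr (s x) = x"
  using s_pr pr_r by (auto simp: pts_M)

lemma a_s: "x \<in> pts M \<Longrightarrow> a (s x) = 1"
  using s_pr a_r by (auto simp: pts_M)

lemma openin_label: "p \<in> pts P \<Longrightarrow> openin (mtop P) {q \<in> pts P. a q \<in> {a p}}"
  by (rule openin_continuous_map_preimage[OF label]) (simp add: a_in)

text \<open>The label is locally constant, so near a point \<open>r\<close> is the action of one
  fixed group element.\<close>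

lemma smooth_r: "smooth_map P P r"
proof (rule smooth_map_if_pullbacks_smooth[OF P P])
  show "r p \<in> pts P" if "p \<in> pts P" for p by (rule r_in[OF that])
  fix f assume f: "f \<in> smooth_functions P"
  show "(\<lambda>p\<in>pts P. f (r p)) \<in> smooth_functions P"
  proof (rule smooth_functions_local[OF P])
    fix p assume p: "p \<in> pts P"
    have "(\<lambda>q\<in>pts P. f (\<sigma> q (inverse (a p)))) \<in> smooth_functions P"
      by (rule smooth_functions_pullback[OF P P smooth_\<sigma>[OF inverse_in_Cn[OF a_in[OF p]]] f])
    then show "\<exists>N g. openin (mtop P) N \<and> p \<in> N \<and> g \<in> smooth_functions P \<and> (\<forall>q\<in>N. (\<lambda>p\<in>pts P. f (r p)) q = g q)"
      using openin_label[OF p] p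
      by (intro exI[of _ "{q \<in> pts P. a q \<in> {a p}}"] exI[of _ "\<lambda>q\<in>pts P. f (\<sigma> q (inverse (a p)))"])
         (auto simp: r_def)
  qed simp
qed

lemmas continuous_r = smooth_map_continuous[OF smooth_r]

text \<open>Openness in the quotient is tested after composition with the orbit map, and there the
  section becomes \<open>r\<close>.\<close>

lemma continuous_s: "continuous_map (mtop M) (mtop P) s"
proof -
  have "openin (mtop M) {x \<in> pts M. s x \<in> W}" if W: "openin (mtop P) W" for W
  proof -
    have "{p \<in> pts P. pr p \<in> {x \<in> pts M. s x \<in> W}} = {p \<in> pts P. r p \<in> W}"
      using s_pr by (auto simp: pts_M)
    then show ?thesis
      using openin_continuous_map_preimage[OF continuous_r W] by (auto simp: openin_M pts_M)
  qed
  then show ?thesis using s_in by (auto simp: continuous_map)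
qed

lemma retraction_pr: "retraction_map (mtop P) (mtop M) pr"
  unfolding retraction_map_def retraction_maps_def
  using continuous_pr continuous_s pr_s by blast

text \<open>The section is injective and continuous, so open sets separating two of its values pull
  back to separate the orbits.\<close>

lemma Hausdorff_M: "Hausdorff_space (mtop M)"
  unfolding Hausdorff_space_def
proof (intro allI impI)
  fix x y assume xy: "x \<in> pts M \<and> y \<in> pts M \<and> x \<noteq> y"
  then have "s x \<in> pts P" "s y \<in> pts P" "s x \<noteq> s y" using s_in pr_s by metis+
  then obtain U V where UV: "openin (mtop P) U" "openin (mtop P) V" "s x \<in> U" "s y \<in> V" "disjnt U V"
    using P unfolding manifold_def Hausdorff_space_def by metis
  have "disjnt {x \<in> pts M. s x \<in> U} {x \<in> pts M. s x \<in> V}" using UV(5) by (auto simp: disjnt_iff)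
  then show "\<exists>U V. openin (mtop M) U \<and> openin (mtop M) V \<and> x \<in> U \<and> y \<in> V \<and> disjnt U V"
    using UV xy openin_continuous_map_preimage[OF continuous_s]
    by (intro exI[of _ "{x \<in> pts M. s x \<in> U}"] exI[of _ "{x \<in> pts M. s x \<in> V}"]) auto
qed

text \<open>A cover is lifted along the orbit map, refined upstairs, and the refinement is pulled
  back along the section. It refines the original cover because the section inverts the orbit map on
  the right, and local finiteness is tested at \<open>s x\<close>.\<close>

lemma paracompact_M: "paracompact_space (mtop M)"
  unfolding paracompact_space_def
proof (intro allI impI)
  fix \<U> assume \<U>: "(\<forall>U\<in>\<U>. openin (mtop M) U) \<and> \<Union>\<U> = pts M"
  define \<U>' where "\<U>' = (\<lambda>U. {p \<in> pts P. pr p \<in> U}) ` \<U>"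
  have "\<forall>U\<in>\<U>'. openin (mtop P) U" using \<U> by (auto simp: \<U>'_def openin_M)
  moreover have "\<Union>\<U>' = pts P"
  proof
    show "pts P \<subseteq> \<Union>\<U>'"
    proof
      fix p assume p: "p \<in> pts P"
      then have "pr p \<in> \<Union>\<U>" using \<U> by (simp add: pts_M)
      then show "p \<in> \<Union>\<U>'" using p by (auto simp: \<U>'_def)
    qed
  qed (auto simp: \<U>'_def)
  ultimately obtain \<V> where \<V>: "\<And>V. V \<in> \<V> \<Longrightarrow> openin (mtop P) V" "\<And>V. V \<in> \<V> \<Longrightarrow> \<exists>U\<in>\<U>'. V \<subseteq> U"
    "\<Union>\<V> = pts P" "locally_finite_in (mtop P) \<V>"
    using P unfolding manifold_def paracompact_space_def by metis
  define F where "F = (\<lambda>V. {x \<in> pts M. s x \<in> V})"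
  have F: "openin (mtop M) (F V)" if "openin (mtop P) V" for V
    unfolding F_def by (rule openin_continuous_map_preimage[OF continuous_s that])
  have sub: "\<exists>U\<in>\<U>. F V \<subseteq> U" if V: "V \<in> \<V>" for V
  proof -
    obtain U where U: "U \<in> \<U>" "V \<subseteq> {p \<in> pts P. pr p \<in> U}" using \<V>(2)[OF V] by (auto simp: \<U>'_def)
    then have "F V \<subseteq> U" using pr_s unfolding F_def by force
    then show ?thesis using U(1) by blast
  qed
  have cov: "\<Union>(F ` \<V>) = pts M"
    using \<V>(3) s_in by (auto simp: F_def)
  have "locally_finite_in (mtop M) (F ` \<V>)"
    unfolding locally_finite_in_def
  proof (intro conjI ballI)
    show "\<Union>(F ` \<V>) \<subseteq> pts M" using cov by simp
    fix x assume x: "x \<in> pts M"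
    then obtain N where N: "openin (mtop P) N" "s x \<in> N" "finite {V \<in> \<V>. V \<inter> N \<noteq> {}}"
      using \<V>(4) s_in[OF x] unfolding locally_finite_in_def by blast
    have "{U \<in> F ` \<V>. U \<inter> F N \<noteq> {}} \<subseteq> F ` {V \<in> \<V>. V \<inter> N \<noteq> {}}" by (auto simp: F_def)
    then have "finite {U \<in> F ` \<V>. U \<inter> F N \<noteq> {}}" using N(3) finite_surj by blast
    then show "\<exists>V. openin (mtop M) V \<and> x \<in> V \<and> finite {U \<in> F ` \<V>. U \<inter> V \<noteq> {}}"
      using F[OF N(1)] N(2) x by (intro exI[of _ "F N"]) (auto simp: F_def)
  qed
  then show "\<exists>\<V>. (\<forall>V\<in>\<V>. openin (mtop M) V \<and> (\<exists>U\<in>\<U>. V \<subseteq> U)) \<and> \<Union>\<V> = pts M \<and> locally_finite_in (mtop M) \<V>"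
    using cov F \<V>(1) sub by (intro exI[of _ "F ` \<V>"]) auto
qed

section \<open>The smooth structure of the orbit space\<close>

lemma atlas_M: "atlas M = {(pr ` U, \<phi> \<circ> inv_into U pr) | U \<phi>. (U, \<phi>) \<in> maximal_atlas P \<and> inj_on pr U}"
  by (simp add: orbit_manifold_def)

text \<open>On \<open>U\<close> the orbit map is continuous, open and injective, hence a
  homeomorphism onto its image; its inverse followed by the chart of \<open>P\<close> is a chart of
  the orbit space.\<close>

lemma chart_M:
  assumes U: "(U, \<phi>) \<in> maximal_atlas P" and inj: "inj_on pr U"
  shows "chart (mtop M) (pr ` U, \<phi> \<circ> inv_into U pr)"
proof -
  have ch: "chart (mtop P) (U, \<phi>)" using U by (rule maximal_atlas_chart)
  have opU: "openin (mtop P) U" using ch by simp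
  have UP: "U \<subseteq> pts P" by (rule chart_subset[OF ch])
  have opM: "openin (mtop M) (pr ` U)" by (rule openin_pr_image[OF opU])
  have inv: "inv_into U pr (pr p) = p" if "p \<in> U" for p by (rule inv_into_f_f[OF inj that])
  have tU: "topspace (subtopology (mtop P) U) = U" using UP by auto
  have tM: "topspace (subtopology (mtop M) (pr ` U)) = pr ` U" using openin_subset[OF opM] by auto
  have "homeomorphic_map (subtopology (mtop M) (pr ` U)) (subtopology (mtop P) U) (inv_into U pr)"
  proof (rule bijective_open_imp_homeomorphic_map)
    show "continuous_map (subtopology (mtop M) (pr ` U)) (subtopology (mtop P) U) (inv_into U pr)"
      unfolding continuous_map tU tM
    proof (intro conjI allI impI)
      show "inv_into U pr ` pr ` U \<subseteq> U" using inv by auto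
      fix W assume "openin (subtopology (mtop P) U) W"
      then have W: "openin (mtop P) W" "W \<subseteq> U" using opU by (auto simp: openin_open_subtopology)
      have "{x \<in> pr ` U. inv_into U pr x \<in> W} = pr ` W" using inv W(2) by auto
      then show "openin (subtopology (mtop M) (pr ` U)) {x \<in> pr ` U. inv_into U pr x \<in> W}"
        using openin_pr_image[OF W(1)] W(2) opM by (auto simp: openin_open_subtopology)
    qed
    show "open_map (subtopology (mtop M) (pr ` U)) (subtopology (mtop P) U) (inv_into U pr)"
      unfolding open_map_def
    proof (intro allI impI)
      fix V assume "openin (subtopology (mtop M) (pr ` U)) V"
      then have V: "openin (mtop M) V" "V \<subseteq> pr ` U" using opM by (auto simp: openin_open_subtopology)
      have "inv_into U pr ` V = U \<inter> {p \<in> pts P. pr p \<in> V}"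
      proof
        show "inv_into U pr ` V \<subseteq> U \<inter> {p \<in> pts P. pr p \<in> V}"
        proof
          fix y assume "y \<in> inv_into U pr ` V"
          then obtain u where "u \<in> U" "pr u \<in> V" "y = inv_into U pr (pr u)" using V(2) by blast
          then show "y \<in> U \<inter> {p \<in> pts P. pr p \<in> V}" using inv UP by auto
        qed
        show "U \<inter> {p \<in> pts P. pr p \<in> V} \<subseteq> inv_into U pr ` V"
        proof
          fix y assume "y \<in> U \<inter> {p \<in> pts P. pr p \<in> V}"
          then have "y = inv_into U pr (pr y)" "pr y \<in> V" using inv by auto
          then show "y \<in> inv_into U pr ` V" by blast
        qed
      qed
      moreover have "openin (mtop P) (U \<inter> {p \<in> pts P. pr p \<in> V})" using V(1) opU by (auto simp: openin_M)
      ultimately show "openin (subtopology (mtop P) U) (inv_into U pr ` V)"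
        using opU by (auto simp: openin_open_subtopology)
    qed
    show "inv_into U pr ` topspace (subtopology (mtop M) (pr ` U)) = topspace (subtopology (mtop P) U)"
      unfolding tU tM using inv by force
    show "inj_on (inv_into U pr) (topspace (subtopology (mtop M) (pr ` U)))"
      unfolding tM by (rule inj_on_inv_into) simp
  qed
  moreover have "homeomorphic_map (subtopology (mtop P) U) (top_of_set (\<phi> ` U)) \<phi>" using ch by simp
  ultimately have "homeomorphic_map (subtopology (mtop M) (pr ` U)) (top_of_set (\<phi> ` U)) (\<phi> \<circ> inv_into U pr)"
    by (rule homeomorphic_map_compose)
  moreover have "(\<phi> \<circ> inv_into U pr) ` pr ` U = \<phi> ` U" using inv by force
  ultimately show ?thesis using opM ch by simp
qed

text \<open>If the group element \<open>z\<close> moves \<open>p\<close> into \<open>V\<close>, it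
  moves all nearby points into \<open>V\<close> too, and injectivity of the orbit map on
  \<open>V\<close> leaves no other lift. Going down and back up is thus locally the action of
  \<open>z\<close>.\<close>

lemma local_inverse_pr_smooth:
  assumes V: "openin (mtop P) V" "inj_on pr V" and p: "p \<in> pts P" "pr p \<in> pr ` V"
  shows "\<exists>N g. openin (mtop P) N \<and> p \<in> N \<and> smooth_map P P g \<and> (\<forall>q\<in>N. inv_into V pr (pr q) = g q)"
proof -
  obtain v where v: "v \<in> V" "pr p = pr v" using p(2) by auto
  then obtain z where z: "z \<in> G" "v = \<sigma> p z" using pr_eqD[OF p(1)] openin_subset[OF V(1)] by blast
  have "openin (mtop P) {q \<in> pts P. \<sigma> q z \<in> V}"
    by (rule openin_continuous_map_preimage[OF continuous_\<sigma>[OF z(1)] V(1)])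
  moreover have "inv_into V pr (pr q) = \<sigma> q z" if "q \<in> pts P" "\<sigma> q z \<in> V" for q
    using inv_into_f_f[OF V(2) that(2)] pr_\<sigma>[OF that(1) z(1)] by simp
  ultimately show ?thesis
    using smooth_\<sigma>[OF z(1)] p(1) v(1) z(2)
    by (intro exI[of _ "{q \<in> pts P. \<sigma> q z \<in> V}"] exI[of _ "\<lambda>q. \<sigma> q z"]) auto
qed

lemma inv_into_chart_M:
  assumes U: "(U, \<phi>) \<in> maximal_atlas P" and inj: "inj_on pr U" and p: "p \<in> U"
  shows "inv_into (pr ` U) (\<phi> \<circ> inv_into U pr) (\<phi> p) = pr p"
  using chart_inv_into[OF chart_M[OF U inj], of "pr p"] inv_into_f_f[OF inj p] p by simp

text \<open>Serves twice: as the transition map between two charts of the orbit space and as the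
  coordinate expression of the orbit map.\<close>

lemma smooth_on_into_M:
  assumes U: "(U, \<phi>) \<in> maximal_atlas P" and V: "(V, \<psi>) \<in> maximal_atlas P" "inj_on pr V"
  shows "smooth_on (\<phi> ` (U \<inter> pr -` (pr ` V))) (\<psi> \<circ> inv_into V pr \<circ> pr \<circ> inv_into U \<phi>)"
proof -
  have opV: "openin (mtop P) V" using maximal_atlas_chart[OF V(1)] by simp
  have UP: "U \<subseteq> pts P" by (rule chart_subset[OF maximal_atlas_chart[OF U]])
  have "smooth_on (\<phi> ` (U \<inter> pr -` (pr ` V))) (\<psi> \<circ> (\<lambda>q. inv_into V pr (pr q)) \<circ> inv_into U \<phi>)"
  proof (rule smooth_on_maximal_charts[OF P P U V(1)])
    show "inv_into V pr (pr p) \<in> V" if "p \<in> U \<inter> pr -` (pr ` V)" for p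
      using that by (auto intro: inv_into_into)
    show "\<exists>N g. openin (mtop P) N \<and> p \<in> N \<and> smooth_map P P g \<and> (\<forall>q\<in>N. inv_into V pr (pr q) = g q)"
      if "p \<in> U \<inter> pr -` (pr ` V)" for p
      using that UP by (intro local_inverse_pr_smooth[OF opV V(2)]) auto
  qed auto
  then show ?thesis by (simp add: comp_def)
qed

lemma compatible_M:
  assumes U: "(U, \<phi>) \<in> maximal_atlas P" "inj_on pr U" and V: "(V, \<psi>) \<in> maximal_atlas P" "inj_on pr V"
  shows "smooth_on ((\<phi> \<circ> inv_into U pr) ` (pr ` U \<inter> pr ` V))
    ((\<psi> \<circ> inv_into V pr) \<circ> inv_into (pr ` U) (\<phi> \<circ> inv_into U pr))"
proof -
  have chU: "chart (mtop P) (U, \<phi>)" using U(1) by (rule maximal_atlas_chart)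
  have e: "(\<phi> \<circ> inv_into U pr) ` (pr ` U \<inter> pr ` V) = \<phi> ` (U \<inter> pr -` (pr ` V))"
  proof -
    have "pr ` U \<inter> pr ` V = pr ` (U \<inter> pr -` (pr ` V))" by auto
    moreover have "(\<phi> \<circ> inv_into U pr) ` pr ` (U \<inter> pr -` (pr ` V)) = \<phi> ` (U \<inter> pr -` (pr ` V))"
      unfolding image_image comp_def
      by (rule image_cong[OF refl]) (metis IntD1 inv_into_f_f[OF U(2)])
    ultimately show ?thesis by (simp only:)
  qed
  have "openin (mtop M) (pr ` V)" using maximal_atlas_chart[OF V(1)] by (intro openin_pr_image) simp
  then have "openin (mtop P) {p \<in> pts P. pr p \<in> pr ` V}" by (simp add: openin_M)
  moreover have "U \<inter> pr -` (pr ` V) = U \<inter> {p \<in> pts P. pr p \<in> pr ` V}" using chart_subset[OF chU] by auto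
  ultimately have op: "open (\<phi> ` (U \<inter> pr -` (pr ` V)))"
    using chart_open_image_Int[OF chU] by simp
  show ?thesis
    unfolding e
  proof (rule smooth_on_cong[OF op smooth_on_into_M[OF U(1) V]])
    fix x assume "x \<in> \<phi> ` (U \<inter> pr -` (pr ` V))"
    then obtain p where "p \<in> U" "x = \<phi> p" by blast
    then show "(\<psi> \<circ> inv_into V pr \<circ> pr \<circ> inv_into U \<phi>) x
        = ((\<psi> \<circ> inv_into V pr) \<circ> inv_into (pr ` U) (\<phi> \<circ> inv_into U pr)) x"
      by (simp add: inv_into_chart_M[OF U] chart_inv_into[OF chU])
  qed
qed

text \<open>Cutting a chart down to a level set of the label suffices: two points of one orbit with
  equal labels differ by a group element \<open>z\<close> with \<open>z * a x = a x\<close>, so they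
  coincide. The level set is open since the label is locally constant.\<close>

lemma injective_chart:
  assumes p: "p \<in> pts P"
  obtains U \<phi> where "(U, \<phi>) \<in> maximal_atlas P" "inj_on pr U" "p \<in> U"
proof -
  obtain U \<phi> where U: "(U, \<phi>) \<in> atlas P" "p \<in> U" by (rule manifold_chart_at[OF P p])
  have ch: "chart (mtop P) (U, \<phi>)" by (rule manifold_chart[OF P U(1)])
  define W where "W = U \<inter> {q \<in> pts P. a q \<in> {a p}}"
  have W: "openin (mtop P) W" unfolding W_def using openin_label[OF p] ch by auto
  have "(W, \<phi>) \<in> maximal_atlas P"
    by (rule maximal_atlas_restrict[OF P subsetD[OF atlas_subset_maximal[OF P] U(1)] W]) (auto simp: W_def)
  moreover have "inj_on pr W"
  proof (rule inj_onI)
    fix x y assume xy: "x \<in> W" "y \<in> W" "pr x = pr y"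
    then have x: "x \<in> pts P" "y \<in> pts P" by (auto simp: W_def)
    obtain z where z: "z \<in> G" "y = \<sigma> x z" by (rule pr_eqD[OF x xy(3)])
    have "a y = a x" using xy(1,2) by (simp add: W_def)
    then have "z * a x = a x" using z equivariant[OF x(1) z(1)] by simp
    then have "z = 1" using G0[OF a_in[OF x(1)]] by simp
    then show "x = y" using z \<sigma>_one[OF x(1)] by simp
  qed
  moreover have "p \<in> W" using p U by (simp add: W_def)
  ultimately show ?thesis by (rule that)
qed

lemma manifold_M: "manifold M"
  unfolding manifold_def
proof (intro conjI ballI)
  show "\<exists>B::'e set. finite B \<and> span B = UNIV" using P by (simp add: manifold_def)
  show "Hausdorff_space (mtop M)" by (rule Hausdorff_M)
  have "second_countable (mtop P)" using P by (simp add: manifold_def)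
  with retraction_pr show "second_countable (mtop M)" by (rule second_countable_retraction_map_image)
  show "paracompact_space (mtop M)" by (rule paracompact_M)
  show "chart (mtop M) c" if "c \<in> atlas M" for c
    using that chart_M unfolding atlas_M by (auto simp del: chart.simps)
  show "(\<Union>c\<in>atlas M. fst c) = pts M"
  proof
    show "(\<Union>c\<in>atlas M. fst c) \<subseteq> pts M"
      using maximal_atlas_chart[THEN chart_subset] unfolding atlas_M pts_M by fastforce
    show "pts M \<subseteq> (\<Union>c\<in>atlas M. fst c)"
    proof
      fix x assume "x \<in> pts M"
      then obtain p where p: "p \<in> pts P" "x = pr p" by (auto simp: pts_M)
      obtain U \<phi> where U: "(U, \<phi>) \<in> maximal_atlas P" "inj_on pr U" "p \<in> U" by (rule injective_chart[OF p(1)])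
      then have "(pr ` U, \<phi> \<circ> inv_into U pr) \<in> atlas M" unfolding atlas_M by blast
      moreover have "x \<in> fst (pr ` U, \<phi> \<circ> inv_into U pr)" using U p by simp
      ultimately show "x \<in> (\<Union>c\<in>atlas M. fst c)" by (rule UN_I)
    qed
  qed
  fix c d assume "c \<in> atlas M" "d \<in> atlas M"
  then obtain U \<phi> V \<psi> where
    c: "c = (pr ` U, \<phi> \<circ> inv_into U pr)" "(U, \<phi>) \<in> maximal_atlas P" "inj_on pr U" and
    d: "d = (pr ` V, \<psi> \<circ> inv_into V pr)" "(V, \<psi>) \<in> maximal_atlas P" "inj_on pr V"
    unfolding atlas_M by blast
  show "compatible c d"
    using compatible_M[OF c(2,3) d(2,3)] compatible_M[OF d(2,3) c(2,3)]
    unfolding c(1) d(1) by (simp add: Int_commute)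
qed

section \<open>Smoothness of projection and section, and the trivialisation\<close>

lemma smooth_pr: "smooth_map P M pr"
proof (rule smooth_mapI[OF continuous_pr])
  fix U \<phi> V' \<psi>' assume U: "(U, \<phi>) \<in> atlas P" and "(V', \<psi>') \<in> atlas M"
  then obtain V \<psi> where V: "V' = pr ` V" "\<psi>' = \<psi> \<circ> inv_into V pr" "(V, \<psi>) \<in> maximal_atlas P" "inj_on pr V"
    unfolding atlas_M by blast
  show "smooth_on (\<phi> ` (U \<inter> pr -` V')) (\<psi>' \<circ> pr \<circ> inv_into U \<phi>)"
    unfolding V(1,2) using smooth_on_into_M[OF subsetD[OF atlas_subset_maximal[OF P] U] V(3,4)] .
qed

text \<open>In the charts of the orbit space, which come from charts of \<open>P\<close>, the
  section has the coordinate expression of the smooth retraction \<open>r\<close>.\<close>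

lemma smooth_s: "smooth_map M P s"
proof (rule smooth_mapI[OF continuous_s])
  fix U' \<phi>' V \<psi> assume "(U', \<phi>') \<in> atlas M" and V: "(V, \<psi>) \<in> atlas P"
  then obtain U \<phi> where U: "U' = pr ` U" "\<phi>' = \<phi> \<circ> inv_into U pr" "(U, \<phi>) \<in> maximal_atlas P" "inj_on pr U"
    unfolding atlas_M by blast
  have chU: "chart (mtop P) (U, \<phi>)" using U(3) by (rule maximal_atlas_chart)
  have UP: "U \<subseteq> pts P" by (rule chart_subset[OF chU])
  have opV: "openin (mtop P) V" using manifold_chart[OF P V] by simp
  have sr: "smooth_on (\<phi> ` (U \<inter> r -` V)) (\<psi> \<circ> r \<circ> inv_into U \<phi>)"
    by (rule smooth_on_maximal_charts[OF P P U(3) subsetD[OF atlas_subset_maximal[OF P] V]])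
       (use smooth_r openin_topspace[of "mtop P"] UP in blast)+
  have e: "\<phi>' ` (U' \<inter> s -` V) = \<phi> ` (U \<inter> r -` V)"
  proof -
    have "U' \<inter> s -` V = pr ` (U \<inter> r -` V)" using U(1) s_pr UP by force
    moreover have "(\<phi> \<circ> inv_into U pr) ` pr ` (U \<inter> r -` V) = \<phi> ` (U \<inter> r -` V)"
      unfolding image_image comp_def
      by (rule image_cong[OF refl]) (metis IntD1 inv_into_f_f[OF U(4)])
    ultimately show ?thesis by (simp only: U(2))
  qed
  have "U \<inter> r -` V = U \<inter> {p \<in> pts P. r p \<in> V}" using UP by auto
  then have op: "open (\<phi> ` (U \<inter> r -` V))"
    using chart_open_image_Int[OF chU openin_continuous_map_preimage[OF continuous_r opV]] by simp
  show "smooth_on (\<phi>' ` (U' \<inter> s -` V)) (\<psi> \<circ> s \<circ> inv_into U' \<phi>')"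
    unfolding e
  proof (rule smooth_on_cong[OF op sr])
    fix x assume "x \<in> \<phi> ` (U \<inter> r -` V)"
    then obtain p where p: "p \<in> U" "x = \<phi> p" by blast
    then show "(\<psi> \<circ> r \<circ> inv_into U \<phi>) x = (\<psi> \<circ> s \<circ> inv_into U' \<phi>') x"
      using inv_into_chart_M[OF U(3,4) p(1)] s_pr[of p] UP
      by (auto simp: chart_inv_into[OF chU] U(1,2))
  qed
qed

lemma bundle_equivalent_product: "bundle_equivalent n P pr \<sigma> (prod_discrete M G) fst product_action"
  unfolding bundle_equivalent_def
proof (intro exI conjI ballI)
  \<comment> \<open>The inverse starts at the point of the section over \<open>x\<close>, which has
    label 1, and moves it by \<open>w\<close>; equivariance makes \<open>w\<close> its
    label.\<close>
  let ?\<Phi> = "\<lambda>p. (pr p, a p)" and ?k = "\<lambda>(x, w). \<sigma> (s x) w"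
  have pts: "pts (prod_discrete M G) = pts M \<times> G" by (simp add: prod_discrete_def)
  show "diffeomorphism P (prod_discrete M G) ?\<Phi>"
    unfolding diffeomorphism_def
  proof (intro conjI exI ballI)
    show "smooth_map P (prod_discrete M G) ?\<Phi>" by (rule smooth_map_into_prod_discrete[OF smooth_pr label])
    show "smooth_map (prod_discrete M G) P ?k"
      unfolding smooth_map_prod_discrete_iff[OF manifold_M P]
      using smooth_map_compose[OF manifold_M P P smooth_s smooth_\<sigma>] by simp
    show "?k (?\<Phi> p) = p" if "p \<in> pts P" for p
      using that G0[OF a_in[OF that]] \<sigma>_mult[OF that inverse_in_Cn[OF a_in[OF that]] a_in[OF that]]
      by (simp add: s_pr r_def \<sigma>_one)
    show "?\<Phi> (?k x) = x" if "x \<in> pts (prod_discrete M G)" for x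
    proof -
      obtain y w where x: "x = (y, w)" "y \<in> pts M" "w \<in> G" using \<open>x \<in> pts (prod_discrete M G)\<close> pts by auto
      then show ?thesis
        using pr_\<sigma>[OF s_in[OF x(2)] x(3)] equivariant[OF s_in[OF x(2)] x(3)] by (simp add: pr_s a_s)
    qed
  qed
  show "?\<Phi> (\<sigma> p z) = product_action (?\<Phi> p) z" if "p \<in> pts P" "z \<in> G" for p z
    using pr_\<sigma>[OF that] equivariant[OF that] by (simp add: product_action_def mult.commute)
qed simp

lemma trivial_bundle: "trivial_principal_bundle n P M pr \<sigma>"
proof -
  have "\<exists>U. openin (mtop M) U \<and> x \<in> U \<and> bundle_equivalent n (open_submanifold P {p \<in> pts P. pr p \<in> U}) pr \<sigma>
      (prod_discrete (open_submanifold M U) G) fst product_action" if "x \<in> pts M" for x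
  proof (intro exI conjI)
    show "openin (mtop M) (pts M)" by simp
    have "{p \<in> pts P. pr p \<in> pts M} = pts P" by (auto simp: pts_M)
    then show "bundle_equivalent n (open_submanifold P {p \<in> pts P. pr p \<in> pts M}) pr \<sigma>
        (prod_discrete (open_submanifold M (pts M)) G) fst product_action"
      using bundle_equivalent_product open_submanifold_pts[OF P] open_submanifold_pts[OF manifold_M] by simp
  qed (rule that)
  then show ?thesis
    unfolding trivial_principal_bundle_def principal_bundle_def
    using P manifold_M smooth_pr action pr_\<sigma> bundle_equivalent_product by blast
qed

end


section \<open>The action induced by a dynamical system\<close>

text \<open>Evaluation is controlled by the seminorm with no derivatives and the one-point compact
  set \<open>{\<phi> p}\<close>.\<close>

lemma continuous_evaluation:
  assumes P: "manifold P" and p: "p \<in> pts P"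
  shows "continuous_map (smooth_topology P) euclidean (\<lambda>f. f p)"
proof -
  obtain U \<phi> where U: "(U, \<phi>) \<in> atlas P" "p \<in> U" by (rule manifold_chart_at[OF P p])
  have inv: "inv_into U \<phi> (\<phi> p) = p" by (rule chart_inv_into[OF manifold_chart[OF P U(1)] U(2)])
  have "openin (smooth_topology P) {f \<in> smooth_functions P. f p \<in> S}" if S: "open S" for S
  proof (subst openin_subopen, intro ballI)
    fix f assume f: "f \<in> {f \<in> smooth_functions P. f p \<in> S}"
    then obtain e where e: "e > 0" "ball (f p) e \<subseteq> S" using S open_contains_ball by blast
    have "uniform_limit {\<phi> p} (\<lambda>f. iter_deriv [] (f \<circ> inv_into U \<phi>)) (iter_deriv [] (f \<circ> inv_into U \<phi>))
        (nhdsin (smooth_topology P) f)"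
      by (rule uniform_limit_iter_deriv) (use f U in auto)
    from uniform_limitD[OF this e(1)] have "\<forall>\<^sub>F g in nhdsin (smooth_topology P) f. dist (g p) (f p) < e"
      by (simp add: inv)
    then obtain N where N: "openin (smooth_topology P) N" "f \<in> N" "\<forall>g\<in>N. dist (g p) (f p) < e"
      unfolding eventually_nhdsin using f by (auto simp: topspace_smooth_topology)
    have "N \<subseteq> {f \<in> smooth_functions P. f p \<in> S}"
      using N(3) e(2) openin_subset[OF N(1)] by (auto simp: topspace_smooth_topology dist_commute)
    then show "\<exists>T. openin (smooth_topology P) T \<and> f \<in> T \<and> T \<subseteq> {f \<in> smooth_functions P. f p \<in> S}"
      using N(1,2) by blast
  qed
  then show ?thesis by (auto simp: continuous_map topspace_smooth_topology)
qed

lemma alg_Aut_mult: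
  assumes "f \<in> carrier (alg_Aut A)" "g \<in> carrier (alg_Aut A)"
  shows "f \<otimes>\<^bsub>alg_Aut A\<^esub> g = compose (carrier A) f g"
  using assms by (simp add: alg_Aut_def BijGroup_def)

locale smooth_dynamical_system =
  fixes P :: "('a, 'e::real_inner) mfd" and n :: nat and \<alpha> :: "complex \<Rightarrow> ('a \<Rightarrow> complex) \<Rightarrow> 'a \<Rightarrow> complex"
  assumes P: "manifold P" and n: "n \<ge> 1" and dyn: "dynamical_system n (C_infinity P) \<alpha>"
begin

abbreviation "G \<equiv> carrier (Cn n)"
abbreviation "\<sigma> \<equiv> induced_action P \<alpha>"

lemma aut:
  assumes "z \<in> G"
  shows "\<alpha> z \<in> carrier (alg_Aut (C_infinity P))"
  using dyn assms unfolding dynamical_system_def by (auto dest: hom_in_carrier)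

lemma \<alpha>_in: "z \<in> G \<Longrightarrow> f \<in> smooth_functions P \<Longrightarrow> \<alpha> z f \<in> smooth_functions P"
  using aut by (fastforce simp: alg_Aut_def Bij_def bij_betw_def C_infinity_simps)

lemma \<alpha>_hom:
  assumes "z \<in> G" "f \<in> smooth_functions P" "g \<in> smooth_functions P"
  shows "\<alpha> z (\<lambda>p\<in>pts P. f p + g p) = (\<lambda>p\<in>pts P. \<alpha> z f p + \<alpha> z g p)"
    "\<alpha> z (\<lambda>p\<in>pts P. f p * g p) = (\<lambda>p\<in>pts P. \<alpha> z f p * \<alpha> z g p)"
    "\<alpha> z (\<lambda>p\<in>pts P. c * f p) = (\<lambda>p\<in>pts P. c * \<alpha> z f p)"
  using aut[OF assms(1)] assms(2,3) by (auto simp: alg_Aut_def ring_hom_def C_infinity_simps)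

lemma \<alpha>_unit: "z \<in> G \<Longrightarrow> \<alpha> z (\<lambda>p\<in>pts P. 1) = (\<lambda>p\<in>pts P. 1)"
  using aut by (auto simp: alg_Aut_def ring_hom_def C_infinity_simps)

lemma \<alpha>_mult:
  assumes "z \<in> G" "w \<in> G" "f \<in> smooth_functions P"
  shows "\<alpha> (z * w) f = \<alpha> z (\<alpha> w f)"
proof -
  have "\<alpha> (z \<otimes>\<^bsub>Cn n\<^esub> w) = \<alpha> z \<otimes>\<^bsub>alg_Aut (C_infinity P)\<^esub> \<alpha> w"
    using dyn assms unfolding dynamical_system_def by (auto intro: hom_mult)
  then show ?thesis
    using assms(3) by (simp add: alg_Aut_mult[OF aut aut] assms(1,2) Cn_simps(2) compose_def C_infinity_simps)
qed

text \<open>Membership in \<open>hom\<close> states multiplicativity only. It makes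
  \<open>\<alpha> 1\<close> idempotent, and an injective idempotent map is the identity.\<close>

lemma \<alpha>_one:
  assumes f: "f \<in> smooth_functions P"
  shows "\<alpha> 1 f = f"
proof -
  have inj: "inj_on (\<alpha> 1) (smooth_functions P)"
    using aut[OF one_in_Cn] by (auto simp: alg_Aut_def Bij_def bij_betw_def C_infinity_simps)
  have "\<alpha> 1 (\<alpha> 1 f) = \<alpha> 1 f" using \<alpha>_mult[OF one_in_Cn one_in_Cn f] by simp
  then show ?thesis using inj_onD[OF inj] \<alpha>_in[OF one_in_Cn f] f by blast
qed

lemma continuous_\<alpha>:
  assumes "z \<in> G"
  shows "continuous_map (smooth_topology P) (smooth_topology P) (\<alpha> z)"
proof -
  have c: "continuous_map (prod_topology (discrete_topology G) (smooth_topology P)) (smooth_topology P) (\<lambda>(z, a). \<alpha> z a)"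
    using dyn by (simp add: dynamical_system_def C_infinity_simps)
  have "continuous_map (smooth_topology P) (prod_topology (discrete_topology G) (smooth_topology P)) (\<lambda>f. (z, f))"
    using assms by (simp add: continuous_map_pairwise comp_def)
  from continuous_map_compose[OF this c] show ?thesis by (simp add: comp_def)
qed

text \<open>Justifies the definite description behind the induced action: the theorem on continuous
  characters gives existence of the point, separation of points by smooth functions gives
  uniqueness.\<close>

lemma \<sigma>_evaluation:
  assumes p: "p \<in> pts P" and z: "z \<in> G"
  shows "\<sigma> p z \<in> pts P" "f \<in> smooth_functions P \<Longrightarrow> f (\<sigma> p z) = \<alpha> z f p"
proof -
  have "continuous_map (smooth_topology P) euclidean (\<lambda>f. \<alpha> z f p)"
    using continuous_map_compose[OF continuous_\<alpha>[OF z] continuous_evaluation[OF P p]] by (simp add: comp_def)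
  then have "\<exists>q\<in>pts P. \<forall>f\<in>smooth_functions P. \<alpha> z f p = f q"
    by (rule continuous_character_is_evaluation[OF P])
       (use p \<alpha>_hom[OF z] \<alpha>_unit[OF z] in auto)
  then obtain q where q: "q \<in> pts P" "\<And>f. f \<in> smooth_functions P \<Longrightarrow> \<alpha> z f p = f q" by blast
  have iff: "point_eval P x = compose (carrier (C_infinity P)) (point_eval P p) (\<alpha> z) \<longleftrightarrow>
      (\<forall>f\<in>smooth_functions P. f x = \<alpha> z f p)" for x
  proof -
    have "compose (carrier (C_infinity P)) (point_eval P p) (\<alpha> z) = (\<lambda>f\<in>smooth_functions P. \<alpha> z f p)"
      using \<alpha>_in[OF z] by (auto simp: compose_def point_eval_def C_infinity_simps fun_eq_iff)
    then show ?thesis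
      by (auto simp: point_eval_def C_infinity_simps restrict_def fun_eq_iff)
  qed
  have "\<sigma> p z = q"
    unfolding induced_action_def
  proof (rule the_equality)
    show "q \<in> pts P \<and> point_eval P q = compose (carrier (C_infinity P)) (point_eval P p) (\<alpha> z)"
      unfolding iff using q by simp
    fix x assume "x \<in> pts P \<and> point_eval P x = compose (carrier (C_infinity P)) (point_eval P p) (\<alpha> z)"
    then have x: "x \<in> pts P" "\<forall>f\<in>smooth_functions P. f x = \<alpha> z f p" unfolding iff by auto
    show "x = q"
    proof (rule ccontr)
      assume "x \<noteq> q"
      then obtain f where "f \<in> smooth_functions P" "f x \<noteq> f q"
        using smooth_functions_separate[OF P x(1) q(1)] by blast
      then show False using x(2) q(2) by simp
    qed
  qed
  with q show "\<sigma> p z \<in> pts P" "f \<in> smooth_functions P \<Longrightarrow> f (\<sigma> p z) = \<alpha> z f p" by auto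
qed

lemma pts_eqI:
  assumes "p \<in> pts P" "q \<in> pts P" "\<And>f. f \<in> smooth_functions P \<Longrightarrow> f p = f q"
  shows "p = q"
  using smooth_functions_separate[OF P assms(1,2)] assms(3) by blast

text \<open>Pullback along the action of \<open>z\<close> is \<open>\<alpha> z\<close>, so smooth
  functions stay smooth and the pullback criterion applies. Equalities of points are checked on
  functions: the value of \<open>f\<close> at \<open>\<sigma> (\<sigma> p z) w\<close> is
  \<open>\<alpha> z (\<alpha> w f) p\<close>, and multiplicativity of \<open>\<alpha>\<close> gives
  the law of a right action.\<close>

lemma smooth_action_\<sigma>: "smooth_action n P \<sigma>"
  unfolding smooth_action_def
proof (intro conjI ballI)
  have "smooth_map P P (\<lambda>p. \<sigma> p z)" if z: "z \<in> G" for z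
  proof (rule smooth_map_if_pullbacks_smooth[OF P P])
    show "\<sigma> p z \<in> pts P" if "p \<in> pts P" for p by (rule \<sigma>_evaluation(1)[OF that z])
    fix f assume f: "f \<in> smooth_functions P"
    have "(\<lambda>p\<in>pts P. f (\<sigma> p z)) = restrict (\<alpha> z f) (pts P)"
      using \<sigma>_evaluation(2)[OF _ z f] by auto
    then show "(\<lambda>p\<in>pts P. f (\<sigma> p z)) \<in> smooth_functions P"
      using \<alpha>_in[OF z f] smooth_functions_restrict by metis
  qed
  then show "smooth_map (prod_discrete P G) P (\<lambda>(p, z). \<sigma> p z)"
    by (simp add: smooth_map_prod_discrete_iff[OF P P])
  fix p assume p: "p \<in> pts P"
  show "\<sigma> p 1 = p"
    by (rule pts_eqI) (simp_all add: \<sigma>_evaluation[OF p one_in_Cn] p \<alpha>_one)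
  fix z w assume zw: "z \<in> G" "w \<in> G"
  note pz = \<sigma>_evaluation(1)[OF p zw(1)]
  show "\<sigma> (\<sigma> p z) w = \<sigma> p (z * w)"
    by (rule pts_eqI)
       (simp_all add: \<sigma>_evaluation[OF pz zw(2)] \<sigma>_evaluation[OF p mult_in_Cn[OF zw]]
         \<sigma>_evaluation(2)[OF p zw(1) \<alpha>_in[OF zw(2)]] \<alpha>_mult[OF zw])
qed

text \<open>The component indices run below \<open>n\<close>, so for \<open>n = 1\<close> the index
  1 is replaced by 0; this changes nothing since \<open>zeta n\<close> is then 1. Equivariance under
  the generator spreads to its powers, which exhaust the group.\<close>

lemma isotypic_equivariant:
  assumes f: "f \<in> isotypic n (C_infinity P) \<alpha> (1 mod n)" and p: "p \<in> pts P" and z: "z \<in> G"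
  shows "f (\<sigma> p z) = z * f p"
proof -
  have sf: "f \<in> smooth_functions P" using f by (simp add: isotypic_def C_infinity_simps)
  have \<zeta>: "zeta n \<in> G" using zeta_power_in_Cn[OF n, of 1] by simp
  have "zeta n ^ (1 mod n) = zeta n"
  proof (cases "n = 1")
    case True
    then show ?thesis using \<zeta> by (simp add: Cn_simps)
  next
    case False
    then show ?thesis using n by simp
  qed
  then have step: "f (\<sigma> q (zeta n)) = zeta n * f q" if "q \<in> pts P" for q
    using f that \<sigma>_evaluation(2)[OF that \<zeta> sf] by (simp add: isotypic_def C_infinity_simps)
  have "f (\<sigma> p (zeta n ^ k)) = zeta n ^ k * f p" for k
  proof (induction k)
    case 0
    show ?case using smooth_action_\<sigma> p by (simp add: smooth_action_def)
  next
    case (Suc k)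
    have "\<sigma> p (zeta n ^ Suc k) = \<sigma> (\<sigma> p (zeta n ^ k)) (zeta n)"
      using smooth_action_\<sigma> p \<zeta> zeta_power_in_Cn[OF n, of k] by (simp add: smooth_action_def mult.commute)
    then show ?case
      using Suc step[OF \<sigma>_evaluation(1)[OF p zeta_power_in_Cn[OF n, of k]]] by (simp add: mult.assoc)
  qed
  then show ?thesis using z by (auto simp: Cn_eq_zeta_powers[OF n])
qed

end

section \<open>From an n-th root of the unit function to a label\<close>

lemma nat_pow_C_infinity:
  assumes P: "manifold P" and p: "p \<in> pts P"
  shows "(f [^]\<^bsub>C_infinity P\<^esub> (m :: nat)) p = f p ^ m"
proof -
  interpret ring "C_infinity P" by (rule ring_C_infinity[OF P])
  show ?thesis
    by (induction m) (use p in \<open>simp_all add: C_infinity_simps mult.commute\<close>)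
qed

text \<open>A finite set of complex numbers is discrete: the complement of \<open>G - T\<close> is
  open and meets \<open>G\<close> exactly in \<open>T\<close>.\<close>

lemma continuous_map_into_finite_discrete:
  fixes a :: "'a \<Rightarrow> complex"
  assumes a: "continuous_map X euclidean a" and "finite G" "\<And>x. x \<in> topspace X \<Longrightarrow> a x \<in> G"
  shows "continuous_map X (discrete_topology G) a"
proof -
  have "openin X {x \<in> topspace X. a x \<in> T}" if "T \<subseteq> G" for T
  proof -
    have "open (- (G - T))" using assms(2) by (intro open_Compl finite_imp_closed) simp
    then have "openin X {x \<in> topspace X. a x \<in> - (G - T)}"
      by (intro openin_continuous_map_preimage[OF a]) simp
    moreover have "{x \<in> topspace X. a x \<in> - (G - T)} = {x \<in> topspace X. a x \<in> T}"
      using assms(3) that by auto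
    ultimately show ?thesis by simp
  qed
  then show ?thesis using assms(3) by (auto simp: continuous_map)
qed

lemma trivial_nc_bundle_imp_trivial_bundle:
  assumes P: "manifold P" and n: "n \<ge> 1" and triv: "trivial_nc_principal_bundle n (C_infinity P) \<alpha>"
  shows "smooth_action n P (induced_action P \<alpha>) \<and> free_action n P (induced_action P \<alpha>) \<and>
    proper_action n P (induced_action P \<alpha>) \<and>
    trivial_principal_bundle n P (orbit_manifold n P (induced_action P \<alpha>))
      (orbit_map n (induced_action P \<alpha>)) (induced_action P \<alpha>)"
proof -
  interpret D: smooth_dynamical_system P n \<alpha>
    using P n triv by unfold_locales (simp_all add: trivial_nc_principal_bundle_def)
  have "1 mod n < n" using n by simp
  then obtain a where a: "a \<in> isotypic n (C_infinity P) \<alpha> (1 mod n)" "a [^]\<^bsub>C_infinity P\<^esub> n = \<one>\<^bsub>C_infinity P\<^esub>"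
    using triv unfolding trivial_nc_principal_bundle_def by blast
  have sa: "a \<in> smooth_functions P" using a(1) by (simp add: isotypic_def C_infinity_simps)
  have aG: "a p \<in> carrier (Cn n)" if p: "p \<in> pts P" for p
  proof -
    have "a p ^ n = 1" using nat_pow_C_infinity[OF P p, of a n] a(2) p by (simp add: C_infinity_simps)
    then show ?thesis using n by (auto simp: Cn_simps zero_power)
  qed
  interpret E: equivariantly_labelled_action P n "induced_action P \<alpha>" a
  proof
    show "continuous_map (mtop P) (discrete_topology (carrier (Cn n))) a"
      by (rule continuous_map_into_finite_discrete[OF smooth_functions_continuous[OF P sa] finite_Cn[OF n] aG])
  qed (use P n D.smooth_action_\<sigma> D.isotypic_equivariant[OF a(1)] in auto)
  show ?thesis using E.action E.free E.proper E.trivial_bundle by blast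
qed


section \<open>The dynamical system of a trivial bundle\<close>

text \<open>The analytic content is continuity. The group is discrete, so joint continuity amounts
  to continuity of each pullback for the smooth compact-open topology.\<close>

lemma dynamical_system_pullback:
  assumes P: "manifold P" and act: "smooth_action n P \<sigma>"
  shows "dynamical_system n (C_infinity P) (pullback_action P \<sigma>)"
proof -
  let ?\<alpha> = "pullback_action P \<sigma>" and ?A = "C_infinity P" and ?G = "carrier (Cn n)"
  have sm: "smooth_map P P (\<lambda>p. \<sigma> p z)" if "z \<in> ?G" for z
    using act smooth_map_prod_discrete_iff[OF P P, of ?G "\<lambda>(p, z). \<sigma> p z"] that
    by (auto simp: smooth_action_def)
  have \<sigma>_in: "\<sigma> p z \<in> pts P" if "p \<in> pts P" "z \<in> ?G" for p z
    using smooth_map_in_pts[OF sm[OF that(2)] that(1)] .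
  have app: "?\<alpha> z f = (\<lambda>p\<in>pts P. f (\<sigma> p z))" if "f \<in> smooth_functions P" for z f
    using that by (simp add: pullback_action_def C_infinity_simps)
  have in_SF: "?\<alpha> z f \<in> smooth_functions P" if "z \<in> ?G" "f \<in> smooth_functions P" for z f
    unfolding app[OF that(2)] by (rule smooth_functions_pullback[OF P P sm[OF that(1)] that(2)])
  have comp: "?\<alpha> z (?\<alpha> w f) = ?\<alpha> (z * w) f" if "z \<in> ?G" "w \<in> ?G" "f \<in> smooth_functions P" for z w f
  proof -
    have "?\<alpha> z (?\<alpha> w f) = (\<lambda>p\<in>pts P. ?\<alpha> w f (\<sigma> p z))" by (rule app[OF in_SF[OF that(2,3)]])
    also have "\<dots> = ?\<alpha> (z * w) f"
      using act that \<sigma>_in by (auto simp: smooth_action_def app)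
    finally show ?thesis .
  qed
  have one: "?\<alpha> 1 f = f" if "f \<in> smooth_functions P" for f
    unfolding app[OF that]
    using act smooth_functions_restrict[OF that] by (auto simp: smooth_action_def cong: restrict_cong)
  \<comment> \<open>The inverse is the action of \<open>inverse z\<close>, which is why composition
    and unit laws are established on functions first.\<close>
  have Bij: "?\<alpha> z \<in> Bij (carrier ?A)" if z: "z \<in> ?G" for z
  proof -
    have z0: "z \<noteq> 0" using z by (simp add: Cn_simps)
    have "bij_betw (?\<alpha> z) (smooth_functions P) (smooth_functions P)"
      by (rule bij_betw_byWitness[where f' = "?\<alpha> (inverse z)"])
         (use z z0 comp[OF inverse_in_Cn[OF z] z] comp[OF z inverse_in_Cn[OF z]] one in_SF[OF z]
           in_SF[OF inverse_in_Cn[OF z]] in auto)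
    then show ?thesis by (simp add: Bij_def pullback_action_def C_infinity_simps)
  qed
  have aut: "?\<alpha> z \<in> carrier (alg_Aut ?A)" if z: "z \<in> ?G" for z
  proof -
    have "?\<alpha> z \<in> ring_hom ?A ?A"
      using in_SF[OF z] \<sigma>_in[OF _ z] smooth_functions_mult[OF P] smooth_functions_add[OF P] smooth_functions_const[OF P]
      by (intro ring_hom_memI) (auto simp: C_infinity_simps app)
    moreover have "?\<alpha> z (c \<odot>\<^bsub>?A\<^esub> f) = c \<odot>\<^bsub>?A\<^esub> ?\<alpha> z f" if "f \<in> carrier ?A" for c f
      using that \<sigma>_in[OF _ z] smooth_functions_scale[OF P] by (auto simp: C_infinity_simps app)
    ultimately show ?thesis using Bij[OF z] by (simp add: alg_Aut_def)
  qed
  have "?\<alpha> \<in> hom (Cn n) (alg_Aut ?A)"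
  proof (rule homI)
    fix z w assume zw: "z \<in> ?G" "w \<in> ?G"
    \<comment> \<open>An equality of functions on the whole type: off the carrier both sides are
      \<open>undefined\<close>.\<close>
    have "?\<alpha> (z * w) = compose (carrier ?A) (?\<alpha> z) (?\<alpha> w)"
    proof
      fix f
      show "?\<alpha> (z * w) f = compose (carrier ?A) (?\<alpha> z) (?\<alpha> w) f"
      proof (cases "f \<in> smooth_functions P")
        case True
        then show ?thesis using comp[OF zw True] by (simp add: compose_def C_infinity_simps)
      next
        case False
        then show ?thesis by (simp add: compose_def C_infinity_simps pullback_action_def)
      qed
    qed
    then show "?\<alpha> (z \<otimes>\<^bsub>Cn n\<^esub> w) = ?\<alpha> z \<otimes>\<^bsub>alg_Aut ?A\<^esub> ?\<alpha> w"
      by (simp add: Cn_simps(2) alg_Aut_mult[OF aut[OF zw(1)] aut[OF zw(2)]])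
  qed (rule aut)
  moreover have "continuous_map (prod_topology (discrete_topology ?G) (topo ?A)) (topo ?A) (\<lambda>(z, a). ?\<alpha> z a)"
  proof -
    let ?X = "smooth_topology P"
    have "continuous_map ?X ?X (?\<alpha> z)" if "z \<in> ?G" for z
      by (rule continuous_map_eq[OF continuous_map_pullback[OF P P sm[OF that]]])
         (simp add: topspace_smooth_topology app)
    then have "continuous_map (prod_topology ?X (discrete_topology ?G)) ?X (\<lambda>y. ?\<alpha> (snd y) (fst y))"
      by (simp add: continuous_map_prod_discrete_iff)
    \<comment> \<open>The slice criterion expects the discrete factor on the right, whereas a
      dynamical system has it on the left, so the factors are exchanged.\<close>
    moreover have "continuous_map (prod_topology (discrete_topology ?G) ?X) (prod_topology ?X (discrete_topology ?G))
        (\<lambda>y. (snd y, fst y))"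
      by (intro continuous_map_paired[THEN iffD2] conjI continuous_map_snd continuous_map_fst)
    ultimately have "continuous_map (prod_topology (discrete_topology ?G) ?X) ?X
        ((\<lambda>y. ?\<alpha> (snd y) (fst y)) \<circ> (\<lambda>y. (snd y, fst y)))"
      by (intro continuous_map_compose)
    then show ?thesis by (simp add: C_infinity_simps comp_def case_prod_unfold)
  qed
  ultimately show ?thesis
    using unital_lc_algebra_C_infinity[OF P] by (simp add: dynamical_system_def)
qed

lemma trivial_bundle_imp_trivial_nc_bundle:
  assumes P: "manifold P" and n: "n \<ge> 1" and triv: "trivial_principal_bundle n P M q \<sigma>"
  shows "trivial_nc_principal_bundle n (C_infinity P) (pullback_action P \<sigma>)"
  unfolding trivial_nc_principal_bundle_def
proof (intro conjI allI impI)
  let ?A = "C_infinity P" and ?G = "carrier (Cn n)"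
  have act: "smooth_action n P \<sigma>"
    using triv by (simp add: trivial_principal_bundle_def principal_bundle_def)
  show "dynamical_system n ?A (pullback_action P \<sigma>)" by (rule dynamical_system_pullback[OF P act])
  fix k assume "k < n"
  obtain \<Phi> where \<Phi>: "smooth_map P (prod_discrete M ?G) \<Phi>"
    "\<And>p z. p \<in> pts P \<Longrightarrow> z \<in> ?G \<Longrightarrow> \<Phi> (\<sigma> p z) = product_action (\<Phi> p) z"
    using triv unfolding trivial_principal_bundle_def bundle_equivalent_def diffeomorphism_def by blast
  define u where "u = (\<lambda>p. snd (\<Phi> p))"
  have "continuous_map (mtop P) (prod_topology (mtop M) (discrete_topology ?G)) \<Phi>"
    using smooth_map_continuous[OF \<Phi>(1)] by (simp add: prod_discrete_def)
  then have u: "continuous_map (mtop P) (discrete_topology ?G) u"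
    using continuous_map_compose[OF _ continuous_map_snd] unfolding u_def comp_def by blast
  have uG: "u p \<noteq> 0" "u p ^ n = 1" if "p \<in> pts P" for p
    using u that by (auto simp: continuous_map_def Cn_simps)
  have \<sigma>_in: "\<sigma> p z \<in> pts P" if "p \<in> pts P" "z \<in> ?G" for p z
    using smooth_map_in_pts[of "prod_discrete P ?G" P "\<lambda>(p, z). \<sigma> p z" "(p, z)"] act that
    by (simp add: smooth_action_def prod_discrete_def)
  have \<zeta>: "zeta n \<in> ?G" using zeta_power_in_Cn[OF n, of 1] by simp
  define a where "a = (\<lambda>p\<in>pts P. u p ^ k)"
  define b where "b = (\<lambda>p\<in>pts P. inverse (u p ^ k))"
  have a: "a \<in> smooth_functions P"
    unfolding a_def by (rule smooth_functions_locally_constant[OF P u, of "\<lambda>w. w ^ k"])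
  have b: "b \<in> smooth_functions P"
    unfolding b_def by (rule smooth_functions_locally_constant[OF P u, of "\<lambda>w. inverse (w ^ k)"])
  have "u (\<sigma> p (zeta n)) = u p * zeta n" if "p \<in> pts P" for p
    using \<Phi>(2)[OF that \<zeta>] by (simp add: u_def product_action_def case_prod_unfold)
  then have "a \<in> isotypic n ?A (pullback_action P \<sigma>) k"
    using a \<sigma>_in[OF _ \<zeta>]
    by (auto simp: isotypic_def C_infinity_simps pullback_action_def a_def power_mult_distrib mult.commute)
  moreover have "a \<in> Units ?A"
  proof -
    have "a \<otimes>\<^bsub>?A\<^esub> b = \<one>\<^bsub>?A\<^esub>" "b \<otimes>\<^bsub>?A\<^esub> a = \<one>\<^bsub>?A\<^esub>"
      using uG by (auto simp: C_infinity_simps a_def b_def)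
    then show ?thesis using a b unfolding Units_def by (auto simp: C_infinity_simps(1))
  qed
  moreover have "a [^]\<^bsub>?A\<^esub> n = \<one>\<^bsub>?A\<^esub>"
  proof -
    \<comment> \<open>The power is taken in the algebra. Closure of the carrier under powers reduces
      the identity to values at points, where \<open>u p\<close> is an n-th root of unity.\<close>
    interpret ring ?A by (rule ring_C_infinity[OF P])
    have "a [^]\<^bsub>?A\<^esub> n \<in> smooth_functions P"
      using nat_pow_closed[of a n] a by (simp add: C_infinity_simps(1))
    then show ?thesis
    proof (rule smooth_functions_eqI)
      show "\<one>\<^bsub>?A\<^esub> \<in> smooth_functions P" using one_closed by (simp add: C_infinity_simps(1))
      fix p assume p: "p \<in> pts P"
      have "(u p ^ k) ^ n = 1" using uG(2)[OF p] by (metis mult.commute power_mult power_one)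
      then show "(a [^]\<^bsub>?A\<^esub> n) p = \<one>\<^bsub>?A\<^esub> p"
        using p by (simp add: nat_pow_C_infinity[OF P p] C_infinity_simps a_def)
    qed
  qed
  ultimately show "\<exists>a\<in>isotypic n ?A (pullback_action P \<sigma>) k. a \<in> Units ?A \<and> a [^]\<^bsub>?A\<^esub> n = \<one>\<^bsub>?A\<^esub>"
    by blast
qed

theorem theorem2p11:
  fixes P :: "('a, 'e::real_inner) mfd" and n :: nat
  assumes "manifold P" and "n \<ge> 1"
  shows
    "(\<forall>\<alpha>. trivial_nc_principal_bundle n (C_infinity P) \<alpha> \<longrightarrow>
        smooth_action n P (induced_action P \<alpha>) \<and>
        free_action n P (induced_action P \<alpha>) \<and>
        proper_action n P (induced_action P \<alpha>) \<and>
        trivial_principal_bundle n P (orbit_manifold n P (induced_action P \<alpha>))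
          (orbit_map n (induced_action P \<alpha>)) (induced_action P \<alpha>)) \<and>
     (\<forall>(M :: ('m, 'f::real_inner) mfd) q \<sigma>. trivial_principal_bundle n P M q \<sigma> \<longrightarrow>
        trivial_nc_principal_bundle n (C_infinity P) (pullback_action P \<sigma>))"
  using trivial_nc_bundle_imp_trivial_bundle[OF assms] trivial_bundle_imp_trivial_nc_bundle[OF assms]
  by blast

end
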